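(* Let $\mathcal{G}$ be the (infinite) Ginibre ensemble on $\mathbb{C}$. Then for every bounded measurable and compactly supported function $f:\mathbb{R}\to\mathbb{R}$, $$\frac{1}{\sqrt{R}}\sum_{z\in\mathcal{G}}f\big(|z|-R\big)-2\sqrt{R}\int_{\mathbb{R}}f(x)\,\mathrm{d}x\ \xrightarrow[R\to+\infty]{\mathrm{law}}\ \mathcal{N}(0,V_f),$$ where $$V_f=\frac{1}{\sqrt{\pi}}\int_{\mathbb{R}^2}\big[f(x)-f(y)\big]^2e^{-(x-y)^2}\,\mathrm{d}x\,\mathrm{d}y .$$
   Context: Determinantal point processes: let $X$ be a locally compact Polish space with a Radon measure $\mu$, and $K:X\times X\to\mathbb{C}$ measurable. A simple point process $\mathscr{X}$ on $X$ (a random locally finite configuration with no multiple points, identified with a random discrete subset; $\mathscr{X}(\Delta)$ is the number of points in $\Delta$) is determinantal with kernel $K$ with respect to the reference measure $\mu$ if for every $k\ge 1$ and all mutually disjoint pre-compact Borel sets $\Delta_1,\dots,\Delta_k\subset X$, $$\mathbb{E}\Big[\prod_{i=1}^k\mathscr{X}(\Delta_i)\Big]=\int_{\Delta_1\times\cdots\times\Delta_k}\det[K(x_i,x_j)]_{1\le i,j\le k}\,\mathrm{d}\mu(x_1)\cdots\mathrm{d}\mu(x_k).$$ Ginibre ensemble: $\mathcal{G}$ is the determinantal point process on $\mathbb{C}$ with respect to Lebesgue measure $m$ with kernel $K_{\mathcal{G}}(z,w)=\frac{1}{\pi}e^{z\overline{w}-\frac{|z|^2}{2}-\frac{|w|^2}{2}}$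 (equivalently, with reference measure $\frac1\pi e^{-|z|^2}\mathrm{d}m(z)$ and the kernel $e^{z\overline w}$ of the orthogonal projection onto the holomorphic functions). $\mathcal{N}(0,V)$ is the centered real Gaussian law with variance $V$ (the Dirac mass at $0$ if $V=0$). *)

theory Defs
  imports "HOL-Probability.Probability" "Jordan_Normal_Form.Determinant"
begin

definition radon_measure :: "'a::polish_space measure \<Rightarrow> bool" where
  "radon_measure \<mu> \<longleftrightarrow> sets \<mu> = sets borel \<and>
     (\<forall>C. compact C \<longrightarrow> emeasure \<mu> C < \<infinity>) \<and>
     (\<forall>B\<in>sets borel. emeasure \<mu> B = (SUP C\<in>{C. compact C \<and> C \<subseteq> B}. emeasure \<mu> C))"

(* A configuration is a set of points, so simplicity (no multiple points) is built into the type.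
   The counts are finite on pre-compact sets, hence card is the true number of points there. *)
locale simple_point_process = prob_space M
  for M :: "'w measure" +
  fixes X :: "'w \<Rightarrow> 'a::polish_space set"
  assumes locally_finite: "\<omega> \<in> space M \<Longrightarrow> compact C \<Longrightarrow> finite (X \<omega> \<inter> C)"
    and measurable_count: "\<Delta> \<in> sets borel \<Longrightarrow> compact (closure \<Delta>) \<Longrightarrow>
      (\<lambda>\<omega>. real (card (X \<omega> \<inter> \<Delta>))) \<in> borel_measurable M"

(* The integrability assumptions say that both sides of the intensity identity are genuine
   (finite) integrals; without them Bochner integrals would silently be 0. The determinant is
   that of Jordan_Normal_Form, not the one of HOL-Analysis, because the size k varies. *)
locale determinantal_process = simple_point_process M X
  for M :: "'w measure" and X :: "'w \<Rightarrow> 'a::polish_space set" +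
  fixes \<mu> :: "'a measure" and K :: "'a \<Rightarrow> 'a \<Rightarrow> complex"
  assumes locally_compact: "locally_compact_space (euclidean :: 'a topology)"
    and radon: "radon_measure \<mu>"
    and measurable_kernel: "(\<lambda>(x, y). K x y) \<in> borel_measurable (borel \<Otimes>\<^sub>M borel)"
    and integrable_count: "\<And>(k::nat) \<Delta>. k \<ge> 1 \<Longrightarrow>
      (\<And>i. i < k \<Longrightarrow> \<Delta> i \<in> sets borel \<and> compact (closure (\<Delta> i))) \<Longrightarrow>
      disjoint_family_on \<Delta> {..<k} \<Longrightarrow>
      integrable M (\<lambda>\<omega>. \<Prod>i<k. real (card (X \<omega> \<inter> \<Delta> i)))"
    and integrable_det: "\<And>(k::nat) \<Delta>. k \<ge> 1 \<Longrightarrow>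
      (\<And>i. i < k \<Longrightarrow> \<Delta> i \<in> sets borel \<and> compact (closure (\<Delta> i))) \<Longrightarrow>
      disjoint_family_on \<Delta> {..<k} \<Longrightarrow>
      set_integrable (Pi\<^sub>M {..<k} (\<lambda>_. \<mu>)) (Pi\<^sub>E {..<k} \<Delta>)
        (\<lambda>x. Determinant.det (Matrix.mat k k (\<lambda>(i, j). K (x i) (x j))))"
    and intensity: "\<And>(k::nat) \<Delta>. k \<ge> 1 \<Longrightarrow>
      (\<And>i. i < k \<Longrightarrow> \<Delta> i \<in> sets borel \<and> compact (closure (\<Delta> i))) \<Longrightarrow>
      disjoint_family_on \<Delta> {..<k} \<Longrightarrow>
      complex_of_real (expectation (\<lambda>\<omega>. \<Prod>i<k. real (card (X \<omega> \<inter> \<Delta> i)))) =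
        (LINT x:(Pi\<^sub>E {..<k} \<Delta>)|(Pi\<^sub>M {..<k} (\<lambda>_. \<mu>)).
          Determinant.det (Matrix.mat k k (\<lambda>(i, j). K (x i) (x j))))"

definition ginibre_kernel :: "complex \<Rightarrow> complex \<Rightarrow> complex" where
  "ginibre_kernel z w =
     1 / of_real pi * exp (z * cnj w - of_real ((norm z)\<^sup>2) / 2 - of_real ((norm w)\<^sup>2) / 2)"

definition ginibre_ensemble :: "'w measure \<Rightarrow> ('w \<Rightarrow> complex set) \<Rightarrow> bool" where
  "ginibre_ensemble M G \<longleftrightarrow> determinantal_process M G lborel ginibre_kernel"

definition centered_normal :: "real \<Rightarrow> real measure" where
  "centered_normal V =
     (if V = 0 then return borel 0 else density lborel (\<lambda>x. ennreal (normal_density 0 (sqrt V) x)))"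

(* Convergence in law along a continuous parameter R tending to infinity. The library's weak_conv_m
   is about sequences of laws, so R runs along arbitrary sequences tending to infinity; distr is
   only meaningful for measurable maps, hence the first conjunct. *)
definition converges_in_law_at_top ::
    "'w measure \<Rightarrow> (real \<Rightarrow> 'w \<Rightarrow> real) \<Rightarrow> real measure \<Rightarrow> bool" where
  "converges_in_law_at_top M Y N \<longleftrightarrow>
     (\<forall>\<^sub>F R in at_top. Y R \<in> borel_measurable M) \<and>
     (\<forall>r :: nat \<Rightarrow> real. filterlim r at_top sequentially \<longrightarrow>
        weak_conv_m (\<lambda>n. distr M borel (Y (r n))) N)"

definition limit_variance :: "(real \<Rightarrow> real) \<Rightarrow> real" where
  "limit_variance f = 1 / sqrt pi *
     (LINT p|(lborel \<Otimes>\<^sub>M lborel). (f (fst p) - f (snd p))\<^sup>2 * exp (- (fst p - snd p)\<^sup>2))"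

end

theory Submission
  imports Defs "HOL-Real_Asymp.Real_Asymp"
begin

text \<open>
  The Ginibre kernel is the sum of the rank-one kernels of the orthonormal modes
  \<open>z ^ n * exp (- |z|^2 / 2) / sqrt (pi * n!)\<close>, which stay orthogonal on every annulus. Expanding the
  correlation determinants, the product moments of the counts in disjoint annuli therefore agree with
  those of independent points, one drawn from each mode. Cutting a disc into ever thinner annuli, on
  which two points almost never fall together, turns these moments into the characteristic functional:
  the law of a radial linear statistic is that of a sum of independent variables (Kostlan's theorem).
  The Lyapunov estimate then gives the central limit theorem. The sum of the squared means involves
  \<open>(\<Sum>n. (u ^ n / n!)^2)\<close>, a Bessel function, whose asymptotics produce the Gaussian weight in
  the limit variance.
\<close>

section \<open>Lebesgue measure on the complex plane and the Ginibre modes\<close>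

text \<open>The intensity identities speak only of products of counts in disjoint sets, so neither a
  power \<open>u ^ N\<close> of a count nor a pair count in a single set is directly accessible. A
  product of powers \<open>u i ^ N i\<close> over cells is therefore replaced by the product of
  \<open>1 + (u i - 1) * N i\<close>, which is affine in each count and agrees with it as long as no
  cell holds two points. Two a priori bounds control the error: the mean number of pairs in a cell,
  quadratic in its area, and an exponential moment of the number of points in a disc. Both are
  needed for the process as well as for the samples, the latter uniformly in the number
  \<open>T\<close> of modes, because the process involves infinitely many modes and is reached only
  as \<open>T\<close> tends to infinity. For the same reason the central limit step is not a
  triangular array theorem: every fixed \<open>R\<close> already involves infinitely many variables.
  It is an explicit estimate of characteristic functions, linear in the second moments, so that it
  survives the summation over all modes.\<close>

lemma distr_norm_lborel_complex:
  "distr (lborel :: complex measure) borel norm = density lborel (\<lambda>r. ennreal (2 * pi * r))"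
proof -
  have disc: "emeasure (distr (lborel :: complex measure) borel norm) {..a} = ennreal (pi * (max 0 a)\<^sup>2)"
    for a :: real
  proof -
    have *: "emeasure (distr (lborel :: complex measure) borel norm) {..a}
      = emeasure lborel {z::complex. norm z \<le> a}"
      by (subst emeasure_distr) (auto simp: vimage_def)
    show ?thesis
    proof (cases "a \<ge> 0")
      case True
      have "{z::complex. norm z \<le> a} = cball 0 a" by auto
      then show ?thesis using True emeasure_cball[of a "0::complex"]
        by (simp add: * max_def unit_ball_vol_2)
    next
      case False
      have "{z::complex. norm z \<le> a} = {}"
        using False by (auto simp: not_le intro: less_le_trans[OF _ norm_ge_zero])
      then show ?thesis using False unfolding * by (simp add: max_def)
    qed
  qed
  show ?thesis
  proof (rule measure_eqI_generator_eq[where E = "range (\<lambda>a::real. {..a})" and \<Omega> = UNIV and A = "\<lambda>n. {..real n}"])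
    show "Int_stable (range (\<lambda>a::real. {..a}))"
      by (auto simp: Int_stable_def)
    show "range (\<lambda>a::real. {..a}) \<subseteq> Pow UNIV" by auto
    show "sets (distr (lborel :: complex measure) borel norm) = sigma_sets UNIV (range (\<lambda>a::real. {..a}))"
      by (subst sets_distr, subst borel_eq_atMost) auto
    show "sets (density lborel (\<lambda>r. ennreal (2 * pi * r))) = sigma_sets UNIV (range (\<lambda>a::real. {..a}))"
      by (subst sets_density, subst sets_lborel, subst borel_eq_atMost) auto
    show "range (\<lambda>n. {..real n}) \<subseteq> range (\<lambda>a::real. {..a})" by auto
    show "(\<Union>i. {..real i}) = UNIV" by (auto intro: real_arch_simple)
  next
    fix X :: "real set" assume "X \<in> range (\<lambda>a::real. {..a})"
    then obtain a where X: "X = {..a}" by auto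
    \<comment> \<open>\<open>ennreal\<close> sends negative reals to 0, so the density vanishes on
      the negative half-line and only the interval from 0 to \<open>max 0 a\<close>
      contributes.\<close>
    have "emeasure (density lborel (\<lambda>r. ennreal (2 * pi * r))) {..a}
       = (\<integral>\<^sup>+r. ennreal (2 * pi * r) * indicator {0..max 0 a} r \<partial>lborel)"
      by (subst emeasure_density)
         (auto intro!: nn_integral_cong simp: ennreal_neg mult_nonneg_nonpos split: split_indicator)
    also have "\<dots> = ennreal (pi * (max 0 a)\<^sup>2 - pi * 0\<^sup>2)"
      by (rule nn_integral_FTC_Icc) (auto intro!: derivative_eq_intros)
    finally show "emeasure (distr (lborel :: complex measure) borel norm) X
       = emeasure (density lborel (\<lambda>r. ennreal (2 * pi * r))) X"
      by (simp add: X disc)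
  next
    show "emeasure (distr (lborel :: complex measure) borel norm) {..real i} \<noteq> \<infinity>" for i
      by (simp add: disc)
  qed
qed

lemma nn_integral_radial:
  assumes [measurable]: "g \<in> borel_measurable borel"
  shows "(\<integral>\<^sup>+z. g (norm (z::complex)) \<partial>lborel) = (\<integral>\<^sup>+r. ennreal (2 * pi * r) * g r \<partial>lborel)"
proof -
  have "(\<integral>\<^sup>+z. g (norm (z::complex)) \<partial>lborel) = (\<integral>\<^sup>+r. g r \<partial>(distr (lborel :: complex measure) borel norm))"
    by (subst nn_integral_distr) auto
  also have "\<dots> = (\<integral>\<^sup>+r. ennreal (2 * pi * r) * g r \<partial>lborel)"
    unfolding distr_norm_lborel_complex by (subst nn_integral_density) auto
  finally show ?thesis .
qed

section \<open>Rotation invariance of planar Lebesgue measure\<close>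

lemma lborel_complex_eq:
  "(lborel :: complex measure) = distr (lborel \<Otimes>\<^sub>M lborel) borel (\<lambda>(x, y). Complex x y)"
proof (rule lborel_eqI)
  have [measurable]: "(\<lambda>(x, y). Complex x y) \<in> borel_measurable (lborel \<Otimes>\<^sub>M lborel)"
    by (subst borel_measurable_complex_iff) (auto simp: split_beta')
  fix l u :: complex assume lu: "\<And>b. b \<in> Basis \<Longrightarrow> l \<bullet> b \<le> u \<bullet> b"
  have le: "Re l \<le> Re u" "Im l \<le> Im u"
    using lu[of 1] lu[of \<i>] by (auto simp: Basis_complex_def inner_complex_def)
  have "(\<lambda>(x, y). Complex x y) -` box l u \<inter> space (lborel \<Otimes>\<^sub>M lborel)
     = {Re l<..<Re u} \<times> {Im l<..<Im u}"
    by (auto simp: space_pair_measure in_box_complex_iff)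
  then have "emeasure (distr (lborel \<Otimes>\<^sub>M lborel) borel (\<lambda>(x, y). Complex x y)) (box l u)
     = emeasure (lborel \<Otimes>\<^sub>M lborel) ({Re l<..<Re u} \<times> {Im l<..<Im u})"
    by (subst emeasure_distr) auto
  also have "\<dots> = ennreal (Re u - Re l) * ennreal (Im u - Im l)"
    using le by (subst lborel.emeasure_pair_measure_Times) auto
  also have "\<dots> = (\<Prod>b\<in>Basis. (u - l) \<bullet> b)"
    using le by (simp add: Basis_complex_def inner_complex_def ennreal_mult)
  finally show "emeasure (distr (lborel \<Otimes>\<^sub>M lborel) borel (\<lambda>(x, y). Complex x y)) (box l u)
     = (\<Prod>b\<in>Basis. (u - l) \<bullet> b)" .
qed auto

lemma borel_measurable_Complex [measurable (raw)]:
  assumes [measurable]: "f \<in> borel_measurable M" "g \<in> borel_measurable M"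
  shows "(\<lambda>x. Complex (f x) (g x)) \<in> borel_measurable M"
  by (subst borel_measurable_complex_iff) auto

lemma borel_measurable_cnj [measurable (raw)]:
  assumes [measurable]: "f \<in> borel_measurable M"
  shows "(\<lambda>x. cnj (f x)) \<in> borel_measurable M"
  by (subst borel_measurable_complex_iff) auto

lemma nn_integral_complex_eq:
  assumes [measurable]: "f \<in> borel_measurable borel"
  shows "(\<integral>\<^sup>+z. f z \<partial>lborel) = (\<integral>\<^sup>+x. \<integral>\<^sup>+y. f (Complex x y) \<partial>lborel \<partial>lborel)"
    and "(\<integral>\<^sup>+z. f z \<partial>lborel) = (\<integral>\<^sup>+y. \<integral>\<^sup>+x. f (Complex x y) \<partial>lborel \<partial>lborel)"
proof -
  have *: "(\<integral>\<^sup>+z. f z \<partial>lborel) = (\<integral>\<^sup>+p. f (Complex (fst p) (snd p)) \<partial>(lborel \<Otimes>\<^sub>M lborel))"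
    by (subst lborel_complex_eq, subst nn_integral_distr) (auto simp: split_beta')
  show "(\<integral>\<^sup>+z. f z \<partial>lborel) = (\<integral>\<^sup>+x. \<integral>\<^sup>+y. f (Complex x y) \<partial>lborel \<partial>lborel)"
    unfolding * by (subst lborel.nn_integral_fst[symmetric]) auto
  show "(\<integral>\<^sup>+z. f z \<partial>lborel) = (\<integral>\<^sup>+y. \<integral>\<^sup>+x. f (Complex x y) \<partial>lborel \<partial>lborel)"
    unfolding * by (subst lborel_pair.nn_integral_snd[symmetric]) auto
qed

lemma nn_integral_lborel_shift:
  fixes c :: real
  assumes [measurable]: "f \<in> borel_measurable borel"
  shows "(\<integral>\<^sup>+x. f (x + c) \<partial>lborel) = (\<integral>\<^sup>+x. f x \<partial>lborel)"
  by (subst lborel_distr_plus[symmetric, of c], subst nn_integral_distr) (auto simp: add.commute)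

text \<open>With the ordinate held fixed, a horizontal shear is a translation of the abscissa, so
  the inner integral in Tonelli's formula does not change. The vertical shear below is treated with
  the other order of integration.\<close>

lemma nn_integral_shear_Re:
  assumes [measurable]: "f \<in> borel_measurable borel"
  shows "(\<integral>\<^sup>+z. f (Complex (Re z + a * Im z) (Im z)) \<partial>lborel) = (\<integral>\<^sup>+z. f z \<partial>lborel)"
  by (subst (1 2) nn_integral_complex_eq(2)) (auto simp: nn_integral_lborel_shift[where f="\<lambda>x. f (Complex x y)" for y])

lemma nn_integral_shear_Im:
  assumes [measurable]: "f \<in> borel_measurable borel"
  shows "(\<integral>\<^sup>+z. f (Complex (Re z) (Im z + a * Re z)) \<partial>lborel) = (\<integral>\<^sup>+z. f z \<partial>lborel)"
  by (subst (1 2) nn_integral_complex_eq(1)) (auto simp: nn_integral_lborel_shift[where f="\<lambda>y. f (Complex x y)" for x])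

text \<open>A planar rotation other than by a multiple of \<open>\<pi>\<close> is a product of three shears.\<close>

lemma lborel_distr_rotation:
  assumes u: "norm u = 1" "Im u \<noteq> 0"
  shows "distr lborel borel ((*) u) = (lborel :: complex measure)"
proof (rule measure_eqI)
  fix A :: "complex set" assume "A \<in> sets (distr lborel borel ((*) u))"
  then have A[measurable]: "A \<in> sets borel" by simp
  \<comment> \<open>For \<open>u = cis a\<close> this is \<open>- tan (a / 2)\<close>. The shears
    with parameters \<open>p\<close>, \<open>Im u\<close>, \<open>p\<close> compose to
    multiplication by \<open>u\<close>; \<open>pq\<close> and \<open>pr\<close> are the half-angle
    identities behind this factorisation, and dividing by \<open>Im u\<close> is what excludes real
    \<open>u\<close>.\<close>
  define p where "p = (Re u - 1) / Im u"
  let ?S = "\<lambda>z. Complex (Re z + p * Im z) (Im z)"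
  let ?T = "\<lambda>z. Complex (Re z) (Im z + Im u * Re z)"
  have pq: "p * Im u = Re u - 1" using u by (simp add: p_def)
  have sq: "(Re u)\<^sup>2 + (Im u)\<^sup>2 = 1" using u(1) by (simp add: cmod_def)
  have "p * (1 + Re u) * Im u = (Re u)\<^sup>2 - 1"
  proof -
    have "p * (1 + Re u) * Im u = (p * Im u) * (1 + Re u)" by (simp add: algebra_simps)
    then show ?thesis unfolding pq by (simp add: algebra_simps power2_eq_square)
  qed
  then have "p * (1 + Re u) * Im u = - Im u * Im u" using sq by (simp add: power2_eq_square)
  then have pr: "p * (1 + Re u) = - Im u" using u(2) by (metis mult_right_cancel)
  have "?S (?T (?S z)) = u * z" for z
  proof -
    have "Re z + p * Im z + p * (Im z + Im u * (Re z + p * Im z))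
      = Re z * (1 + p * Im u) + Im z * (p * (1 + (1 + p * Im u)))" by (simp add: algebra_simps)
    also have "\<dots> = Re u * Re z - Im u * Im z" using pr by (simp add: pq)
    finally have re: "Re z + p * Im z + p * (Im z + Im u * (Re z + p * Im z)) = Re u * Re z - Im u * Im z" .
    have "Im z + Im u * (Re z + p * Im z) = Im z * (1 + p * Im u) + Im u * Re z"
      by (simp add: algebra_simps)
    then have "Im z + Im u * (Re z + p * Im z) = Re u * Im z + Im u * Re z" by (simp add: pq)
    with re show ?thesis by (simp add: complex_eq_iff)
  qed
  then have "(\<integral>\<^sup>+z. indicator A (u * z) \<partial>lborel) = (\<integral>\<^sup>+z. indicator A (?S (?T (?S z))) \<partial>(lborel :: complex measure))"
    by simp
  also have "\<dots> = (\<integral>\<^sup>+z. indicator A (?S (?T z)) \<partial>lborel)"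
    by (rule nn_integral_shear_Re[where f="\<lambda>z. indicator A (?S (?T z))"]) measurable
  also have "\<dots> = (\<integral>\<^sup>+z. indicator A (?S z) \<partial>lborel)"
    by (rule nn_integral_shear_Im[where f="\<lambda>z. indicator A (?S z)"]) measurable
  also have "\<dots> = (\<integral>\<^sup>+z. indicator A z \<partial>lborel)"
    by (rule nn_integral_shear_Re) measurable
  finally show "emeasure (distr lborel borel ((*) u)) A = emeasure lborel A"
    by (subst nn_integral_indicator[symmetric], simp, subst nn_integral_distr) auto
qed simp

section \<open>The modes: kernel expansion, radial laws, orthogonality on annuli\<close>

definition mode :: "nat \<Rightarrow> complex \<Rightarrow> complex" where
  "mode n z = z ^ n * of_real (exp (- (norm z)\<^sup>2 / 2) / sqrt (pi * fact n))"

lemma borel_measurable_mode [measurable]: "mode n \<in> borel_measurable borel"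
  unfolding mode_def by measurable

lemma norm_mode_sq: "(norm (mode n z))\<^sup>2 = norm z ^ (2 * n) * exp (- (norm z)\<^sup>2) / (pi * fact n)"
proof -
  have "(exp (- (norm z)\<^sup>2 / 2))\<^sup>2 = exp (- (norm z)\<^sup>2)"
    by (simp add: exp_double[symmetric])
  then show ?thesis
    by (simp add: mode_def norm_mult norm_power norm_divide power_mult_distrib power_divide
      power_mult[symmetric] mult.commute[of n 2] real_sqrt_mult)
qed

lemma mode_mult_cnj:
  "mode n z * cnj (mode n w) = (z * cnj w) ^ n /\<^sub>R fact n * of_real (exp (- (norm z)\<^sup>2 / 2 - (norm w)\<^sup>2 / 2) / pi)"
proof -
  have e: "exp (- (norm z)\<^sup>2 / 2 - (norm w)\<^sup>2 / 2) = exp (- (norm z)\<^sup>2 / 2) * exp (- (norm w)\<^sup>2 / 2)"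
    by (simp add: exp_add[symmetric])
  have s: "complex_of_real (sqrt (pi * fact n)) * of_real (sqrt (pi * fact n)) = of_real (pi * fact n)"
    unfolding of_real_mult[symmetric] by (simp del: real_sqrt_mult)
  have gen: "(z ^ n * of_real (a / c)) * cnj (w ^ n * of_real (b / c)) =
    (z * cnj w) ^ n * of_real (a * b) / (of_real c * of_real c)" for a b c :: real
    by (simp add: power_mult_distrib)
  have "mode n z * cnj (mode n w) = (z * cnj w) ^ n *
     of_real (exp (- (norm z)\<^sup>2 / 2) * exp (- (norm w)\<^sup>2 / 2)) /
     (of_real (sqrt (pi * fact n)) * of_real (sqrt (pi * fact n)))"
    unfolding mode_def by (rule gen)
  moreover have "x * of_real y / of_real (pi * fact n) = x /\<^sub>R fact n * of_real (y / pi)"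
    for x :: complex and y :: real
    by (simp add: scaleR_conv_of_real field_simps)
  ultimately show ?thesis by (simp only: e s)
qed

lemma ginibre_kernel_sums: "(\<lambda>n. mode n z * cnj (mode n w)) sums ginibre_kernel z w"
proof -
  have "(\<lambda>n. (z * cnj w) ^ n /\<^sub>R fact n * of_real (exp (- (norm z)\<^sup>2 / 2 - (norm w)\<^sup>2 / 2) / pi))
    sums (exp (z * cnj w) * of_real (exp (- (norm z)\<^sup>2 / 2 - (norm w)\<^sup>2 / 2) / pi))"
    by (intro sums_mult2 exp_converges)
  moreover have "exp (z * cnj w) * of_real (exp (- (norm z)\<^sup>2 / 2 - (norm w)\<^sup>2 / 2) / pi) = ginibre_kernel z w"
  proof -
    have "z * cnj w - of_real ((norm z)\<^sup>2) / 2 - of_real ((norm w)\<^sup>2) / 2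
      = z * cnj w + of_real (- (norm z)\<^sup>2 / 2 - (norm w)\<^sup>2 / 2)" by simp
    then show ?thesis unfolding ginibre_kernel_def
      by (simp only: exp_add exp_of_real) simp
  qed
  ultimately show ?thesis by (simp add: mode_mult_cnj)
qed

lemma norm_mode_sq_sums: "(\<lambda>n. (norm (mode n z))\<^sup>2) sums (1 / pi)"
proof -
  have "(\<lambda>n. ((norm z)\<^sup>2) ^ n /\<^sub>R fact n * (exp (- (norm z)\<^sup>2) / pi)) sums (exp ((norm z)\<^sup>2) * (exp (- (norm z)\<^sup>2) / pi))"
    by (intro sums_mult2 exp_converges)
  moreover have "((norm z)\<^sup>2) ^ n /\<^sub>R fact n * (exp (- (norm z)\<^sup>2) / pi) = (norm (mode n z))\<^sup>2" for n
    unfolding norm_mode_sq power_mult by (simp add: divide_inverse mult_ac)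
  moreover have "exp ((norm z)\<^sup>2) * (exp (- (norm z)\<^sup>2) / pi) = 1 / pi"
    by (simp add: exp_minus)
  ultimately show ?thesis by simp
qed

text \<open>The arithmetic-geometric mean inequality reduces this to the diagonal, where the full
  series has the sum \<open>1 / pi\<close>. Independence of \<open>T\<close>, \<open>z\<close> and
  \<open>w\<close> is what later provides a dominating function for the truncated
  determinants.\<close>

lemma norm_mode_partial_kernel_le:
  "norm (\<Sum>n<T. mode n z * cnj (mode n w)) \<le> 1 / pi"
proof -
  have le: "(\<Sum>n<T. (norm (mode n z))\<^sup>2) \<le> 1 / pi" for z
    using norm_mode_sq_sums[of z] by (metis sum_le_suminf sums_iff finite_lessThan zero_le_power2)
  have "norm (\<Sum>n<T. mode n z * cnj (mode n w)) \<le> (\<Sum>n<T. norm (mode n z) * norm (mode n w))"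
    by (rule order_trans[OF norm_sum]) (simp add: norm_mult)
  also have "\<dots> \<le> (\<Sum>n<T. ((norm (mode n z))\<^sup>2 + (norm (mode n w))\<^sup>2) / 2)"
  proof (intro sum_mono)
    fix n
    show "norm (mode n z) * norm (mode n w) \<le> ((norm (mode n z))\<^sup>2 + (norm (mode n w))\<^sup>2) / 2"
      using sum_squares_bound[of "norm (mode n z)" "norm (mode n w)"] by simp
  qed
  also have "\<dots> = ((\<Sum>n<T. (norm (mode n z))\<^sup>2) + (\<Sum>n<T. (norm (mode n w))\<^sup>2)) / 2"
    by (simp add: sum_divide_distrib[symmetric] sum.distrib)
  also have "\<dots> \<le> 1 / pi" using le[of z] le[of w] by simp
  finally show ?thesis .
qed

text \<open>The law of one point drawn from mode \<open>n\<close>. The square of its modulus has the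
  Gamma law of shape \<open>n + 1\<close>, by the radial formula below.\<close>

definition mode_law :: "nat \<Rightarrow> complex measure" where
  "mode_law n = density lborel (\<lambda>z. ennreal ((norm (mode n z))\<^sup>2))"

lemma sets_mode_law [measurable_cong, simp]: "sets (mode_law n) = sets borel"
  and space_mode_law [simp]: "space (mode_law n) = UNIV"
  by (auto simp: mode_law_def)

lemma nn_integral_mode_law:
  assumes [measurable]: "g \<in> borel_measurable borel"
  shows "(\<integral>\<^sup>+z. g z \<partial>mode_law n) = (\<integral>\<^sup>+z. ennreal ((norm (mode n z))\<^sup>2) * g z \<partial>lborel)"
  unfolding mode_law_def by (subst nn_integral_density) auto

lemma nn_integral_mode_law_radial:
  assumes [measurable]: "g \<in> borel_measurable borel"
  shows "(\<integral>\<^sup>+z. g (norm z) \<partial>mode_law n)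
    = (\<integral>\<^sup>+r. ennreal (indicator {0..} r * (2 * r ^ (2 * n + 1) * exp (- r\<^sup>2) / fact n)) * g r \<partial>lborel)"
proof -
  have "(\<integral>\<^sup>+z. g (norm z) \<partial>mode_law n) =
     (\<integral>\<^sup>+z. ennreal (norm (z::complex) ^ (2 * n) * exp (- (norm z)\<^sup>2) / (pi * fact n)) * g (norm z) \<partial>lborel)"
    by (subst nn_integral_mode_law) (auto simp: norm_mode_sq)
  also have "\<dots> = (\<integral>\<^sup>+r. ennreal (2 * pi * r) * (ennreal (r ^ (2 * n) * exp (- r\<^sup>2) / (pi * fact n)) * g r) \<partial>lborel)"
    by (rule nn_integral_radial[where g="\<lambda>r. ennreal (r ^ (2 * n) * exp (- r\<^sup>2) / (pi * fact n)) * g r"]) measurable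
  also have "\<dots> = (\<integral>\<^sup>+r. ennreal (indicator {0..} r * (2 * r ^ (2 * n + 1) * exp (- r\<^sup>2) / fact n)) * g r \<partial>lborel)"
  proof (rule nn_integral_cong)
    fix r :: real
    show "ennreal (2 * pi * r) * (ennreal (r ^ (2 * n) * exp (- r\<^sup>2) / (pi * fact n)) * g r) =
      ennreal (indicator {0..} r * (2 * r ^ (2 * n + 1) * exp (- r\<^sup>2) / fact n)) * g r"
    proof (cases "r \<ge> 0")
      case True
      then have "ennreal (2 * pi * r) * ennreal (r ^ (2 * n) * exp (- r\<^sup>2) / (pi * fact n))
        = ennreal (indicator {0..} r * (2 * r ^ (2 * n + 1) * exp (- r\<^sup>2) / fact n))"
        by (subst ennreal_mult[symmetric]) (auto simp: field_simps)
      then show ?thesis by (simp add: mult.assoc[symmetric])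
    next
      case False
      then show ?thesis by (simp add: ennreal_neg mult_nonneg_nonpos)
    qed
  qed
  finally show ?thesis .
qed

lemma prob_space_mode_law: "prob_space (mode_law n)"
proof
  have "emeasure (mode_law n) (space (mode_law n)) = (\<integral>\<^sup>+z. (\<lambda>_. 1) (norm z) \<partial>mode_law n)" by simp
  also have "\<dots> = (\<integral>\<^sup>+r. ennreal (2 / fact n * (indicator {0..} r *\<^sub>R (exp (-r\<^sup>2)*r^(2 * n + 1)))) \<partial>lborel)"
    by (subst nn_integral_mode_law_radial) (auto intro!: nn_integral_cong simp: field_simps)
  also have "\<dots> = ennreal (2 / fact n * (fact n / 2))"
  proof (rule nn_integral_eq_integral[THEN trans])
    show "integrable lborel (\<lambda>r. 2 / fact n * (indicator {0..} r *\<^sub>R (exp (-r\<^sup>2)*r^(2 * n + 1))) :: real)"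
      using gaussian_moment_odd_pos[of n] by (intro integrable_mult_right) (auto simp: has_bochner_integral_iff)
    show "ennreal (\<integral>r. 2 / fact n * (indicator {0..} r *\<^sub>R (exp (-r\<^sup>2)*r^(2 * n + 1))) \<partial>lborel) = ennreal (2 / fact n * (fact n / 2))"
      using gaussian_moment_odd_pos[of n] by (simp add: has_bochner_integral_iff)
  qed (auto split: split_indicator)
  finally show "emeasure (mode_law n) (space (mode_law n)) = 1" by simp
qed

lemma measurable_norm_vimage [measurable]:
  "A \<in> sets borel \<Longrightarrow> {z::'a::{real_normed_vector,second_countable_topology}. norm z \<in> A} \<in> sets borel"
  using measurable_sets[of norm borel borel A] by (simp add: vimage_def)

text \<open>A rotation by \<open>u\<close> preserves Lebesgue measure and every annulus, and
  multiplies the integrand by \<open>c = u ^ n * cnj (u ^ m)\<close>. The integral therefore equals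
  \<open>c\<close> times itself, and vanishes once \<open>c\<close> differs from 1.\<close>

lemma mode_orthogonal:
  assumes A[measurable]: "A \<in> sets borel" and "n \<noteq> m"
  shows "(LINT z:{z. norm z \<in> A}|lborel. mode n z * cnj (mode m z)) = 0"
proof -
  define d :: nat where "d = (if m < n then n - m else m - n)"
  \<comment> \<open>Chosen so that \<open>u ^ d\<close> is the imaginary unit, which makes
    \<open>c\<close> equal to it or to its conjugate; the angle lies strictly between 0 and
    \<open>pi\<close>, so the rotation lemma applies.\<close>
  define u where "u = cis (pi / (2 * real d))"
  have d: "d > 0" using assms(2) by (auto simp: d_def)
  have ud: "u ^ d = \<i>" using d unfolding u_def Complex.DeMoivre by (simp add: complex_eq_iff)
  have "0 < pi / (2 * real d)" "pi / (2 * real d) < pi"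
    using d by (auto simp: field_simps)
  then have "Im u \<noteq> 0" using sin_gt_zero[of "pi / (2 * real d)"] by (simp add: u_def)
  then have rot: "distr lborel borel ((*) u) = lborel"
    by (intro lborel_distr_rotation) (auto simp: u_def)
  have nu: "norm u = 1" by (simp add: u_def)
  define c where "c = u ^ n * cnj (u ^ m)"
  have c: "c \<noteq> 1"
  proof
    assume c1: "c = 1"
    have e: "u ^ k * cnj (u ^ k) = 1" for k
      using complex_norm_square[of "u ^ k"] nu by (simp add: norm_power)
    show False
    proof (cases "m < n")
      case True
      then have "c = u ^ d * (u ^ m * cnj (u ^ m))" by (simp add: c_def d_def power_add[symmetric] mult.assoc[symmetric])
      then show False using c1 ud unfolding e by (simp add: complex_eq_iff)
    next
      case False
      then have "u ^ m = u ^ n * u ^ d" using assms(2) by (simp add: d_def power_add[symmetric])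
      then have "c = u ^ n * cnj (u ^ n) * cnj (u ^ d)" by (simp add: c_def)
      then show False using c1 ud unfolding e by (simp add: complex_eq_iff)
    qed
  qed
  let ?g = "\<lambda>z. indicator {z. norm z \<in> A} z *\<^sub>R (mode n z * cnj (mode m z))"
  have mode_u: "mode k (u * z) = u ^ k * mode k z" for k z
    using nu by (simp add: mode_def norm_mult power_mult_distrib)
  have gu: "?g (u * z) = c * ?g z" for z
    using nu by (simp add: mode_u c_def norm_mult indicator_def mult_ac)
  have "(LINT z|lborel. ?g z) = (LINT z|distr lborel borel ((*) u). ?g z)"
    by (simp add: rot)
  also have "\<dots> = (LINT z|lborel. ?g (u * z))"
    by (rule integral_distr) measurable
  also have "\<dots> = c * (LINT z|lborel. ?g z)"
    unfolding gu by (rule integral_mult_right_zero)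
  finally have "(1 - c) * (LINT z|lborel. ?g z) = 0" by (simp add: algebra_simps)
  then show ?thesis using c by (simp add: set_lebesgue_integral_def)
qed

lemma measure_mode_law:
  assumes A[measurable]: "A \<in> sets borel"
  shows "set_integrable lborel A (\<lambda>z. mode n z * cnj (mode n z))"
    and "(LINT z:A|lborel. mode n z * cnj (mode n z)) = of_real (measure (mode_law n) A)"
proof -
  interpret prob_space "mode_law n" by (rule prob_space_mode_law)
  have *: "mode n z * cnj (mode n z) = of_real ((norm (mode n z))\<^sup>2)" for z
    using complex_norm_square[of "mode n z"] by simp
  have em: "emeasure (mode_law n) A = (\<integral>\<^sup>+z. ennreal (indicator A z * (norm (mode n z))\<^sup>2) \<partial>lborel)"
    unfolding mode_law_def by (subst emeasure_density) (auto intro!: nn_integral_cong split: split_indicator)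
  have "has_bochner_integral lborel (\<lambda>z. indicator A z * (norm (mode n z))\<^sup>2) (measure (mode_law n) A)"
    by (rule has_bochner_integral_nn_integral) (auto simp: em[symmetric] emeasure_eq_measure)
  then have "has_bochner_integral lborel (\<lambda>z. complex_of_real (indicator A z * (norm (mode n z))\<^sup>2)) (of_real (measure (mode_law n) A))"
    by (rule has_bochner_integral_of_real)
  then have "has_bochner_integral lborel (\<lambda>z. indicator A z *\<^sub>R (mode n z * cnj (mode n z))) (of_real (measure (mode_law n) A))"
    by (simp add: * scaleR_conv_of_real)
  then show "set_integrable lborel A (\<lambda>z. mode n z * cnj (mode n z))"
    "(LINT z:A|lborel. mode n z * cnj (mode n z)) = of_real (measure (mode_law n) A)"
    by (auto simp: set_integrable_def set_lebesgue_integral_def has_bochner_integral_iff)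
qed

section \<open>Correlation integrals over radial sets\<close>

abbreviation partial_det :: "nat \<Rightarrow> nat \<Rightarrow> (nat \<Rightarrow> complex) \<Rightarrow> complex" where
  "partial_det T k x \<equiv> Determinant.det (Matrix.mat k k (\<lambda>(i, j). \<Sum>n<T. mode n (x i) * cnj (mode n (x j))))"

abbreviation ginibre_det :: "nat \<Rightarrow> (nat \<Rightarrow> complex) \<Rightarrow> complex" where
  "ginibre_det k x \<equiv> Determinant.det (Matrix.mat k k (\<lambda>(i, j). ginibre_kernel (x i) (x j)))"

lemma integrable_mode_mult_cnj: "integrable lborel (\<lambda>z. mode n z * cnj (mode m z))"
proof -
  have *: "integrable lborel (\<lambda>z. (norm (mode n z))\<^sup>2)" for n
    using integrable_norm[OF measure_mode_law(1)[of UNIV n, unfolded set_integrable_def]]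
    by (simp add: norm_mult power2_eq_square)
  show ?thesis
  proof (rule Bochner_Integration.integrable_bound)
    show "integrable lborel (\<lambda>z. (norm (mode n z))\<^sup>2 + (norm (mode m z))\<^sup>2)"
      by (intro Bochner_Integration.integrable_add *)
    show "AE z in lborel. norm (mode n z * cnj (mode m z)) \<le> norm ((norm (mode n z))\<^sup>2 + (norm (mode m z))\<^sup>2)"
    proof (rule AE_I2)
      fix z
      have "2 * (norm (mode n z) * norm (mode m z)) \<le> (norm (mode n z))\<^sup>2 + (norm (mode m z))\<^sup>2"
        using sum_squares_bound[of "norm (mode n z)" "norm (mode m z)"] by simp
      moreover have "0 \<le> norm (mode n z) * norm (mode m z)" by simp
      ultimately show "norm (mode n z * cnj (mode m z)) \<le> norm ((norm (mode n z))\<^sup>2 + (norm (mode m z))\<^sup>2)"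
        unfolding norm_mult complex_mod_cnj real_norm_def by linarith
    qed
  qed simp
qed

lemma permutes_atLeast0LessThan: "p permutes {0..<k} \<Longrightarrow> i < k \<Longrightarrow> p i < (k::nat)"
  using permutes_in_image[of p "{0..<k}" i] by simp

text \<open>The left-hand side is the Leibniz expansion of the determinant of the 0/1 matrix that
  records equality of labels: the identity matrix for distinct labels, a matrix with two equal rows
  otherwise. This is the exclusion principle by which no mode is occupied twice.\<close>

lemma sum_sign_fixing_permutations:
  fixes n :: "nat \<Rightarrow> nat"
  shows "(\<Sum>p | p permutes {..<k}. signof p * (\<Prod>i<k. if n i = n (p i) then 1 else 0 :: complex))
    = (if inj_on n {..<k} then 1 else 0)"
proof -
  define A :: "complex mat" where "A = Matrix.mat k k (\<lambda>(i, j). if n i = n j then 1 else 0)"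
  have A: "A \<in> carrier_mat k k" by (simp add: A_def)
  have "Determinant.det A = (\<Sum>p | p permutes {..<k}. signof p * (\<Prod>i<k. if n i = n (p i) then 1 else 0 :: complex))"
    unfolding det_def'[OF A] lessThan_atLeast0
    by (intro sum.cong refl arg_cong2[where f="(*)"] prod.cong) (auto simp: A_def permutes_atLeast0LessThan)
  moreover have "Determinant.det A = (if inj_on n {..<k} then 1 else 0)"
  proof (cases "inj_on n {..<k}")
    case True
    then have "A = 1\<^sub>m k" by (auto simp: A_def inj_on_def intro!: eq_matI)
    then show ?thesis using True by simp
  next
    case False
    then obtain i j where ij: "i < k" "j < k" "i \<noteq> j" "n i = n j" by (auto simp: inj_on_def)
    then have "row A i = row A j" by (intro eq_vecI) (auto simp: A_def)
    then show ?thesis using det_identical_rows[OF A] ij False by simp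
  qed
  ultimately show ?thesis by simp
qed

lemma prod_permute_arg:
  fixes f :: "nat \<Rightarrow> nat \<Rightarrow> 'a::comm_monoid_mult"
  assumes "p permutes {..<k}"
  shows "(\<Prod>i<k. f i (p i)) = (\<Prod>i<k. f (inv_into UNIV p i) i)"
  using prod.permute[OF assms, of "\<lambda>i. f (inv_into UNIV p i) i"] permutes_inverses[OF assms]
  by (simp add: o_def)

interpretation lborel_prod: product_sigma_finite "\<lambda>_::nat. lborel :: complex measure" ..

lemma indicator_PiE_prod:
  assumes "finite I" "x \<in> extensional I"
  shows "indicator (Pi\<^sub>E I D) x = (\<Prod>i\<in>I. indicator (D i) (x i) :: 'a::linordered_idom)"
  using assms by (auto simp: indicator_def PiE_iff prod_zero_iff intro!: prod.neutral)

text \<open>Permutations and mode sums are both expanded. Orthogonality on each annulus kills every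
  term in which one variable meets two different modes; for a fixed assignment \<open>n\<close> of
  modes to sets, the signs of the surviving permutations then add up to 1 or 0 according to
  injectivity of \<open>n\<close>.\<close>

lemma set_integral_det_partial_kernel:
  fixes A :: "nat \<Rightarrow> real set" and k T :: nat
  assumes A[measurable]: "\<And>i. i < k \<Longrightarrow> A i \<in> sets borel"
  defines "D \<equiv> \<lambda>i. {z::complex. norm z \<in> A i}"
  shows "(LINT x:Pi\<^sub>E {..<k} D|Pi\<^sub>M {..<k} (\<lambda>_. lborel).
       partial_det T k x)
     = of_real (\<Sum>n\<in>{n \<in> {..<k} \<rightarrow>\<^sub>E {..<T}. inj_on n {..<k}}. \<Prod>i<k. measure (mode_law (n i)) (D i))"
proof -
  let ?I = "{..<k}"
  let ?P = "Pi\<^sub>M ?I (\<lambda>_. lborel :: complex measure)"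
  let ?N = "?I \<rightarrow>\<^sub>E {..<T}"
  have D[measurable]: "D i \<in> sets borel" if "i < k" for i using that by (simp add: D_def)
  define g where "g p n i z = indicator (D i) z *\<^sub>R (mode (n i) z * cnj (mode (n (inv_into UNIV p i)) z))"
    for p n :: "nat \<Rightarrow> nat" and i :: nat and z :: complex
  have expand: "indicator (Pi\<^sub>E ?I D) x *\<^sub>R
      partial_det T k x
    = (\<Sum>p | p permutes ?I. \<Sum>n\<in>?N. signof p * (\<Prod>i\<in>?I. g p n i (x i)))"
    if x: "x \<in> space ?P" for x
  proof -
    have ind: "indicator (Pi\<^sub>E ?I D) x = (\<Prod>i\<in>?I. indicator (D i) (x i) :: real)"
      using x by (intro indicator_PiE_prod) (auto simp: space_PiM PiE_iff)
    have "partial_det T k x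
      = (\<Sum>p | p permutes ?I. signof p * (\<Prod>i\<in>?I. \<Sum>n<T. mode n (x i) * cnj (mode n (x (p i)))))"
      unfolding lessThan_atLeast0
      by (subst det_def'[of _ k], simp)
         (auto intro!: sum.cong arg_cong2[where f="(*)"] prod.cong simp: permutes_atLeast0LessThan)
    also have "\<dots> = (\<Sum>p | p permutes ?I. signof p *
        (\<Sum>n\<in>?N. \<Prod>i\<in>?I. mode (n i) (x i) * cnj (mode (n i) (x (p i)))))"
      by (simp add: prod_sum_PiE)
    \<comment> \<open>Reindexing the conjugated factors by the inverse permutation collects the two
      factors that carry the same variable \<open>x i\<close>, so that Fubini splits the integral
      into one-point integrals.\<close>
    also have "\<dots> = (\<Sum>p | p permutes ?I. signof p *
        (\<Sum>n\<in>?N. \<Prod>i\<in>?I. mode (n i) (x i) * cnj (mode (n (inv_into UNIV p i)) (x i))))"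
    proof (intro sum.cong refl arg_cong2[where f="(*)"])
      fix p n assume "p \<in> {p. p permutes ?I}"
      then have p: "p permutes ?I" by simp
      show "(\<Prod>i\<in>?I. mode (n i) (x i) * cnj (mode (n i) (x (p i)))) =
        (\<Prod>i\<in>?I. mode (n i) (x i) * cnj (mode (n (inv_into UNIV p i)) (x i)))"
        unfolding prod.distrib using prod_permute_arg[OF p, of "\<lambda>i j. cnj (mode (n i) (x j))"] by simp
    qed
    finally show ?thesis
      unfolding ind g_def
      by (simp add: scaleR_conv_of_real prod.distrib sum_distrib_left mult_ac)
  qed
  have int_g: "integrable lborel (g p n i)" if "i < k" for p n i
    unfolding g_def using that by (intro integrable_mult_indicator integrable_mode_mult_cnj) simp
  have val_g: "(LINT z|lborel. g p n i z) =
      (if n i = n (inv_into UNIV p i) then of_real (measure (mode_law (n i)) (D i)) else 0)" if "i < k" for p n i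
  proof (cases "n i = n (inv_into UNIV p i)")
    case True
    then show ?thesis using measure_mode_law(2)[of "D i" "n i"] that
      by (simp add: g_def set_lebesgue_integral_def)
  next
    case False
    then show ?thesis using mode_orthogonal[OF A[OF that] False] that
      by (simp add: g_def set_lebesgue_integral_def D_def)
  qed
  have "(LINT x:Pi\<^sub>E ?I D|?P.
       partial_det T k x)
    = (LINT x|?P. (\<Sum>p | p permutes ?I. \<Sum>n\<in>?N. signof p * (\<Prod>i\<in>?I. g p n i (x i))))"
    unfolding set_lebesgue_integral_def by (intro Bochner_Integration.integral_cong refl expand)
  also have "\<dots> = (\<Sum>p | p permutes ?I. \<Sum>n\<in>?N. signof p * (\<Prod>i\<in>?I. LINT z|lborel. g p n i z))"
  proof -
    have int: "integrable ?P (\<lambda>x. \<Prod>i\<in>?I. g p n i (x i))" for p n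
      by (rule lborel_prod.product_integrable_prod) (auto intro: int_g)
    have eq: "(LINT x|?P. (\<Prod>i\<in>?I. g p n i (x i))) = (\<Prod>i\<in>?I. LINT z|lborel. g p n i z)" for p n
      by (rule lborel_prod.product_integral_prod) (auto intro: int_g)
    show ?thesis
      by (subst Bochner_Integration.integral_sum | subst integral_mult_right_zero |
          intro Bochner_Integration.integrable_sum integrable_mult_right int sum.cong refl | simp only: eq)+
  qed
  also have "\<dots> = (\<Sum>p | p permutes ?I. \<Sum>n\<in>?N. signof p *
     ((\<Prod>i<k. of_real (measure (mode_law (n i)) (D i))) * (\<Prod>i<k. if n i = n (p i) then 1 else 0)))"
  proof (intro sum.cong refl arg_cong2[where f="(*)"])
    fix p n assume "p \<in> {p. p permutes ?I}"
    then have p: "p permutes ?I" by simp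
    have "(\<Prod>i\<in>?I. LINT z|lborel. g p n i z) =
      (\<Prod>i\<in>?I. of_real (measure (mode_law (n i)) (D i)) * (if n i = n (inv_into UNIV p i) then 1 else 0))"
      by (intro prod.cong refl) (simp add: val_g)
    also have "\<dots> = (\<Prod>i<k. of_real (measure (mode_law (n i)) (D i))) * (\<Prod>i<k. if n i = n (inv_into UNIV p i) then 1 else 0)"
      by (rule prod.distrib)
    also have "(\<Prod>i<k. if n i = n (inv_into UNIV p i) then 1 else 0 :: complex) = (\<Prod>i<k. if n i = n (p i) then 1 else 0)"
      using prod_permute_arg[OF p, of "\<lambda>i j. if n i = n j then 1 else 0 :: complex"]
      by (simp add: eq_commute)
    finally show "(\<Prod>i\<in>?I. LINT z|lborel. g p n i z) =
      (\<Prod>i<k. of_real (measure (mode_law (n i)) (D i))) * (\<Prod>i<k. if n i = n (p i) then 1 else 0)" .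
  qed
  also have "\<dots> = (\<Sum>n\<in>?N. (\<Prod>i<k. of_real (measure (mode_law (n i)) (D i))) *
     (\<Sum>p | p permutes ?I. signof p * (\<Prod>i<k. if n i = n (p i) then 1 else 0)))"
    by (subst sum.swap) (simp add: sum_distrib_left mult_ac)
  also have "\<dots> = (\<Sum>n\<in>?N. if inj_on n ?I then \<Prod>i<k. of_real (measure (mode_law (n i)) (D i)) else 0)"
    by (intro sum.cong refl) (simp add: sum_sign_fixing_permutations)
  also have "\<dots> = (\<Sum>n\<in>{n \<in> ?N. inj_on n ?I}. \<Prod>i<k. of_real (measure (mode_law (n i)) (D i)))"
    by (rule sum.inter_filter[symmetric]) (auto intro: finite_PiE)
  finally show ?thesis by simp
qed

lemma emeasure_PiE_lborel_finite:
  fixes k :: nat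
  assumes "\<And>i. i < k \<Longrightarrow> D i \<in> sets borel \<and> bounded (D i)"
  shows "Pi\<^sub>E {..<k} D \<in> sets (Pi\<^sub>M {..<k} (\<lambda>_. lborel :: complex measure))"
    and "emeasure (Pi\<^sub>M {..<k} (\<lambda>_. lborel :: complex measure)) (Pi\<^sub>E {..<k} D) < \<infinity>"
proof -
  show "Pi\<^sub>E {..<k} D \<in> sets (Pi\<^sub>M {..<k} (\<lambda>_. lborel :: complex measure))"
    using assms by (intro sets_PiM_I_finite[OF finite_lessThan]) auto
  have "emeasure (Pi\<^sub>M {..<k} (\<lambda>_. lborel :: complex measure)) (Pi\<^sub>E {..<k} D) = (\<Prod>i<k. emeasure lborel (D i))"
    using assms by (intro lborel_prod.emeasure_PiM) auto
  also have "\<dots> < \<infinity>"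
  proof -
    have "emeasure lborel (D i) \<noteq> \<top>" if "i < k" for i
      using emeasure_bounded_finite[of "D i"] assms[OF that] by auto
    then show ?thesis by (auto simp: less_top[symmetric] ennreal_prod_eq_top)
  qed
  finally show "emeasure (Pi\<^sub>M {..<k} (\<lambda>_. lborel :: complex measure)) (Pi\<^sub>E {..<k} D) < \<infinity>" .
qed

lemma det_ginibre_limit:
  "(\<lambda>T. partial_det T k x)
    \<longlonglongrightarrow> ginibre_det k x"
proof -
  have "(\<lambda>T. \<Sum>p | p permutes {0..<k}. signof p * (\<Prod>i=0..<k. \<Sum>n<T. mode n (x i) * cnj (mode n (x (p i)))))
    \<longlonglongrightarrow> (\<Sum>p | p permutes {0..<k}. signof p * (\<Prod>i=0..<k. ginibre_kernel (x i) (x (p i))))"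
    using ginibre_kernel_sums unfolding sums_def by (intro tendsto_intros)
  then show ?thesis
    by (subst (1 2) det_def'[of _ k])
       (auto elim!: back_subst[where P="\<lambda>f. (f \<longlongrightarrow> _) _"] back_subst[where P="\<lambda>f. (_ \<longlongrightarrow> f) _"]
         intro!: ext sum.cong arg_cong2[where f="(*)"] prod.cong simp: permutes_atLeast0LessThan)
qed

text \<open>Crude Leibniz bound: \<open>fact k\<close> permutations, entries of modulus at most
  \<open>1 / pi\<close>, hence at most 1. Uniformity in \<open>T\<close> gives the domination in the
  limit of infinitely many modes; the value 2 for \<open>k = 2\<close> reappears in the pair
  bounds.\<close>

lemma norm_det_partial_kernel_le:
  "norm (partial_det T k x) \<le> fact k"
proof -
  have "norm (\<Sum>p | p permutes {0..<k}. signof p * (\<Prod>i=0..<k. \<Sum>n<T. mode n (x i) * cnj (mode n (x (p i)))))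
    \<le> (\<Sum>p | p permutes {0..<k}. 1)"
  proof (rule sum_norm_le)
    fix p
    have "norm (signof p :: complex) = 1" by (simp add: sign_def)
    moreover have "norm (\<Prod>i=0..<k. \<Sum>n<T. mode n (x i) * cnj (mode n (x (p i)))) \<le> 1"
      unfolding prod_norm[symmetric]
      using norm_mode_partial_kernel_le pi_ge_two
      by (intro prod_le_1) (auto intro: order_trans[OF norm_mode_partial_kernel_le])
    ultimately show "norm (signof p * (\<Prod>i=0..<k. \<Sum>n<T. mode n (x i) * cnj (mode n (x (p i))))) \<le> 1"
      by (simp add: norm_mult)
  qed
  also have "\<dots> = fact k" using card_permutations[of "{0..<k}" k] by simp
  finally show ?thesis
    by (subst det_def'[of _ k])
       (auto elim!: back_subst[where P="\<lambda>x. norm x \<le> _"] intro!: sum.cong arg_cong2[where f="(*)"] prod.cong simp: permutes_atLeast0LessThan)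
qed

lemma borel_measurable_det:
  assumes [measurable]: "\<And>i j. i < k \<Longrightarrow> j < k \<Longrightarrow> (\<lambda>x. f x i j :: complex) \<in> borel_measurable M"
  shows "(\<lambda>x. Determinant.det (Matrix.mat k k (\<lambda>(i, j). f x i j))) \<in> borel_measurable (M :: 'a measure)"
    (is "?d \<in> _")
proof -
  have "?d = (\<lambda>x. \<Sum>p | p permutes {0..<k}. signof p * (\<Prod>i=0..<k. f x i (p i)) :: complex)"
    by (rule ext, subst det_def'[of _ k])
       (auto intro!: sum.cong arg_cong2[where f="(*)"] prod.cong simp: permutes_atLeast0LessThan)
  moreover have "(\<lambda>x. \<Sum>p | p permutes {0..<k}. signof p * (\<Prod>i=0..<k. f x i (p i)) :: complex) \<in> borel_measurable M"
    by (intro borel_measurable_sum borel_measurable_times borel_measurable_prod borel_measurable_const assms)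
       (auto simp: permutes_atLeast0LessThan)
  ultimately show ?thesis by simp
qed


text \<open>The intensity identity expresses the moment by the full kernel. The truncated
  determinants converge pointwise and are bounded by \<open>fact k\<close> on a product of bounded
  sets, so dominated convergence carries the evaluation for finitely many modes to the
  limit.\<close>

lemma ginibre_radial_moment:
  fixes A :: "nat \<Rightarrow> real set" and k :: nat
  assumes gin: "ginibre_ensemble M G" and k: "k \<ge> 1"
    and A: "\<And>i. i < k \<Longrightarrow> A i \<in> sets borel \<and> bounded (A i)"
    and disj: "disjoint_family_on A {..<k}"
  defines "D \<equiv> \<lambda>i. {z::complex. norm z \<in> A i}"
  shows "(\<lambda>T. \<Sum>n\<in>{n \<in> {..<k} \<rightarrow>\<^sub>E {..<T}. inj_on n {..<k}}. \<Prod>i<k. measure (mode_law (n i)) (D i))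
    \<longlonglongrightarrow> (LINT w|M. (\<Prod>i<k. real (card (G w \<inter> D i))))"
proof -
  interpret determinantal_process M G lborel ginibre_kernel
    using gin by (simp add: ginibre_ensemble_def)
  let ?P = "Pi\<^sub>M {..<k} (\<lambda>_. lborel :: complex measure)"
  have D: "D i \<in> sets borel \<and> bounded (D i)" if "i < k" for i
  proof -
    obtain a where a: "\<forall>x\<in>A i. \<bar>x\<bar> \<le> a" using A[of i] \<open>i < k\<close> by (auto simp: bounded_iff)
    have "norm z \<le> a" if "z \<in> D i" for z
      using a that abs_ge_self[of "norm z"] by (auto simp: D_def)
    then show ?thesis using A[OF that] by (auto simp: bounded_iff D_def)
  qed
  have D': "D i \<in> sets borel \<and> compact (closure (D i))" if "i < k" for i
    using D[OF that] by (simp add: compact_closure)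
  have dD: "disjoint_family_on D {..<k}"
    using disj unfolding disjoint_family_on_def D_def by blast
  have [measurable]: "Pi\<^sub>E {..<k} D \<in> sets ?P" by (rule emeasure_PiE_lborel_finite(1)[OF D])
  have lim: "(\<lambda>T. LINT x:Pi\<^sub>E {..<k} D|?P.
       partial_det T k x)
    \<longlonglongrightarrow> (LINT x:Pi\<^sub>E {..<k} D|?P. ginibre_det k x)"
    unfolding set_lebesgue_integral_def
  proof (rule integral_dominated_convergence[where w="\<lambda>x. fact k * indicator (Pi\<^sub>E {..<k} D) x"])
    show "integrable ?P (\<lambda>x. fact k * indicator (Pi\<^sub>E {..<k} D) x :: real)"
      using emeasure_PiE_lborel_finite(2)[OF D] by (intro integrable_mult_right) auto
    show meas: "(\<lambda>x. indicator (Pi\<^sub>E {..<k} D) x *\<^sub>R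
         partial_det T k x) \<in> borel_measurable ?P" for T
      by (intro borel_measurable_scaleR borel_measurable_indicator borel_measurable_det) measurable
    show pt: "AE x in ?P. (\<lambda>T. indicator (Pi\<^sub>E {..<k} D) x *\<^sub>R
         partial_det T k x)
       \<longlonglongrightarrow> indicator (Pi\<^sub>E {..<k} D) x *\<^sub>R ginibre_det k x"
      by (intro AE_I2 tendsto_intros det_ginibre_limit)
    show "(\<lambda>x. indicator (Pi\<^sub>E {..<k} D) x *\<^sub>R ginibre_det k x) \<in> borel_measurable ?P"
      by (rule borel_measurable_LIMSEQ_metric[where f="\<lambda>T x. indicator (Pi\<^sub>E {..<k} D) x *\<^sub>R
          partial_det T k x"], rule meas)
        (intro tendsto_intros det_ginibre_limit)
    show "AE x in ?P. norm (indicator (Pi\<^sub>E {..<k} D) x *\<^sub>R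
         partial_det T k x)
       \<le> fact k * indicator (Pi\<^sub>E {..<k} D) x" for T
      using norm_det_partial_kernel_le by (auto simp: mult.commute indicator_def)
  qed
  have "(\<lambda>T. complex_of_real (\<Sum>n\<in>{n \<in> {..<k} \<rightarrow>\<^sub>E {..<T}. inj_on n {..<k}}. \<Prod>i<k. measure (mode_law (n i)) (D i)))
    \<longlonglongrightarrow> of_real (LINT w|M. (\<Prod>i<k. real (card (G w \<inter> D i))))"
  proof -
    have "(LINT x:Pi\<^sub>E {..<k} D|?P. partial_det T k x)
      = complex_of_real (\<Sum>n\<in>{n \<in> {..<k} \<rightarrow>\<^sub>E {..<T}. inj_on n {..<k}}. \<Prod>i<k. measure (mode_law (n i)) (D i))" for T
      unfolding D_def by (rule set_integral_det_partial_kernel) (use A in auto)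
    moreover have "complex_of_real (LINT w|M. (\<Prod>i<k. real (card (G w \<inter> D i)))) =
      (LINT x:Pi\<^sub>E {..<k} D|?P. ginibre_det k x)"
      by (rule intensity[OF k D' dD])
    ultimately show ?thesis using lim by (simp only:)
  qed
  then show ?thesis by (rule tendsto_of_real_iff[THEN iffD1])
qed

section \<open>Independent sampling from the modes\<close>

interpretation modes: product_sigma_finite mode_law
  unfolding product_sigma_finite_def using prob_space_mode_law prob_space_imp_sigma_finite by blast

abbreviation annulus :: "real set \<Rightarrow> complex set" where
  "annulus A \<equiv> {z. norm z \<in> A}"

abbreviation mode_sample :: "nat \<Rightarrow> (nat \<Rightarrow> complex) measure" where
  "mode_sample T \<equiv> Pi\<^sub>M {..<T} mode_law"

abbreviation sample_count :: "nat \<Rightarrow> (nat \<Rightarrow> complex) \<Rightarrow> real set \<Rightarrow> nat" where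
  "sample_count T w A \<equiv> card {n. n < T \<and> norm (w n) \<in> A}"

abbreviation mode_prob :: "nat \<Rightarrow> real set \<Rightarrow> real" where
  "mode_prob n A \<equiv> measure (mode_law n) (annulus A)"

lemma prob_space_mode_sample: "prob_space (mode_sample T)"
  using prob_space_mode_law by (intro prob_space_PiM) auto

lemma sample_count_eq: "real (sample_count T w A) = (\<Sum>n<T. indicator (annulus A) (w n))"
proof -
  have "{n. n < T \<and> norm (w n) \<in> A} = {n \<in> {..<T}. w n \<in> annulus A}" by auto
  then show ?thesis by (simp add: indicator_def sum.If_cases Int_def)
qed

lemma borel_measurable_sample_count [measurable]:
  assumes [measurable]: "A \<in> sets borel"
  shows "(\<lambda>w. real (sample_count T w A)) \<in> borel_measurable (mode_sample T)"
  unfolding sample_count_eq by measurable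

lemma integrable_mode_law_bounded:
  fixes f :: "complex \<Rightarrow> 'a::{banach,second_countable_topology}"
  assumes "f \<in> borel_measurable borel" "\<And>z. norm (f z) \<le> B"
  shows "integrable (mode_law n) f"
proof -
  interpret prob_space "mode_law n" by (rule prob_space_mode_law)
  show ?thesis using assms by (intro integrable_const_bound[where B=B]) auto
qed

lemma integral_mode_sample_prod:
  fixes f :: "nat \<Rightarrow> complex \<Rightarrow> 'a::{real_normed_field,banach,second_countable_topology}"
  assumes "\<And>n. n < T \<Longrightarrow> f n \<in> borel_measurable borel" "\<And>n z. n < T \<Longrightarrow> norm (f n z) \<le> B"
  shows "(LINT w|mode_sample T. (\<Prod>n<T. f n (w n))) = (\<Prod>n<T. LINT z|mode_law n. f n z)"
    and "integrable (mode_sample T) (\<lambda>w. \<Prod>n<T. f n (w n))"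
  by (rule modes.product_integral_prod modes.product_integrable_prod;
      use assms in \<open>auto intro: integrable_mode_law_bounded\<close>)+

text \<open>For injective \<open>n\<close> the factors involve different coordinates and
  independence applies. If two labels coincide, one and the same point would have to lie in two
  disjoint annuli, so the integrand is 0. This reproduces the exclusion found in the
  determinants.\<close>

lemma integral_sample_indicators:
  fixes A :: "nat \<Rightarrow> real set" and n :: "nat \<Rightarrow> nat"
  assumes A[measurable]: "\<And>i. i < k \<Longrightarrow> A i \<in> sets borel" and disj: "disjoint_family_on A {..<k}"
    and n: "n \<in> {..<k} \<rightarrow>\<^sub>E {..<T}"
  shows "(LINT w|mode_sample T. (\<Prod>i<k. indicator (annulus (A i)) (w (n i)))) =
     (if inj_on n {..<k} then \<Prod>i<k. mode_prob (n i) (A i) else 0)"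
proof (cases "inj_on n {..<k}")
  case True
  \<comment> \<open>Coordinates that carry no label get the constant 1. This turns the product over
    labels into a product over all \<open>T\<close> coordinates, the form required by the product
    measure.\<close>
  define g :: "nat \<Rightarrow> complex \<Rightarrow> real" where
    "g m z = (if m \<in> n ` {..<k} then indicator (annulus (A (the_inv_into {..<k} n m))) z else 1)" for m z
  have inv: "the_inv_into {..<k} n (n i) = i" if "i < k" for i
    using the_inv_into_f_f[OF True] that by auto
  have sub: "n ` {..<k} \<subseteq> {..<T}" using n by auto
  have gm: "g m \<in> borel_measurable borel" for m
  proof (cases "m \<in> n ` {..<k}")
    case T: True
    then obtain i where "i < k" "m = n i" by auto
    then have "g m = indicator (annulus (A i))" by (auto simp: g_def inv)
    then show ?thesis using A[OF \<open>i < k\<close>] by simp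
  qed (simp add: g_def[abs_def])
  have prodg: "(\<Prod>m<T. h m) = (\<Prod>i<k. h (n i))" if "\<And>m. m \<notin> n ` {..<k} \<Longrightarrow> h m = 1" for h :: "nat \<Rightarrow> real"
  proof -
    have "(\<Prod>m<T. h m) = (\<Prod>m\<in>n ` {..<k}. h m)"
      using sub that by (intro prod.mono_neutral_right) auto
    then show ?thesis by (simp add: prod.reindex[OF True])
  qed
  have "(\<Prod>i<k. indicator (annulus (A i)) (w (n i))) = (\<Prod>m<T. g m (w m))" for w
    by (subst prodg) (auto simp: g_def inv)
  then have "(LINT w|mode_sample T. (\<Prod>i<k. indicator (annulus (A i)) (w (n i))))
    = (LINT w|mode_sample T. (\<Prod>m<T. g m (w m)))" by simp
  also have "\<dots> = (\<Prod>m<T. LINT z|mode_law m. g m z)"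
    by (rule integral_mode_sample_prod(1)[where B=1]) (auto simp: gm, auto simp: g_def)
  also have "\<dots> = (\<Prod>i<k. LINT z|mode_law (n i). g (n i) z)"
  proof (rule prodg)
    fix m assume m: "m \<notin> n ` {..<k}"
    interpret prob_space "mode_law m" by (rule prob_space_mode_law)
    show "(LINT z|mode_law m. g m z) = 1" using m by (simp add: g_def prob_space[unfolded space_mode_law])
  qed
  also have "\<dots> = (\<Prod>i<k. mode_prob (n i) (A i))"
    by (intro prod.cong refl) (auto simp: g_def inv)
  finally show ?thesis using True by simp
next
  case False
  then obtain i j where ij: "i < k" "j < k" "i \<noteq> j" "n i = n j" by (auto simp: inj_on_def)
  have "(\<Prod>i<k. indicator (annulus (A i)) (w (n i))) = (0::real)" for w :: "nat \<Rightarrow> complex"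
  proof -
    have "A i \<inter> A j = {}" using disj ij by (auto simp: disjoint_family_on_def)
    then have "norm (w (n i)) \<notin> A i \<or> norm (w (n j)) \<notin> A j" using ij by auto
    then have "\<exists>a\<in>{..<k}. indicator (annulus (A a)) (w (n a)) = (0::real)"
      using ij(1,2) by (elim disjE) (rule bexI[of _ i] bexI[of _ j]; auto)+
    then show ?thesis by (intro prod_zero) auto
  qed
  then show ?thesis using False by (simp only: if_False Bochner_Integration.integral_zero)
qed

text \<open>Each count is a sum of indicators over the sampled points; multiplying out gives a sum
  over assignments of points to sets, of which only the injective ones survive. The result is
  literally the expression obtained from the kernel truncated at \<open>T\<close> modes.\<close>

lemma sample_moment:
  fixes A :: "nat \<Rightarrow> real set"
  assumes A[measurable]: "\<And>i. i < k \<Longrightarrow> A i \<in> sets borel" and disj: "disjoint_family_on A {..<k}"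
  shows "(LINT w|mode_sample T. (\<Prod>i<k. real (sample_count T w (A i)))) =
    (\<Sum>n\<in>{n \<in> {..<k} \<rightarrow>\<^sub>E {..<T}. inj_on n {..<k}}. \<Prod>i<k. mode_prob (n i) (A i))"
proof -
  interpret prob_space "mode_sample T" by (rule prob_space_mode_sample)
  have int: "integrable (mode_sample T) (\<lambda>w. \<Prod>i<k. indicator (annulus (A i)) (w (n i)) :: real)"
    if n: "n \<in> {..<k} \<rightarrow>\<^sub>E {..<T}" for n
  proof (rule integrable_const_bound[where B="1::real"])
    show "AE w in mode_sample T. norm (\<Prod>i<k. indicator (annulus (A i)) (w (n i)) :: real) \<le> 1"
      by (intro AE_I2) (auto simp: prod_nonneg intro!: prod_le_1)
    show "(\<lambda>w. \<Prod>i<k. indicator (annulus (A i)) (w (n i)) :: real) \<in> borel_measurable (mode_sample T)"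
    proof (intro borel_measurable_prod)
      fix i assume i: "i \<in> {..<k}"
      then have "n i \<in> {..<T}" using n by auto
      then have [measurable]: "(\<lambda>w. w (n i)) \<in> measurable (mode_sample T) borel"
        using measurable_component_singleton[of "n i" "{..<T}" mode_law]
        by (simp cong: measurable_cong_sets)
      have [measurable]: "A i \<in> sets borel" using A i by auto
      show "(\<lambda>w. indicator (annulus (A i)) (w (n i)) :: real) \<in> borel_measurable (mode_sample T)"
        by measurable
    qed
  qed
  have "(\<lambda>w. \<Prod>i<k. real (sample_count T w (A i))) =
     (\<lambda>w. \<Sum>n\<in>{..<k} \<rightarrow>\<^sub>E {..<T}. \<Prod>i<k. indicator (annulus (A i)) (w (n i)))"
    unfolding sample_count_eq by (simp add: prod_sum_PiE)
  then have "(LINT w|mode_sample T. (\<Prod>i<k. real (sample_count T w (A i)))) =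
    (\<Sum>n\<in>{..<k} \<rightarrow>\<^sub>E {..<T}. if inj_on n {..<k} then \<Prod>i<k. mode_prob (n i) (A i) else 0)"
    using int by (simp add: Bochner_Integration.integral_sum integral_sample_indicators[OF A disj])
  also have "\<dots> = (\<Sum>n\<in>{n \<in> {..<k} \<rightarrow>\<^sub>E {..<T}. inj_on n {..<k}}. \<Prod>i<k. mode_prob (n i) (A i))"
    by (rule sum.inter_filter[symmetric]) (auto intro: finite_PiE)
  finally show ?thesis .
qed

text \<open>Kostlan's observation in the form of product moments: counting points of the Ginibre ensemble
  in disjoint annuli is, as far as such moments see, the same as sampling one point from each mode.\<close>

lemma ginibre_moment_comparison:
  fixes A :: "'i \<Rightarrow> real set"
  assumes gin: "ginibre_ensemble M G" and S: "finite S"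
    and A: "\<And>i. i \<in> S \<Longrightarrow> A i \<in> sets borel \<and> bounded (A i)"
    and disj: "disjoint_family_on A S"
  shows "(\<lambda>T. LINT w|mode_sample T. (\<Prod>i\<in>S. real (sample_count T w (A i))))
    \<longlonglongrightarrow> (LINT w|M. (\<Prod>i\<in>S. real (card (G w \<inter> annulus (A i)))))"
    and "integrable M (\<lambda>w. \<Prod>i\<in>S. real (card (G w \<inter> annulus (A i))))"
proof -
  interpret determinantal_process M G lborel ginibre_kernel
    using gin by (simp add: ginibre_ensemble_def)
  obtain e where e: "bij_betw e {..<card S} S"
    using ex_bij_betw_nat_finite[OF S] by (auto simp: lessThan_atLeast0)
  have re: "(\<Prod>i\<in>S. f i) = (\<Prod>i<card S. f (e i))" for f :: "'i \<Rightarrow> real"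
    using prod.reindex_bij_betw[OF e, of f] by simp
  have A': "A (e i) \<in> sets borel \<and> bounded (A (e i))" if "i < card S" for i
    using A bij_betwE[OF e] that by auto
  have disj': "disjoint_family_on (\<lambda>i. A (e i)) {..<card S}"
    using disj e unfolding disjoint_family_on_def bij_betw_def inj_on_def by blast
  show "(\<lambda>T. LINT w|mode_sample T. (\<Prod>i\<in>S. real (sample_count T w (A i))))
    \<longlonglongrightarrow> (LINT w|M. (\<Prod>i\<in>S. real (card (G w \<inter> annulus (A i)))))"
  \<comment> \<open>The intensity identities start at \<open>k = 1\<close>, so the empty product is
    treated apart. It does occur: the expansion over all subsets below contains the empty
    one.\<close>
  proof (cases "S = {}")
    case True
    have "(LINT w|mode_sample T. 1) = (1::real)" for T
      using prob_space.prob_space[OF prob_space_mode_sample] by simp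
    then show ?thesis using True by (simp add: prob_space)
  next
    case False
    then have "1 \<le> card S" using S by (simp add: Suc_le_eq card_gt_0_iff)
    then show ?thesis unfolding re
      by (subst sample_moment) (use A' disj' in \<open>auto intro!: ginibre_radial_moment[OF gin]\<close>)
  qed
  show "integrable M (\<lambda>w. \<Prod>i\<in>S. real (card (G w \<inter> annulus (A i))))"
  proof (cases "S = {}")
    case False
    then have k: "1 \<le> card S" using S by (simp add: Suc_le_eq card_gt_0_iff)
    have D: "annulus (A (e i)) \<in> sets borel \<and> compact (closure (annulus (A (e i))))" if "i < card S" for i
    proof -
      obtain a where "\<forall>x\<in>A (e i). \<bar>x\<bar> \<le> a" using A'[of i] \<open>i < card S\<close> by (auto simp: bounded_iff)
      then have "\<forall>z\<in>annulus (A (e i)). norm z \<le> a" by force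
      then show ?thesis using A'[OF that] by (auto simp: compact_closure bounded_iff)
    qed
    have "disjoint_family_on (\<lambda>i. annulus (A (e i))) {..<card S}"
      using disj' unfolding disjoint_family_on_def by blast
    then show ?thesis unfolding re by (intro integrable_count[OF k]) (use D in auto)
  qed simp
qed

lemma integrable_sample_count_prod:
  assumes "\<And>i. i \<in> S \<Longrightarrow> A i \<in> sets borel"
  shows "integrable (mode_sample T) (\<lambda>w. \<Prod>i\<in>S. real (sample_count T w (A i)))"
proof -
  interpret prob_space "mode_sample T" by (rule prob_space_mode_sample)
  have le: "real (sample_count T w (A i)) \<le> real T" for w i
    using card_mono[of "{..<T}" "{n. n < T \<and> norm (w n) \<in> A i}"] by auto
  show ?thesis
  proof (rule integrable_const_bound[where B="real T ^ card S"])
    show "AE w in mode_sample T. norm (\<Prod>i\<in>S. real (sample_count T w (A i))) \<le> real T ^ card S"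
    proof (rule AE_I2)
      fix w
      have "(\<Prod>i\<in>S. real (sample_count T w (A i))) \<le> (\<Prod>i\<in>S. real T)"
        by (intro prod_mono conjI le) simp
      then show "norm (\<Prod>i\<in>S. real (sample_count T w (A i))) \<le> real T ^ card S"
        by (simp add: prod_nonneg)
    qed
  qed (use assms in auto)
qed

text \<open>Multiplying out over the subsets of \<open>P\<close> leaves a finite linear combination
  of product moments of counts in disjoint annuli, and the comparison of moments applies to each
  term.\<close>

lemma ginibre_product_comparison:
  fixes A :: "'i \<Rightarrow> real set" and c :: "'i \<Rightarrow> complex"
  assumes gin: "ginibre_ensemble M G" and P: "finite P"
    and A: "\<And>i. i \<in> P \<Longrightarrow> A i \<in> sets borel \<and> bounded (A i)"
    and disj: "disjoint_family_on A P"
  shows "(\<lambda>T. LINT w|mode_sample T. (\<Prod>i\<in>P. 1 + c i * of_nat (sample_count T w (A i))))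
    \<longlonglongrightarrow> (LINT w|M. (\<Prod>i\<in>P. 1 + c i * of_nat (card (G w \<inter> annulus (A i)))))"
    and "integrable M (\<lambda>w. \<Prod>i\<in>P. 1 + c i * of_nat (card (G w \<inter> annulus (A i))))"
    and "integrable (mode_sample T) (\<lambda>w. \<Prod>i\<in>P. 1 + c i * of_nat (sample_count T w (A i)))"
proof -
  have expand: "(\<Prod>i\<in>P. 1 + c i * of_nat (N i)) =
      (\<Sum>S\<in>Pow P. (\<Prod>i\<in>S. c i) * of_real (\<Prod>i\<in>S. real (N i)))" for N :: "'i \<Rightarrow> nat"
    using prod_add[OF P, of "\<lambda>i. c i * of_nat (N i)" "\<lambda>_. 1"]
    by (simp add: add.commute prod.distrib)
  have S: "finite S" "disjoint_family_on A S" "\<And>i. i \<in> S \<Longrightarrow> A i \<in> sets borel \<and> bounded (A i)"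
    if "S \<in> Pow P" for S
    using that P A disj disjoint_family_on_mono[of S P A] by (auto intro: finite_subset)
  have int: "integrable M (\<lambda>w. \<Prod>i\<in>S. real (card (G w \<inter> annulus (A i))))"
    "integrable (mode_sample T) (\<lambda>w. \<Prod>i\<in>S. real (sample_count T w (A i)))" if "S \<in> Pow P" for S T
    using ginibre_moment_comparison(2)[OF gin S(1)[OF that] S(3)[OF that] S(2)[OF that]]
      integrable_sample_count_prod[of S A T] S(3)[OF that] by auto
  have int': "integrable M (\<lambda>w. (\<Prod>i\<in>S. c i) * of_real (\<Prod>i\<in>S. real (card (G w \<inter> annulus (A i)))))"
    "integrable (mode_sample T) (\<lambda>w. (\<Prod>i\<in>S. c i) * of_real (\<Prod>i\<in>S. real (sample_count T w (A i))))"
    if "S \<in> Pow P" for S T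
    using int[OF that] by (intro integrable_mult_right integrable_of_real; simp)+
  have pull: "integrable N f \<Longrightarrow> (LINT w|N. a * complex_of_real (f w)) = a * of_real (LINT w|N. f w)"
    for N :: "'z measure" and f a by simp
  show "integrable M (\<lambda>w. \<Prod>i\<in>P. 1 + c i * of_nat (card (G w \<inter> annulus (A i))))"
    unfolding expand by (intro Bochner_Integration.integrable_sum int'(1))
  show "integrable (mode_sample T) (\<lambda>w. \<Prod>i\<in>P. 1 + c i * of_nat (sample_count T w (A i)))"
    unfolding expand by (intro Bochner_Integration.integrable_sum int'(2))
  have "(\<lambda>T. \<Sum>S\<in>Pow P. (\<Prod>i\<in>S. c i) * of_real (LINT w|mode_sample T. (\<Prod>i\<in>S. real (sample_count T w (A i)))))
    \<longlonglongrightarrow> (\<Sum>S\<in>Pow P. (\<Prod>i\<in>S. c i) * of_real (LINT w|M. (\<Prod>i\<in>S. real (card (G w \<inter> annulus (A i))))))"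
    using S by (intro tendsto_intros ginibre_moment_comparison[OF gin]) auto
  moreover have "(LINT w|mode_sample T. (\<Prod>i\<in>P. 1 + c i * of_nat (sample_count T w (A i))))
     = (\<Sum>S\<in>Pow P. (\<Prod>i\<in>S. c i) * of_real (LINT w|mode_sample T. (\<Prod>i\<in>S. real (sample_count T w (A i)))))" for T
    unfolding expand
    by (subst Bochner_Integration.integral_sum, erule int'(2), intro sum.cong refl, rule pull, erule int(2))
  moreover have "(LINT w|M. (\<Prod>i\<in>P. 1 + c i * of_nat (card (G w \<inter> annulus (A i)))))
     = (\<Sum>S\<in>Pow P. (\<Prod>i\<in>S. c i) * of_real (LINT w|M. (\<Prod>i\<in>S. real (card (G w \<inter> annulus (A i))))))"
    unfolding expand
    by (subst Bochner_Integration.integral_sum, erule int'(1), intro sum.cong refl, rule pull, erule int(1))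
  ultimately show "(\<lambda>T. LINT w|mode_sample T. (\<Prod>i\<in>P. 1 + c i * of_nat (sample_count T w (A i))))
    \<longlonglongrightarrow> (LINT w|M. (\<Prod>i\<in>P. 1 + c i * of_nat (card (G w \<inter> annulus (A i)))))"
    by simp
qed

section \<open>Mean counts and moment bounds for the samples, uniform in the number of modes\<close>

text \<open>The kernel has the constant value \<open>1 / pi\<close> on the diagonal, so this is the
  expected number of Ginibre points in the annulus. It also equals the sum of all
  \<open>mode_prob n A\<close> for bounded Borel \<open>A\<close>, and thus bounds the mean of
  \<open>sample_count\<close> for every \<open>T\<close>.\<close>

definition mean_count :: "real set \<Rightarrow> real" where
  "mean_count A = measure lborel (annulus A) / pi"

lemma mean_count_nonneg: "mean_count A \<ge> 0"
  by (simp add: mean_count_def)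

lemma bounded_annulus: "bounded A \<Longrightarrow> bounded (annulus A)"
proof -
  assume "bounded A"
  then obtain a where "\<forall>x\<in>A. \<bar>x\<bar> \<le> a" by (auto simp: bounded_iff)
  then have "\<forall>z\<in>annulus A. norm z \<le> a" by force
  then show ?thesis by (auto simp: bounded_iff)
qed

lemma sum_emeasure_mode_law:
  assumes [measurable]: "B \<in> sets borel"
  shows "(\<Sum>n. emeasure (mode_law n) B) = emeasure lborel B / ennreal pi"
proof -
  have "(\<Sum>n. emeasure (mode_law n) B) = (\<Sum>n. \<integral>\<^sup>+z. ennreal ((norm (mode n z))\<^sup>2) * indicator B z \<partial>lborel)"
    unfolding mode_law_def by (intro suminf_cong emeasure_density) auto
  also have "\<dots> = (\<integral>\<^sup>+z. (\<Sum>n. ennreal ((norm (mode n z))\<^sup>2) * indicator B z) \<partial>lborel)"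
    by (rule nn_integral_suminf[symmetric]) measurable
  also have "\<dots> = (\<integral>\<^sup>+z. ennreal (1 / pi) * indicator B z \<partial>lborel)"
  proof (rule nn_integral_cong)
    fix z
    have "(\<Sum>n. ennreal ((norm (mode n z))\<^sup>2)) = ennreal (1 / pi)"
      using norm_mode_sq_sums[of z] by (intro suminf_ennreal_eq) auto
    then show "(\<Sum>n. ennreal ((norm (mode n z))\<^sup>2) * indicator B z) = ennreal (1 / pi) * indicator B z"
      by simp
  qed
  also have "\<dots> = ennreal (1 / pi) * emeasure lborel B" by (simp add: nn_integral_cmult_indicator)
  finally show ?thesis by (simp add: divide_ennreal[symmetric] mult.commute ennreal_times_divide)
qed

lemma mode_prob_sums:
  assumes [measurable]: "A \<in> sets borel" and "bounded A"
  shows "(\<lambda>n. mode_prob n A) sums mean_count A"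
proof -
  interpret prob_space "mode_law i" for i by (rule prob_space_mode_law)
  have fin: "emeasure lborel (annulus A) = ennreal (measure lborel (annulus A))"
    using emeasure_bounded_finite[OF bounded_annulus[OF assms(2)]]
    by (intro emeasure_eq_ennreal_measure) auto
  have "(\<Sum>n. ennreal (mode_prob n A)) = ennreal (mean_count A)"
  proof -
    have "(\<Sum>n. ennreal (mode_prob n A)) = (\<Sum>n. emeasure (mode_law n) (annulus A))"
      by (intro suminf_cong emeasure_eq_measure[symmetric])
    also have "\<dots> = emeasure lborel (annulus A) / ennreal pi"
      by (rule sum_emeasure_mode_law) measurable
    also have "\<dots> = ennreal (mean_count A)"
      unfolding fin mean_count_def by (intro divide_ennreal) auto
    finally show ?thesis .
  qed
  then have "(\<lambda>n. ennreal (mode_prob n A)) sums ennreal (mean_count A)"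
    using summable_sums[OF summableI, of "\<lambda>n. ennreal (mode_prob n A)"] by simp
  then show ?thesis by (subst (asm) sums_ennreal) (auto simp: mean_count_nonneg)
qed

lemma sum_mode_prob_le:
  assumes "A \<in> sets borel" "bounded A"
  shows "(\<Sum>n<T. mode_prob n A) \<le> mean_count A"
  using mode_prob_sums[OF assms] sum_le_suminf[of "\<lambda>n. mode_prob n A" "{..<T}"] by (auto simp: sums_iff)

text \<open>Independence turns the expectation into a product of factors
  \<open>1 + x * mode_prob n A\<close>, each at most the exponential of
  \<open>x * mode_prob n A\<close>; the exponents add up to at most \<open>x * mean_count A\<close>
  for every \<open>T\<close>.\<close>

lemma sample_power_expectation:
  assumes A[measurable]: "A \<in> sets borel" and "bounded A" and "x \<ge> 0"
  shows "(LINT w|mode_sample T. (1 + x) ^ sample_count T w A) \<le> exp (x * mean_count A)"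
    and "integrable (mode_sample T) (\<lambda>w. (1 + x) ^ sample_count T w A)"
proof -
  have eq: "(1 + x) ^ sample_count T w A = (\<Prod>n<T. 1 + x * indicator (annulus A) (w n))" for w
  proof -
    have "(\<Prod>n<T. 1 + x * indicator (annulus A) (w n)) = (\<Prod>n<T. if norm (w n) \<in> A then 1 + x else 1)"
      by (intro prod.cong) auto
    also have "\<dots> = (1 + x) ^ card ({..<T} \<inter> {n. norm (w n) \<in> A})"
      by (simp add: prod.If_cases)
    also have "{..<T} \<inter> {n. norm (w n) \<in> A} = {n. n < T \<and> norm (w n) \<in> A}" by auto
    finally show ?thesis by simp
  qed
  have b: "norm (1 + x * indicator (annulus A) z) \<le> 1 + x" for z
    using assms(3) by (auto simp: indicator_def)
  show "integrable (mode_sample T) (\<lambda>w. (1 + x) ^ sample_count T w A)"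
    unfolding eq by (rule integral_mode_sample_prod(2)[OF _ b]) measurable
  have "(LINT w|mode_sample T. (1 + x) ^ sample_count T w A) = (\<Prod>n<T. LINT z|mode_law n. 1 + x * indicator (annulus A) z)"
    unfolding eq by (rule integral_mode_sample_prod(1)[OF _ b]) measurable
  also have "\<dots> = (\<Prod>n<T. 1 + x * mode_prob n A)"
  proof (intro prod.cong refl)
    fix n
    interpret prob_space "mode_law n" by (rule prob_space_mode_law)
    have "integrable (mode_law n) (\<lambda>z. indicator (annulus A) z :: real)"
      by (rule integrable_mode_law_bounded[where B=1]) auto
    then show "(LINT z|mode_law n. 1 + x * indicator (annulus A) z) = 1 + x * mode_prob n A"
      by (subst Bochner_Integration.integral_add) (auto simp: prob_space[unfolded space_mode_law])
  qed
  also have "\<dots> \<le> (\<Prod>n<T. exp (x * mode_prob n A))"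
    using assms(3) by (intro prod_mono) auto
  also have "\<dots> = exp (x * (\<Sum>n<T. mode_prob n A))"
    by (simp add: exp_sum sum_distrib_left)
  also have "\<dots> \<le> exp (x * mean_count A)"
    using assms sum_mode_prob_le[OF A assms(2)] by (simp add: mult_left_mono)
  finally show "(LINT w|mode_sample T. (1 + x) ^ sample_count T w A) \<le> exp (x * mean_count A)" .
qed

text \<open>\<open>N * (N - 1)\<close> counts ordered pairs of distinct indices, whose points are
  independent. Adding the missing diagonal terms completes the double sum to the square of the
  mean.\<close>

lemma sample_pair_expectation:
  assumes A[measurable]: "A \<in> sets borel" and "bounded A"
  shows "(\<integral>\<^sup>+w. ennreal (real (sample_count T w A) * (real (sample_count T w A) - 1)) \<partial>mode_sample T)
    \<le> ennreal ((mean_count A)\<^sup>2)"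
proof -
  interpret prob_space "mode_sample T" by (rule prob_space_mode_sample)
  interpret m: prob_space "mode_law i" for i by (rule prob_space_mode_law)
  let ?D = "annulus A"
  have eq: "real (sample_count T w A) * (real (sample_count T w A) - 1)
      = (\<Sum>n<T. \<Sum>m\<in>{..<T} - {n}. indicator ?D (w n) * indicator ?D (w m))" for w
  proof -
    have "real (sample_count T w A) * (real (sample_count T w A) - 1) =
      (\<Sum>n<T. indicator ?D (w n) * (real (sample_count T w A) - 1))"
      unfolding sum_distrib_right[symmetric] by (simp add: sample_count_eq)
    also have "\<dots> = (\<Sum>n<T. \<Sum>m\<in>{..<T} - {n}. indicator ?D (w n) * indicator ?D (w m))"
    proof (intro sum.cong refl)
      fix n assume n: "n \<in> {..<T}"
      have "real (sample_count T w A) = indicator ?D (w n) + (\<Sum>m\<in>{..<T} - {n}. indicator ?D (w m))"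
        unfolding sample_count_eq using n by (subst sum.remove[of _ n]) auto
      then show "indicator ?D (w n) * (real (sample_count T w A) - 1)
        = (\<Sum>m\<in>{..<T} - {n}. indicator ?D (w n) * indicator ?D (w m))"
        by (auto simp: sum_distrib_left[symmetric] indicator_def)
    qed
    finally show ?thesis .
  qed
  have pair: "(\<integral>\<^sup>+w. ennreal (indicator ?D (w n) * indicator ?D (w m)) \<partial>mode_sample T)
     = ennreal (mode_prob n A * mode_prob m A)" if "n < T" "m < T" "n \<noteq> m" for n m
  proof -
    have "(\<integral>\<^sup>+w. ennreal (indicator ?D (w n) * indicator ?D (w m)) \<partial>mode_sample T)
      = (\<integral>\<^sup>+w. (\<Prod>i<T. if i = n \<or> i = m then indicator ?D (w i) else 1) \<partial>mode_sample T)"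
    proof (rule nn_integral_cong)
      fix w
      have "(\<Prod>i<T. if i = n \<or> i = m then indicator ?D (w i) else 1 :: ennreal)
        = (\<Prod>i\<in>{n, m}. if i = n \<or> i = m then indicator ?D (w i) else 1)"
        using that by (intro prod.mono_neutral_right) auto
      also have "\<dots> = indicator ?D (w n) * indicator ?D (w m)" using that by simp
      finally show "ennreal (indicator ?D (w n) * indicator ?D (w m)) =
         (\<Prod>i<T. if i = n \<or> i = m then indicator ?D (w i) else 1)"
        by (simp add: ennreal_mult ennreal_indicator)
    qed
    also have "\<dots> = (\<Prod>i<T. \<integral>\<^sup>+z. (if i = n \<or> i = m then indicator ?D z else 1) \<partial>mode_law i)"
      by (rule modes.product_nn_integral_prod) auto
    also have "\<dots> = (\<Prod>i\<in>{n, m}. \<integral>\<^sup>+z. (if i = n \<or> i = m then indicator ?D z else 1) \<partial>mode_law i)"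
      using that m.emeasure_space_1 by (intro prod.mono_neutral_right) auto
    also have "\<dots> = ennreal (mode_prob n A * mode_prob m A)"
      using that by (simp add: m.emeasure_eq_measure ennreal_mult)
    finally show ?thesis .
  qed
  have "(\<integral>\<^sup>+w. ennreal (real (sample_count T w A) * (real (sample_count T w A) - 1)) \<partial>mode_sample T)
    = (\<Sum>n<T. \<Sum>m\<in>{..<T} - {n}. \<integral>\<^sup>+w. ennreal (indicator ?D (w n) * indicator ?D (w m)) \<partial>mode_sample T)"
  proof -
    have comp[measurable]: "(\<lambda>w. w n) \<in> measurable (mode_sample T) borel" if "n < T" for n
      using measurable_component_singleton[of n "{..<T}" mode_law] that by (simp cong: measurable_cong_sets)
    have meas: "(\<lambda>w. ennreal (indicator ?D (w n) * indicator ?D (w m))) \<in> borel_measurable (mode_sample T)"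
      if "n < T" "m < T" for n m
      using that by measurable
    have "(\<integral>\<^sup>+w. ennreal (real (sample_count T w A) * (real (sample_count T w A) - 1)) \<partial>mode_sample T)
      = (\<integral>\<^sup>+w. (\<Sum>n<T. \<Sum>m\<in>{..<T} - {n}. ennreal (indicator ?D (w n) * indicator ?D (w m))) \<partial>mode_sample T)"
      unfolding eq by (simp add: sum_ennreal sum_nonneg)
    also have "\<dots> = (\<Sum>n<T. \<integral>\<^sup>+w. (\<Sum>m\<in>{..<T} - {n}. ennreal (indicator ?D (w n) * indicator ?D (w m))) \<partial>mode_sample T)"
      by (rule nn_integral_sum) (auto intro!: borel_measurable_sum meas)
    also have "\<dots> = (\<Sum>n<T. \<Sum>m\<in>{..<T} - {n}. \<integral>\<^sup>+w. ennreal (indicator ?D (w n) * indicator ?D (w m)) \<partial>mode_sample T)"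
      by (intro sum.cong refl nn_integral_sum meas) auto
    finally show ?thesis .
  qed
  also have "\<dots> = (\<Sum>n<T. \<Sum>m\<in>{..<T} - {n}. ennreal (mode_prob n A * mode_prob m A))"
    by (intro sum.cong refl pair) auto
  also have "\<dots> \<le> (\<Sum>n<T. \<Sum>m<T. ennreal (mode_prob n A * mode_prob m A))"
    by (intro sum_mono sum_mono2) auto
  also have "\<dots> = ennreal ((\<Sum>n<T. mode_prob n A) * (\<Sum>m<T. mode_prob m A))"
    by (simp add: sum_product sum_ennreal sum_nonneg)
  also have "\<dots> \<le> ennreal ((mean_count A)\<^sup>2)"
    unfolding power2_eq_square using sum_mode_prob_le[OF assms]
    by (intro ennreal_leI mult_mono) (auto intro: sum_nonneg mean_count_nonneg)
  finally show ?thesis .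
qed

section \<open>Pair counts and counting products\<close>

lemma norm_det_ginibre_le:
  "norm (ginibre_det k x) \<le> fact k"
  by (rule LIMSEQ_le_const2[OF tendsto_norm[OF det_ginibre_limit]]) (use norm_det_partial_kernel_le in blast)

lemma measure_PiE_lborel:
  fixes k :: nat and D :: "nat \<Rightarrow> complex set"
  assumes "\<And>i. i < k \<Longrightarrow> D i \<in> sets borel \<and> bounded (D i)"
  shows "measure (Pi\<^sub>M {..<k} (\<lambda>_. lborel)) (Pi\<^sub>E {..<k} D) = (\<Prod>i<k. measure lborel (D i))"
proof -
  have "emeasure (Pi\<^sub>M {..<k} (\<lambda>_. lborel :: complex measure)) (Pi\<^sub>E {..<k} D) = (\<Prod>i<k. emeasure lborel (D i))"
    using assms by (intro lborel_prod.emeasure_PiM) auto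
  also have "\<dots> = (\<Prod>i<k. ennreal (measure lborel (D i)))"
  proof (intro prod.cong refl emeasure_eq_ennreal_measure)
    fix i assume "i \<in> {..<k}"
    then show "emeasure lborel (D i) \<noteq> \<top>" using assms emeasure_bounded_finite[of "D i"] by auto
  qed
  also have "\<dots> = ennreal (\<Prod>i<k. measure lborel (D i))" by (simp add: prod_ennreal)
  finally show ?thesis by (intro measure_eq_emeasure_eq_ennreal) (auto intro: prod_nonneg)
qed

lemma integral_norm_le_integral:
  fixes f :: "'a \<Rightarrow> 'b::{banach,second_countable_topology}"
  assumes "integrable M f" "integrable M g" "\<And>x. norm (f x) \<le> g x"
  shows "norm (LINT x|M. f x) \<le> (LINT x|M. g x)"
  by (rule order_trans[OF integral_norm_bound integral_mono]) (use assms in auto)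

text \<open>The intensity identity with \<open>k = 2\<close>; the factor 2 is the crude bound
  \<open>fact 2\<close> on the determinant. For later use only the proportionality to both areas
  matters.\<close>

lemma ginibre_pair_bound:
  assumes gin: "ginibre_ensemble M G"
    and B: "B \<in> sets borel" "bounded B" and C: "C \<in> sets borel" "bounded C" and "B \<inter> C = {}"
  shows "(\<integral>\<^sup>+w. ennreal (real (card (G w \<inter> B)) * real (card (G w \<inter> C))) \<partial>M)
    \<le> ennreal (2 * measure lborel B * measure lborel C)"
proof -
  interpret determinantal_process M G lborel ginibre_kernel
    using gin by (simp add: ginibre_ensemble_def)
  define \<Delta> where "\<Delta> i = (if i = 0 then B else C)" for i :: nat
  let ?P = "Pi\<^sub>M {..<2::nat} (\<lambda>_. lborel :: complex measure)"
  have D: "\<Delta> i \<in> sets borel \<and> bounded (\<Delta> i)" for i using B C by (simp add: \<Delta>_def)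
  then have D': "\<Delta> i \<in> sets borel \<and> compact (closure (\<Delta> i))" for i by (simp add: compact_closure)
  have dD: "disjoint_family_on \<Delta> {..<2}"
    using assms(6) by (auto simp: disjoint_family_on_def \<Delta>_def)
  have two: "(\<Prod>i<(2::nat). f i) = f 0 * f 1" for f :: "nat \<Rightarrow> real" by (simp add: numeral_2_eq_2)
  have prod_eq: "(\<Prod>i<(2::nat). real (card (G w \<inter> \<Delta> i))) = real (card (G w \<inter> B)) * real (card (G w \<inter> C))" for w
    unfolding two by (simp add: \<Delta>_def)
  have "norm (complex_of_real (expectation (\<lambda>w. \<Prod>i<(2::nat). real (card (G w \<inter> \<Delta> i)))))
    \<le> (LINT x|?P. 2 * indicator (Pi\<^sub>E {..<2} \<Delta>) x)"
    unfolding intensity[of 2 \<Delta>, OF one_le_numeral D' dD] set_lebesgue_integral_def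
  proof (rule integral_norm_le_integral)
    show "integrable ?P (\<lambda>x. indicator (Pi\<^sub>E {..<2} \<Delta>) x *\<^sub>R
        ginibre_det 2 x)"
      using integrable_det[of 2 \<Delta>, OF one_le_numeral D' dD] by (simp add: set_integrable_def)
    show "integrable ?P (\<lambda>x. 2 * indicator (Pi\<^sub>E {..<2} \<Delta>) x :: real)"
      using emeasure_PiE_lborel_finite[of 2 \<Delta>] D by (intro integrable_mult_right) auto
    show "norm (indicator (Pi\<^sub>E {..<2} \<Delta>) x *\<^sub>R
        ginibre_det 2 x)
      \<le> 2 * indicator (Pi\<^sub>E {..<2} \<Delta>) x" for x
      using norm_det_ginibre_le[of 2 x] by (auto simp: indicator_def fact_2)
  qed
  also have "\<dots> = 2 * measure ?P (Pi\<^sub>E {..<2} \<Delta>)"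
    using emeasure_PiE_lborel_finite[of 2 \<Delta>] D by simp
  also have "\<dots> = 2 * measure lborel B * measure lborel C"
    using D by (subst measure_PiE_lborel) (simp_all only: two, simp_all add: \<Delta>_def)
  finally have E: "expectation (\<lambda>w. \<Prod>i<(2::nat). real (card (G w \<inter> \<Delta> i))) \<le> 2 * measure lborel B * measure lborel C"
    by simp
  have "(\<integral>\<^sup>+w. ennreal (\<Prod>i<(2::nat). real (card (G w \<inter> \<Delta> i))) \<partial>M)
    = ennreal (expectation (\<lambda>w. \<Prod>i<(2::nat). real (card (G w \<inter> \<Delta> i))))"
    by (intro nn_integral_eq_integral integrable_count D' dD) (auto intro!: prod_nonneg)
  then show ?thesis using E by (simp only: prod_eq ennreal_leI)
qed

lemma sum_card_fibres:
  assumes "finite F" "finite J" "g ` F \<subseteq> J"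
  shows "(\<Sum>i\<in>J. real (card {z \<in> F. g z = i})) = real (card F)"
  using sum.group[OF assms, of "\<lambda>_. 1 :: real"] by simp

lemma eventually_floor_neq:
  fixes x y :: real
  assumes "x \<noteq> y"
  shows "\<forall>\<^sub>F m in sequentially. \<lfloor>real m * x\<rfloor> \<noteq> \<lfloor>real m * y\<rfloor>"
proof -
  have "\<forall>\<^sub>F m in sequentially. 1 / \<bar>x - y\<bar> \<le> real m"
    by (rule eventually_sequentiallyI[of "nat \<lceil>1 / \<bar>x - y\<bar>\<rceil>"]) linarith
  then show ?thesis
  proof eventually_elim
    case (elim m)
    then have "1 \<le> real m * \<bar>x - y\<bar>" using assms by (simp add: field_simps)
    also have "\<dots> = \<bar>real m * x - real m * y\<bar>" by (simp add: abs_mult right_diff_distrib[symmetric])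
    finally show ?case by linarith
  qed
qed

text \<open>Disjoint cells only see pairs in different cells; a refining grid separates all points of a
  finite configuration, so Fatou's lemma recovers all pairs.\<close>

lemma ginibre_pair_expectation:
  assumes gin: "ginibre_ensemble M G" and B[measurable]: "B \<in> sets borel" and "bounded B"
  shows "(\<integral>\<^sup>+w. ennreal (real (card (G w \<inter> B)) * (real (card (G w \<inter> B)) - 1)) \<partial>M)
    \<le> ennreal (2 * (measure lborel B)\<^sup>2)"
proof -
  interpret determinantal_process M G lborel ginibre_kernel
    using gin by (simp add: ginibre_ensemble_def)
  define q where "q m z = (\<lfloor>real m * Re z\<rfloor>, \<lfloor>real m * Im z\<rfloor>)" for m :: nat and z
  define J where "J m = q m ` B" for m
  define Q where "Q m i = {z \<in> B. q m z = i}" for m i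
  \<comment> \<open>\<open>S m w\<close> counts ordered pairs of points in different cells of the
    grid of mesh \<open>1 / m\<close>. Grids for successive \<open>m\<close> are not nested, so
    \<open>S m w\<close> need not be monotone in \<open>m\<close>; it is eventually constant for
    each \<open>w\<close>, which is enough for Fatou's lemma.\<close>
  define S where "S m w = (\<Sum>i\<in>J m. \<Sum>j\<in>J m - {i}. ennreal (real (card (G w \<inter> Q m i)) * real (card (G w \<inter> Q m j))))" for m w
  obtain a where a: "norm z \<le> a" if "z \<in> B" for z using assms(3) by (auto simp: bounded_iff)
  have finJ: "finite (J m)" for m
  proof (rule finite_subset)
    have "\<bar>real m * Re z\<bar> \<le> real m * a" "\<bar>real m * Im z\<bar> \<le> real m * a" if "z \<in> B" for z
      using a[OF that] abs_Re_le_cmod[of z] abs_Im_le_cmod[of z]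
      by (auto simp: abs_mult intro!: mult_left_mono)
    then have *: "\<lfloor>- (real m * a)\<rfloor> \<le> \<lfloor>real m * Re z\<rfloor>" "\<lfloor>real m * Re z\<rfloor> \<le> \<lfloor>real m * a\<rfloor>"
      "\<lfloor>- (real m * a)\<rfloor> \<le> \<lfloor>real m * Im z\<rfloor>" "\<lfloor>real m * Im z\<rfloor> \<le> \<lfloor>real m * a\<rfloor>" if "z \<in> B" for z
      using that by (auto intro!: floor_mono simp: abs_le_iff) (smt (verit))+
    show "J m \<subseteq> {\<lfloor>- (real m * a)\<rfloor>..\<lfloor>real m * a\<rfloor>} \<times> {\<lfloor>- (real m * a)\<rfloor>..\<lfloor>real m * a\<rfloor>}"
      using * by (auto simp: J_def q_def)
  qed auto
  have Qm: "Q m i \<in> sets borel" for m i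
  proof -
    have "Q m i = {z \<in> B. \<lfloor>real m * Re z\<rfloor> = fst i \<and> \<lfloor>real m * Im z\<rfloor> = snd i}"
      by (auto simp: Q_def q_def)
    then show ?thesis by simp
  qed
  have Qb: "bounded (Q m i)" for m i
    by (rule bounded_subset[OF assms(3)]) (auto simp: Q_def)
  have Nm: "(\<lambda>w. real (card (G w \<inter> Q m i))) \<in> borel_measurable M" for m i
    using Qb by (intro measurable_count Qm) (simp add: compact_closure)
  have conv: "(\<lambda>m. S m w) \<longlonglongrightarrow> ennreal (real (card (G w \<inter> B)) * (real (card (G w \<inter> B)) - 1))"
    if w: "w \<in> space M" for w
  proof (rule tendsto_eventually)
    let ?F = "G w \<inter> B"
    have "compact (closure B)" using assms(3) by (simp only: compact_closure)
    then have "finite (G w \<inter> closure B)" using w by (intro locally_finite)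
    then have F: "finite ?F" by (rule finite_subset[rotated]) (use closure_subset in auto)
    have "\<forall>\<^sub>F m in sequentially. \<forall>p\<in>?F \<times> ?F. fst p \<noteq> snd p \<longrightarrow> q m (fst p) \<noteq> q m (snd p)"
    proof (intro eventually_ball_finite ballI)
      fix p assume "p \<in> ?F \<times> ?F"
      show "\<forall>\<^sub>F m in sequentially. fst p \<noteq> snd p \<longrightarrow> q m (fst p) \<noteq> q m (snd p)"
      proof (cases "Re (fst p) = Re (snd p)")
        case True
        show ?thesis
        proof (cases "Im (fst p) = Im (snd p)")
          case True
          with \<open>Re (fst p) = Re (snd p)\<close> show ?thesis by (simp add: complex_eq_iff)
        next
          case False
          then show ?thesis using eventually_floor_neq[OF False] by eventually_elim (simp add: q_def)
        qed
      next
        case False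
        then show ?thesis using eventually_floor_neq[OF False] by eventually_elim (simp add: q_def)
      qed
    qed (use F in auto)
    then show "\<forall>\<^sub>F m in sequentially. S m w = ennreal (real (card ?F) * (real (card ?F) - 1))"
    proof eventually_elim
      case (elim m)
      define N where "N i = real (card (G w \<inter> Q m i))" for i
      have GQ: "G w \<inter> Q m i = {z \<in> ?F. q m z = i}" for i by (auto simp: Q_def)
      have sumN: "(\<Sum>i\<in>J m. N i) = real (card ?F)"
        unfolding N_def GQ by (rule sum_card_fibres[OF F finJ]) (auto simp: J_def)
      \<comment> \<open>Once the grid separates all points, each cell count is 0 or 1. Leaving out
        the diagonal of the double sum then subtracts \<open>N i\<close> instead of its square,
        which produces \<open>N * (N - 1)\<close>.\<close>
      have "N i * N i = N i" for i
      proof -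
        have "card {z \<in> ?F. q m z = i} \<le> 1"
        proof (subst card_le_Suc0_iff_eq[folded One_nat_def])
          show "finite {z \<in> ?F. q m z = i}" using F by (rule finite_subset[rotated]) auto
          show "\<forall>x\<in>{z \<in> ?F. q m z = i}. \<forall>y\<in>{z \<in> ?F. q m z = i}. x = y"
          proof (intro ballI)
            fix x y assume xy: "x \<in> {z \<in> ?F. q m z = i}" "y \<in> {z \<in> ?F. q m z = i}"
            then have "(x, y) \<in> ?F \<times> ?F" by auto
            then show "x = y" using elim xy by force
          qed
        qed
        then have "card {z \<in> ?F. q m z = i} = 0 \<or> card {z \<in> ?F. q m z = i} = 1" by linarith
        then show ?thesis unfolding N_def GQ by auto
      qed
      then have "(\<Sum>i\<in>J m. \<Sum>j\<in>J m - {i}. N i * N j) = (\<Sum>i\<in>J m. N i * real (card ?F) - N i)"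
        by (intro sum.cong refl)
          (simp add: sum_distrib_left[symmetric] sum_diff1[OF finJ] sumN right_diff_distrib)
      also have "\<dots> = real (card ?F) * (real (card ?F) - 1)"
        by (simp add: sum_subtractf sum_distrib_right[symmetric] sumN right_diff_distrib)
      finally have "(\<Sum>i\<in>J m. \<Sum>j\<in>J m - {i}. N i * N j) = real (card ?F) * (real (card ?F) - 1)" .
      moreover have "S m w = ennreal (\<Sum>i\<in>J m. \<Sum>j\<in>J m - {i}. N i * N j)"
        unfolding S_def N_def by (simp add: sum_ennreal sum_nonneg)
      ultimately show ?case by simp
    qed
  qed
  have bound: "(\<integral>\<^sup>+w. S m w \<partial>M) \<le> ennreal (2 * (measure lborel B)\<^sup>2)" for m
  proof -
    have sumB: "(\<Sum>i\<in>J m. measure lborel (Q m i)) = measure lborel B"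
    proof -
      have "B = (\<Union>i\<in>J m. Q m i)" by (auto simp: J_def Q_def)
      moreover have "measure lborel (\<Union>i\<in>J m. Q m i) = (\<Sum>i\<in>J m. measure lborel (Q m i))"
      proof (intro measure_finite_Union finJ)
        show "disjoint_family_on (Q m) (J m)" by (auto simp: disjoint_family_on_def Q_def)
        show "Q m ` J m \<subseteq> sets lborel" using Qm by auto
        show "emeasure lborel (Q m i) \<noteq> \<infinity>" for i
          using emeasure_bounded_finite[OF Qb] by (simp add: less_top)
      qed
      ultimately show ?thesis by simp
    qed
    have "(\<integral>\<^sup>+w. S m w \<partial>M) = (\<Sum>i\<in>J m. \<integral>\<^sup>+w. (\<Sum>j\<in>J m - {i}. ennreal (real (card (G w \<inter> Q m i)) * real (card (G w \<inter> Q m j)))) \<partial>M)"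
      unfolding S_def by (rule nn_integral_sum) (use Nm in \<open>auto intro!: borel_measurable_sum\<close>)
    also have "\<dots> = (\<Sum>i\<in>J m. \<Sum>j\<in>J m - {i}. \<integral>\<^sup>+w. ennreal (real (card (G w \<inter> Q m i)) * real (card (G w \<inter> Q m j))) \<partial>M)"
      by (intro sum.cong refl nn_integral_sum) (use Nm in auto)
    also have "\<dots> \<le> (\<Sum>i\<in>J m. \<Sum>j\<in>J m - {i}. ennreal (2 * measure lborel (Q m i) * measure lborel (Q m j)))"
      by (intro sum_mono ginibre_pair_bound[OF gin] Qm Qb) (auto simp: Q_def)
    also have "\<dots> \<le> (\<Sum>i\<in>J m. \<Sum>j\<in>J m. ennreal (2 * measure lborel (Q m i) * measure lborel (Q m j)))"
      by (intro sum_mono sum_mono2 finJ) auto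
    also have "\<dots> = ennreal (2 * (\<Sum>i\<in>J m. measure lborel (Q m i)) * (\<Sum>j\<in>J m. measure lborel (Q m j)))"
      by (simp add: sum_ennreal sum_nonneg sum_distrib_left[symmetric] sum_distrib_right[symmetric] mult.assoc)
    finally show ?thesis by (simp add: sumB power2_eq_square mult.assoc)
  qed
  have "(\<integral>\<^sup>+w. ennreal (real (card (G w \<inter> B)) * (real (card (G w \<inter> B)) - 1)) \<partial>M)
    = (\<integral>\<^sup>+w. liminf (\<lambda>m. S m w) \<partial>M)"
    by (intro nn_integral_cong lim_imp_Liminf[symmetric] conv) auto
  also have "\<dots> \<le> liminf (\<lambda>m. \<integral>\<^sup>+w. S m w \<partial>M)"
    unfolding S_def using Nm by (intro nn_integral_liminf) auto
  also have "\<dots> \<le> liminf (\<lambda>m::nat. ennreal (2 * (measure lborel B)\<^sup>2))"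
    using bound by (intro Liminf_mono always_eventually) auto
  finally show ?thesis by (simp add: Liminf_const)
qed

section \<open>Replacing powers of counts by affine factors\<close>

lemma one_plus_mult_le_power:
  fixes x :: real
  assumes "x \<ge> 0"
  shows "1 + x * real n \<le> (1 + x) ^ n"
  using Bernoulli_inequality[of x n] assms by (simp add: mult.commute)

text \<open>The two products agree unless some \<open>n i\<close> is at least 2, in which case the
  pair sum is at least 1. In that case the first product has modulus 1, and the second at most 3 to
  the total count, because \<open>norm (c i) \<le> 2\<close> and
  \<open>1 + 2 * n \<le> 3 ^ n\<close>. The parameter \<open>\<eta>\<close> separates exponential
  size from pair count, so that only their separate expectations are needed; the base 9 is the
  square of 3.\<close>

lemma norm_power_product_diff_le:
  fixes c :: "'i \<Rightarrow> complex" and n :: "'i \<Rightarrow> nat"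
  assumes P: "finite P" and c: "\<And>i. i \<in> P \<Longrightarrow> norm (1 + c i) = 1" and \<eta>: "\<eta> > 0"
  shows "norm ((\<Prod>i\<in>P. (1 + c i) ^ n i) - (\<Prod>i\<in>P. 1 + c i * of_nat (n i)))
    \<le> \<eta> * 9 ^ (\<Sum>i\<in>P. n i) + (\<Sum>i\<in>P. real (n i) * (real (n i) - 1)) / \<eta>" (is "?L \<le> _")
proof (cases "\<forall>i\<in>P. n i \<le> 1")
  case True
  have "(1 + c i) ^ n i = 1 + c i * of_nat (n i)" if "i \<in> P" for i
  proof -
    have "n i = 0 \<or> n i = 1" using True that by (auto simp: le_Suc_eq)
    then show ?thesis by auto
  qed
  then have "?L = 0" by simp
  moreover have "(\<Sum>i\<in>P. real (n i) * (real (n i) - 1)) = 0"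
    using True by (intro sum.neutral) (auto simp: le_Suc_eq)
  ultimately show ?thesis using \<eta> by simp
next
  case False
  then obtain k where k: "k \<in> P" "n k \<ge> 2" by auto
  have "1 * 1 \<le> real (n k) * (real (n k) - 1)" using k by (intro mult_mono) auto
  also have "\<dots> \<le> (\<Sum>i\<in>P. real (n i) * (real (n i) - 1))"
  proof (rule member_le_sum[OF k(1) _ P])
    fix i show "0 \<le> real (n i) * (real (n i) - 1)" by (cases "n i") auto
  qed
  finally have Q: "1 \<le> (\<Sum>i\<in>P. real (n i) * (real (n i) - 1))" by simp
  define a :: real where "a = 3 ^ (\<Sum>i\<in>P. n i)"
  have a: "a \<ge> 1" by (simp add: a_def)
  have a2: "9 ^ (\<Sum>i\<in>P. n i) = a * a"
    unfolding a_def power_mult_distrib[symmetric] by simp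
  have c2: "norm (c i) \<le> 2" if "i \<in> P" for i
    using norm_triangle_ineq4[of "1 + c i" 1] c[OF that] by simp
  have "norm (\<Prod>i\<in>P. 1 + c i * of_nat (n i)) \<le> (\<Prod>i\<in>P. 3 ^ n i)"
    unfolding prod_norm[symmetric]
  proof (intro prod_mono conjI)
    fix i assume i: "i \<in> P"
    have "norm (1 + c i * of_nat (n i)) \<le> 1 + norm (c i) * real (n i)"
      by (rule order_trans[OF norm_triangle_ineq]) (simp add: norm_mult)
    also have "\<dots> \<le> 1 + 2 * real (n i)" using c2[OF i] by (simp add: mult_right_mono)
    also have "\<dots> \<le> 3 ^ n i" using one_plus_mult_le_power[of 2 "n i"] by simp
    finally show "norm (1 + c i * of_nat (n i)) \<le> 3 ^ n i" .
  qed simp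
  also have "\<dots> = a" by (simp add: a_def power_sum)
  finally have B: "norm (\<Prod>i\<in>P. 1 + c i * of_nat (n i)) \<le> a" .
  have "norm (\<Prod>i\<in>P. (1 + c i) ^ n i) = 1"
    unfolding prod_norm[symmetric] using c by (intro prod.neutral) (simp add: norm_power)
  then have "?L \<le> 2 * a"
    using norm_triangle_ineq4[of "\<Prod>i\<in>P. (1 + c i) ^ n i" "\<Prod>i\<in>P. 1 + c i * of_nat (n i)"] a B by linarith
  \<comment> \<open>Weighted arithmetic-geometric mean inequality; the term
    \<open>1 / \<eta>\<close> is then absorbed by the pair sum, which is at least 1.\<close>
  also have "2 * a \<le> \<eta> * (a * a) + 1 / \<eta>"
  proof -
    have "0 \<le> (\<eta> * a - 1)\<^sup>2 / \<eta>" using \<eta> by simp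
    also have "\<dots> = \<eta> * (a * a) + 1 / \<eta> - 2 * a" using \<eta> by (simp add: power2_eq_square field_simps)
    finally show ?thesis by simp
  qed
  also have "\<dots> \<le> \<eta> * (a * a) + (\<Sum>i\<in>P. real (n i) * (real (n i) - 1)) / \<eta>"
    using Q \<eta> by (intro add_left_mono divide_right_mono) auto
  finally show ?thesis by (simp add: a2)
qed

text \<open>A point process provides measurability of real-valued counts, while powers of counts are
  composed as functions on the discrete space of natural numbers.\<close>

lemma measurable_nat_of_real:
  assumes "(\<lambda>w. real (n w)) \<in> borel_measurable M"
  shows "n \<in> measurable M (count_space UNIV)"
proof -
  have "(\<lambda>w. nat \<lfloor>real (n w)\<rfloor>) \<in> measurable M (count_space UNIV)" using assms by measurable
  then show ?thesis by simp
qed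

text \<open>The pointwise bound, integrated. It is stated over an arbitrary probability space
  because it is applied twice with the same constants: to the point process and to the
  samples.\<close>

lemma (in prob_space) expectation_power_product_approx:
  fixes c :: "'i \<Rightarrow> complex" and n :: "'i \<Rightarrow> 'a \<Rightarrow> nat"
  assumes P: "finite P" and c: "\<And>i. i \<in> P \<Longrightarrow> norm (1 + c i) = 1" and \<eta>: "\<eta> > 0"
    and n: "\<And>i. i \<in> P \<Longrightarrow> (\<lambda>w. real (n i w)) \<in> borel_measurable M"
    and D: "(\<integral>\<^sup>+w. ennreal (9 ^ (\<Sum>i\<in>P. n i w)) \<partial>M) \<le> ennreal D" "D \<ge> 0"
    and e: "\<And>i. i \<in> P \<Longrightarrow> (\<integral>\<^sup>+w. ennreal (real (n i w) * (real (n i w) - 1)) \<partial>M) \<le> ennreal (e i)"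
      "\<And>i. i \<in> P \<Longrightarrow> e i \<ge> 0"
    and int: "integrable M (\<lambda>w. \<Prod>i\<in>P. 1 + c i * of_nat (n i w))"
  shows "norm ((LINT w|M. (\<Prod>i\<in>P. (1 + c i) ^ n i w)) - (LINT w|M. (\<Prod>i\<in>P. 1 + c i * of_nat (n i w))))
    \<le> \<eta> * D + (\<Sum>i\<in>P. e i) / \<eta>"
    and "integrable M (\<lambda>w. \<Prod>i\<in>P. (1 + c i) ^ n i w)"
proof -
  have nm[measurable]: "n i \<in> measurable M (count_space UNIV)" if "i \<in> P" for i
    using n[OF that] by (rule measurable_nat_of_real)
  have [measurable]: "(\<lambda>w. (1 + c i) ^ n i w) \<in> borel_measurable M" if "i \<in> P" for i
    using measurable_compose[OF nm[OF that], of "\<lambda>k. (1 + c i) ^ k" borel] by simp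
  have [measurable]: "(\<lambda>w. \<Sum>i\<in>P. n i w) \<in> measurable M (count_space UNIV)"
  proof (rule measurable_nat_of_real)
    show "(\<lambda>w. real (\<Sum>i\<in>P. n i w)) \<in> borel_measurable M" unfolding of_nat_sum using n by measurable
  qed
  have [measurable]: "(\<lambda>w. (9::real) ^ (\<Sum>i\<in>P. n i w)) \<in> borel_measurable M"
    by (rule measurable_compose[of "\<lambda>w. \<Sum>i\<in>P. n i w" M "count_space UNIV" "\<lambda>k. 9 ^ k" borel]) auto
  show int2: "integrable M (\<lambda>w. \<Prod>i\<in>P. (1 + c i) ^ n i w)"
  proof (rule integrable_const_bound[where B=1])
    show "AE w in M. norm (\<Prod>i\<in>P. (1 + c i) ^ n i w) \<le> 1"
      using c by (intro AE_I2) (simp add: prod_norm[symmetric] norm_power)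
  qed measurable
  let ?d = "\<lambda>w. (\<Prod>i\<in>P. (1 + c i) ^ n i w) - (\<Prod>i\<in>P. 1 + c i * of_nat (n i w))"
  have nn: "0 \<le> (\<Sum>i\<in>P. real (n i w) * (real (n i w) - 1))" for w
  proof (rule sum_nonneg)
    fix i show "0 \<le> real (n i w) * (real (n i w) - 1)" by (cases "n i w") auto
  qed
  have nn': "0 \<le> real (n i w) * (real (n i w) - 1)" for i w by (cases "n i w") auto
  have "ennreal (norm (LINT w|M. ?d w)) \<le> (\<integral>\<^sup>+w. ennreal (norm (?d w)) \<partial>M)"
    using int int2 by (intro integral_norm_bound_ennreal) auto
  also have "\<dots> \<le> (\<integral>\<^sup>+w. ennreal \<eta> * ennreal (9 ^ (\<Sum>i\<in>P. n i w)) +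
      ennreal (1 / \<eta>) * (\<Sum>i\<in>P. ennreal (real (n i w) * (real (n i w) - 1))) \<partial>M)"
  proof (rule nn_integral_mono)
    fix w
    have "ennreal (norm (?d w)) \<le> ennreal (\<eta> * 9 ^ (\<Sum>i\<in>P. n i w) + (\<Sum>i\<in>P. real (n i w) * (real (n i w) - 1)) / \<eta>)"
      by (intro ennreal_leI norm_power_product_diff_le P c \<eta>)
    also have "\<dots> = ennreal (\<eta> * 9 ^ (\<Sum>i\<in>P. n i w)) + ennreal (1 / \<eta> * (\<Sum>i\<in>P. real (n i w) * (real (n i w) - 1)))"
      using \<eta> nn by (subst ennreal_plus[symmetric]) auto
    also have "\<dots> = ennreal \<eta> * ennreal (9 ^ (\<Sum>i\<in>P. n i w)) +
      ennreal (1 / \<eta>) * (\<Sum>i\<in>P. ennreal (real (n i w) * (real (n i w) - 1)))"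
      using \<eta> nn nn' by (subst (1 2) ennreal_mult) (auto simp: sum_ennreal)
    finally show "ennreal (norm (?d w)) \<le> ennreal \<eta> * ennreal (9 ^ (\<Sum>i\<in>P. n i w)) +
      ennreal (1 / \<eta>) * (\<Sum>i\<in>P. ennreal (real (n i w) * (real (n i w) - 1)))" .
  qed
  also have "\<dots> = ennreal \<eta> * (\<integral>\<^sup>+w. ennreal (9 ^ (\<Sum>i\<in>P. n i w)) \<partial>M) +
      ennreal (1 / \<eta>) * (\<Sum>i\<in>P. \<integral>\<^sup>+w. ennreal (real (n i w) * (real (n i w) - 1)) \<partial>M)"
    using n by (subst nn_integral_add, measurable, subst (1 2) nn_integral_cmult, measurable, subst nn_integral_sum) auto
  also have "\<dots> \<le> ennreal \<eta> * ennreal D + ennreal (1 / \<eta>) * (\<Sum>i\<in>P. ennreal (e i))"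
    using D e by (intro add_mono mult_left_mono sum_mono) auto
  also have "\<dots> = ennreal (\<eta> * D + (\<Sum>i\<in>P. e i) / \<eta>)"
    using \<eta> D e by (simp add: sum_ennreal sum_nonneg ennreal_mult[symmetric] ennreal_plus[symmetric] del: ennreal_plus)
  finally have "norm (LINT w|M. ?d w) \<le> \<eta> * D + (\<Sum>i\<in>P. e i) / \<eta>"
    using \<eta> D e by (subst (asm) ennreal_le_iff) (auto intro!: add_nonneg_nonneg sum_nonneg divide_nonneg_nonneg)
  then show "norm ((LINT w|M. (\<Prod>i\<in>P. (1 + c i) ^ n i w)) - (LINT w|M. (\<Prod>i\<in>P. 1 + c i * of_nat (n i w))))
    \<le> \<eta> * D + (\<Sum>i\<in>P. e i) / \<eta>"
    using int int2 by (subst (asm) Bochner_Integration.integral_diff) auto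
qed

lemma emeasure_annulus:
  assumes [measurable]: "A \<in> sets borel"
  shows "emeasure lborel (annulus A) = (\<integral>\<^sup>+r. ennreal (2 * pi * r) * indicator A r \<partial>lborel)"
proof -
  have "emeasure lborel (annulus A) = (\<integral>\<^sup>+z. indicator A (norm z) \<partial>(lborel :: complex measure))"
  proof -
    have "emeasure lborel (annulus A) = (\<integral>\<^sup>+z. indicator (annulus A) z \<partial>lborel)"
      by (rule nn_integral_indicator[symmetric]) measurable
    then show ?thesis by (simp add: indicator_def)
  qed
  then show ?thesis by (simp add: nn_integral_radial)
qed

lemma mean_count_le:
  assumes A[measurable]: "A \<in> sets borel" and sub: "A \<subseteq> {s..<t}" and st: "s \<le> t" "t \<le> b" "0 \<le> b"
  shows "mean_count A \<le> 2 * b * (t - s)"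
proof -
  have "emeasure lborel (annulus A) \<le> (\<integral>\<^sup>+r. ennreal (2 * pi * b) * indicator {s..<t} r \<partial>lborel)"
    unfolding emeasure_annulus[OF A]
    using sub st by (intro nn_integral_mono) (auto intro!: ennreal_leI split: split_indicator)
  also have "\<dots> = ennreal (2 * pi * b * (t - s))"
    using st by (simp add: nn_integral_cmult_indicator ennreal_mult)
  finally have "measure lborel (annulus A) \<le> 2 * pi * b * (t - s)"
    using st unfolding measure_def by (intro enn2real_leI) auto
  then show ?thesis by (simp add: mean_count_def field_simps)
qed

lemma mean_count_UN:
  assumes "finite P" "\<And>i. i \<in> P \<Longrightarrow> A i \<in> sets borel \<and> bounded (A i)" "disjoint_family_on A P"
  shows "mean_count (\<Union>i\<in>P. A i) = (\<Sum>i\<in>P. mean_count (A i))"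
proof -
  have "annulus (\<Union>i\<in>P. A i) = (\<Union>i\<in>P. annulus (A i))" by auto
  moreover have "measure lborel (\<Union>i\<in>P. annulus (A i)) = (\<Sum>i\<in>P. measure lborel (annulus (A i)))"
  proof (intro measure_finite_Union assms(1))
    show "disjoint_family_on (\<lambda>i. annulus (A i)) P"
      using assms(3) unfolding disjoint_family_on_def by blast
    show "(\<lambda>i. annulus (A i)) ` P \<subseteq> sets lborel"
    proof (intro image_subsetI)
      fix i assume "i \<in> P"
      then have [measurable]: "A i \<in> sets borel" using assms(2) by blast
      show "annulus (A i) \<in> sets lborel" by measurable
    qed
    show "emeasure lborel (annulus (A i)) \<noteq> \<infinity>" if "i \<in> P" for i
      using emeasure_bounded_finite[OF bounded_annulus] assms(2)[OF that] by (auto simp: less_top)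
  qed
  ultimately show ?thesis by (simp add: mean_count_def sum_divide_distrib)
qed

section \<open>Radial multiplicative functionals\<close>

lemma
  assumes F: "finite F" and P: "finite P" and disj: "disjoint_family_on A P"
    and cover: "\<And>z. z \<in> F \<Longrightarrow> r z \<in> (\<Union>i\<in>P. A i)"
  shows prod_over_cells: "(\<And>i x. i \<in> P \<Longrightarrow> x \<in> A i \<Longrightarrow> g x = u i) \<Longrightarrow>
      (\<Prod>z\<in>F. g (r z) :: 'b::comm_monoid_mult) = (\<Prod>i\<in>P. u i ^ card {z \<in> F. r z \<in> A i})"
    and card_over_cells: "(\<Sum>i\<in>P. card {z \<in> F. r z \<in> A i}) = card F"
proof -
  have F_eq: "F = (\<Union>i\<in>P. {z \<in> F. r z \<in> A i})" using cover by auto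
  have dis: "\<forall>i\<in>P. \<forall>j\<in>P. i \<noteq> j \<longrightarrow> {z \<in> F. r z \<in> A i} \<inter> {z \<in> F. r z \<in> A j} = {}"
    using disj unfolding disjoint_family_on_def by blast
  have fin: "\<forall>i\<in>P. finite {z \<in> F. r z \<in> A i}" using F by auto
  show "(\<Prod>z\<in>F. g (r z)) = (\<Prod>i\<in>P. u i ^ card {z \<in> F. r z \<in> A i})"
    if g: "\<And>i x. i \<in> P \<Longrightarrow> x \<in> A i \<Longrightarrow> g x = u i"
  proof -
    have "(\<Prod>z\<in>F. g (r z)) = (\<Prod>z\<in>(\<Union>i\<in>P. {z \<in> F. r z \<in> A i}). g (r z))" using F_eq by simp
    also have "\<dots> = (\<Prod>i\<in>P. \<Prod>z\<in>{z \<in> F. r z \<in> A i}. g (r z))"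
      by (rule prod.UNION_disjoint[OF P fin dis])
    also have "\<dots> = (\<Prod>i\<in>P. \<Prod>z\<in>{z \<in> F. r z \<in> A i}. u i)"
      using g by (intro prod.cong refl) auto
    finally show ?thesis by simp
  qed
  show "(\<Sum>i\<in>P. card {z \<in> F. r z \<in> A i}) = card F"
    using card_UN_disjoint[OF P fin dis] F_eq by simp
qed

text \<open>A cell is indexed by a value of \<open>g\<close> and the number of a ring of width
  \<open>b / m\<close>. Splitting by the value makes a merely measurable \<open>g\<close> constant
  on each cell; finiteness of the range keeps the number of cells finite.\<close>

definition radial_cell :: "real \<Rightarrow> nat \<Rightarrow> (real \<Rightarrow> complex) \<Rightarrow> complex \<times> nat \<Rightarrow> real set" where
  "radial_cell b m g i = {r. 0 \<le> r \<and> r < b \<and> g r = fst i \<and> nat \<lfloor>real m * r / b\<rfloor> = snd i}"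

context
  fixes b :: real and m :: nat and g :: "real \<Rightarrow> complex" and P :: "(complex \<times> nat) set"
  assumes b: "b > 0" and m: "m > 0" and g[measurable]: "g \<in> borel_measurable borel"
    and fin: "finite (g ` {0..<b})" and P_def: "P = g ` {0..<b} \<times> {..<m}"
begin

lemma finite_cell_index: "finite P"
  using fin by (simp add: P_def)

lemma radial_cell_borel: "radial_cell b m g i \<in> sets borel \<and> bounded (radial_cell b m g i)"
proof
  show "radial_cell b m g i \<in> sets borel" unfolding radial_cell_def by measurable
  show "bounded (radial_cell b m g i)"
    by (rule bounded_subset[of "{0..b}"]) (auto simp: radial_cell_def)
qed

lemma disjoint_radial_cell: "disjoint_family_on (radial_cell b m g) P"
  by (auto simp: disjoint_family_on_def radial_cell_def)

lemma UN_radial_cell: "(\<Union>i\<in>P. radial_cell b m g i) = {0..<b}"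
proof -
  have "nat \<lfloor>real m * r / b\<rfloor> < m" if "0 \<le> r" "r < b" for r
  proof -
    have "real m * r / b < real m" using that b m by (simp add: field_simps)
    then have "\<lfloor>real m * r / b\<rfloor> < int m" by (simp add: floor_less_iff)
    then show ?thesis using m by linarith
  qed
  then show ?thesis by (fastforce simp: radial_cell_def P_def)
qed

text \<open>A sum of squares is at most the largest term times the sum. A cell lies in a ring of
  width \<open>b / m\<close>, hence has mean at most \<open>2 * b * (b / m)\<close>, and all cells
  together have mean at most \<open>2 * b * b\<close>. The decay in \<open>m\<close> says that two
  points rarely share a cell.\<close>

lemma sum_mean_count_radial_cell_sq:
  "(\<Sum>i\<in>P. (mean_count (radial_cell b m g i))\<^sup>2) \<le> 4 * b ^ 4 / real m"
proof -
  have small: "mean_count (radial_cell b m g i) \<le> 2 * b * (b / real m)" if "i \<in> P" for i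
  proof -
    have sub: "radial_cell b m g i \<subseteq> {real (snd i) * b / real m ..< real (snd i) * b / real m + b / real m}"
    proof
      fix r assume r: "r \<in> radial_cell b m g i"
      then have "0 \<le> real m * r / b" using b by (simp add: radial_cell_def)
      then have "real (nat \<lfloor>real m * r / b\<rfloor>) \<le> real m * r / b" "real m * r / b < real (nat \<lfloor>real m * r / b\<rfloor>) + 1"
        by linarith+
      moreover have "nat \<lfloor>real m * r / b\<rfloor> = snd i" using r by (simp add: radial_cell_def)
      ultimately have "real (snd i) \<le> real m * r / b" "real m * r / b < real (snd i) + 1"
        by (simp_all only:)
      then show "r \<in> {real (snd i) * b / real m ..< real (snd i) * b / real m + b / real m}"
        using b m by (auto simp: field_simps)
    qed
    have "snd i < m" using that by (auto simp: P_def)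
    then have "(real (snd i) + 1) * b / real m \<le> real m * b / real m"
      using b m by (intro divide_right_mono mult_right_mono) auto
    then have le: "real (snd i) * b / real m + b / real m \<le> b" using m by (simp add: field_simps)
    show ?thesis
      using mean_count_le[OF conjunct1[OF radial_cell_borel] sub _ le] b m by simp
  qed
  have "(\<Sum>i\<in>P. mean_count (radial_cell b m g i)) = mean_count {0..<b}"
    using mean_count_UN[OF finite_cell_index radial_cell_borel disjoint_radial_cell] by (simp add: UN_radial_cell)
  also have "\<dots> \<le> 2 * b * b" using mean_count_le[of "{0..<b}" 0 b b] b by simp
  finally have total: "(\<Sum>i\<in>P. mean_count (radial_cell b m g i)) \<le> 2 * b * b" .
  have "(\<Sum>i\<in>P. (mean_count (radial_cell b m g i))\<^sup>2) \<le>
     (\<Sum>i\<in>P. 2 * b * (b / real m) * mean_count (radial_cell b m g i))"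
    unfolding power2_eq_square using small by (intro sum_mono mult_right_mono mean_count_nonneg) auto
  also have "\<dots> \<le> 2 * b * (b / real m) * (2 * b * b)"
    unfolding sum_distrib_left[symmetric] using total b by (intro mult_left_mono) auto
  also have "\<dots> = 4 * b ^ 4 / real m" by (simp add: power4_eq_xxxx)
  finally show ?thesis .
qed

lemma sample_cell_sum:
  "(\<Sum>i\<in>P. sample_count T w (radial_cell b m g i)) = sample_count T w {0..<b}"
proof -
  have "{z \<in> {n. n < T \<and> norm (w n) \<in> {0..<b}}. norm (w z) \<in> radial_cell b m g i}
     = {n. n < T \<and> norm (w n) \<in> radial_cell b m g i}" for i
    by (auto simp: radial_cell_def)
  then show ?thesis
    using card_over_cells[of "{n. n < T \<and> norm (w n) \<in> {0..<b}}" P "radial_cell b m g" "\<lambda>n. norm (w n)"]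
      finite_cell_index disjoint_radial_cell by (simp add: UN_radial_cell)
qed

lemma sample_cell_prod:
  "(\<Prod>n<T. if norm (w n) < b then g (norm (w n)) else 1)
    = (\<Prod>i\<in>P. (fst i) ^ sample_count T w (radial_cell b m g i))"
proof -
  have *: "{z \<in> {n. n < T \<and> norm (w n) \<in> {0..<b}}. norm (w z) \<in> radial_cell b m g i}
     = {n. n < T \<and> norm (w n) \<in> radial_cell b m g i}" for i
    by (auto simp: radial_cell_def)
  have "(\<Prod>n<T. if norm (w n) < b then g (norm (w n)) else 1)
    = (\<Prod>n\<in>{n. n < T \<and> norm (w n) \<in> {0..<b}}. g (norm (w n)))"
    by (rule prod.mono_neutral_cong_right) auto
  also have "\<dots> = (\<Prod>i\<in>P. fst i ^ card {z \<in> {n. n < T \<and> norm (w n) \<in> {0..<b}}. norm (w z) \<in> radial_cell b m g i})"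
  proof (rule prod_over_cells[OF _ finite_cell_index disjoint_radial_cell])
    show "norm (w n) \<in> (\<Union>i\<in>P. radial_cell b m g i)" if "n \<in> {n. n < T \<and> norm (w n) \<in> {0..<b}}" for n
      using that unfolding UN_radial_cell by blast
    show "g r = fst i" if "r \<in> radial_cell b m g i" for i r using that by (simp add: radial_cell_def)
  qed simp
  also have "\<dots> = (\<Prod>i\<in>P. (fst i) ^ sample_count T w (radial_cell b m g i))"
    unfolding * by (rule refl)
  finally show ?thesis .
qed

context
  fixes M :: "'w measure" and G :: "'w \<Rightarrow> complex set"
  assumes gin: "ginibre_ensemble M G"
begin

lemma finite_ginibre_disc:
  assumes "w \<in> space M"
  shows "finite (G w \<inter> annulus {0..<b})"
proof -
  interpret determinantal_process M G lborel ginibre_kernel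
    using gin by (simp add: ginibre_ensemble_def)
  have "finite (G w \<inter> cball 0 b)" using assms by (intro locally_finite) auto
  then show ?thesis by (rule finite_subset[rotated]) auto
qed

lemma ginibre_cell_sum:
  assumes "w \<in> space M"
  shows "(\<Sum>i\<in>P. card (G w \<inter> annulus (radial_cell b m g i))) = card (G w \<inter> annulus {0..<b})"
proof -
  have "{z \<in> G w \<inter> annulus {0..<b}. norm z \<in> radial_cell b m g i} = G w \<inter> annulus (radial_cell b m g i)" for i
    by (auto simp: radial_cell_def)
  then show ?thesis
    using card_over_cells[of "G w \<inter> annulus {0..<b}" P "radial_cell b m g" norm]
      finite_cell_index disjoint_radial_cell finite_ginibre_disc[OF assms] by (simp add: UN_radial_cell)
qed

lemma ginibre_cell_prod:
  assumes "w \<in> space M"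
  shows "(\<Prod>z\<in>G w \<inter> annulus {0..<b}. g (norm z)) =
    (\<Prod>i\<in>P. (fst i) ^ card (G w \<inter> annulus (radial_cell b m g i)))"
proof -
  have *: "{z \<in> G w \<inter> annulus {0..<b}. norm z \<in> radial_cell b m g i} = G w \<inter> annulus (radial_cell b m g i)" for i
    by (auto simp: radial_cell_def)
  show ?thesis
    using prod_over_cells[of "G w \<inter> annulus {0..<b}" P "radial_cell b m g" norm g fst, unfolded *]
      finite_cell_index disjoint_radial_cell finite_ginibre_disc[OF assms]
    by (simp add: UN_radial_cell) (simp add: radial_cell_def)
qed

lemma measurable_ginibre_cell:
  "(\<lambda>w. real (card (G w \<inter> annulus (radial_cell b m g i)))) \<in> borel_measurable M"
proof -
  interpret determinantal_process M G lborel ginibre_kernel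
    using gin by (simp add: ginibre_ensemble_def)
  have "radial_cell b m g i \<in> sets borel" "bounded (radial_cell b m g i)"
    using radial_cell_borel by auto
  then show ?thesis
    using bounded_annulus by (intro measurable_count) (auto simp: compact_closure)
qed

lemma ginibre_cell_pair_expectation:
  "(\<integral>\<^sup>+w. ennreal (real (card (G w \<inter> annulus (radial_cell b m g i))) *
      (real (card (G w \<inter> annulus (radial_cell b m g i))) - 1)) \<partial>M)
    \<le> ennreal (2 * pi\<^sup>2 * (mean_count (radial_cell b m g i))\<^sup>2)"
proof -
  have [measurable]: "radial_cell b m g i \<in> sets borel" and "bounded (radial_cell b m g i)"
    using radial_cell_borel by auto
  then have "(\<integral>\<^sup>+w. ennreal (real (card (G w \<inter> annulus (radial_cell b m g i))) *
      (real (card (G w \<inter> annulus (radial_cell b m g i))) - 1)) \<partial>M)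
    \<le> ennreal (2 * (measure lborel (annulus (radial_cell b m g i)))\<^sup>2)"
    by (intro ginibre_pair_expectation[OF gin] bounded_annulus) measurable
  then show ?thesis by (simp add: mean_count_def power_divide)
qed

end

end

section \<open>Exponential moments of the number of points in a disc\<close>

lemma sample_power_expectation_disc:
  assumes "b > 0"
  shows "(LINT w|mode_sample T. 9 ^ sample_count T w {0..<b}) \<le> exp (8 * mean_count {0..<b})"
    and "integrable (mode_sample T) (\<lambda>w. 9 ^ sample_count T w {0..<b} :: real)"
  using sample_power_expectation[of "{0..<b}" 8 T] by auto

text \<open>The product of the factors \<open>1 + 8 * N i\<close> is at most 9 to the total count,
  so for the samples its mean is at most \<open>D\<close>, and the comparison of moments transfers
  this to the process. When no cell is doubly occupied, that product equals 9 to the total count,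
  the quantity of interest.\<close>

lemma ginibre_power_expectation:
  assumes gin: "ginibre_ensemble M G" and b: "b > 0"
  shows "(\<integral>\<^sup>+w. ennreal (9 ^ card (G w \<inter> annulus {0..<b})) \<partial>M) \<le> ennreal (exp (8 * mean_count {0..<b}))"
proof -
  interpret determinantal_process M G lborel ginibre_kernel
    using gin by (simp add: ginibre_ensemble_def)
  define g :: "real \<Rightarrow> complex" where "g = (\<lambda>_. 1)"
  define D where "D = exp (8 * mean_count {0..<b})"
  have D: "D \<ge> 0" by (simp add: D_def)
  let ?N = "\<lambda>w. card (G w \<inter> annulus {0..<b})"
  have Nm[measurable]: "?N \<in> measurable M (count_space UNIV)"
  proof (rule measurable_nat_of_real, rule measurable_count)
    show "annulus {0..<b} \<in> sets borel" by measurable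
    show "compact (closure (annulus {0..<b}))" using bounded_annulus[of "{0..<b}"] by (simp add: compact_closure)
  qed
  have pm: "(\<lambda>w. (9::real) ^ ?N w) \<in> borel_measurable M"
    by (rule measurable_compose[OF Nm, of "\<lambda>k. 9 ^ k" borel]) simp
  \<comment> \<open>The general error estimate presupposes the exponential moment that is being
    proved. Truncation at \<open>K\<close> avoids the circle: a doubly occupied cell costs at most
    \<open>K\<close> times the pair sum, whose mean is of order 1 over the number of rings. Only
    afterwards does \<open>K\<close> tend to infinity, by Fatou.\<close>
  have trunc: "(\<integral>\<^sup>+w. ennreal (min (9 ^ ?N w) (real K)) \<partial>M) \<le> ennreal D" for K :: nat
  proof (rule LIMSEQ_le_const)
    show "(\<lambda>m. ennreal (D + real K * (8 * pi\<^sup>2 * b ^ 4) * inverse (real (Suc m)))) \<longlonglongrightarrow> ennreal D"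
      by (rule tendsto_ennrealI) (rule tendsto_eq_intros LIMSEQ_inverse_real_of_nat refl | simp)+
    show "\<exists>k. \<forall>n\<ge>k. (\<integral>\<^sup>+w. ennreal (min (9 ^ ?N w) (real K)) \<partial>M)
       \<le> ennreal (D + real K * (8 * pi\<^sup>2 * b ^ 4) * inverse (real (Suc n)))"
    proof (intro exI allI impI)
      fix n :: nat
      let ?m = "Suc n"
      define P where "P = g ` {0..<b} \<times> {..<?m}"
      have g: "g \<in> borel_measurable borel" "finite (g ` {0..<b})" by (auto simp: g_def image_constant_conv)
      note cell = b zero_less_Suc g P_def
      let ?A = "radial_cell b ?m g"
      let ?n = "\<lambda>i w. card (G w \<inter> annulus (?A i))"
      define Y where "Y w = (\<Prod>i\<in>P. 1 + 8 * real (?n i w))" for w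
      have Y_of_real: "(\<Prod>i\<in>P. 1 + 8 * of_nat (k i)) = complex_of_real (\<Prod>i\<in>P. 1 + 8 * real (k i))"
        for k :: "complex \<times> nat \<Rightarrow> nat" by simp
      note comp = ginibre_product_comparison[OF gin finite_cell_index[OF cell] radial_cell_borel[OF cell]
        disjoint_radial_cell[OF cell], where c="\<lambda>_. 8", unfolded Y_of_real complex_of_real_integrable_eq integral_complex_of_real]
      have Yi: "integrable M Y" using comp(2) unfolding Y_def .
      have YT: "(LINT w|mode_sample T. (\<Prod>i\<in>P. 1 + 8 * real (sample_count T w (?A i)))) \<le> D" for T
      proof -
        have "(LINT w|mode_sample T. (\<Prod>i\<in>P. 1 + 8 * real (sample_count T w (?A i))))
          \<le> (LINT w|mode_sample T. 9 ^ sample_count T w {0..<b})"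
        proof (rule integral_mono[OF comp(3) sample_power_expectation_disc(2)[OF b]])
          fix w
          have "(\<Prod>i\<in>P. 1 + 8 * real (sample_count T w (?A i))) \<le> (\<Prod>i\<in>P. 9 ^ sample_count T w (?A i))"
            using one_plus_mult_le_power[of 8] by (intro prod_mono conjI) auto
          also have "\<dots> = 9 ^ sample_count T w {0..<b}"
            by (simp add: power_sum[symmetric] sample_cell_sum[OF cell])
          finally show "(\<Prod>i\<in>P. 1 + 8 * real (sample_count T w (?A i))) \<le> 9 ^ sample_count T w {0..<b}" .
        qed
        also have "\<dots> \<le> D" unfolding D_def by (rule sample_power_expectation_disc(1)[OF b])
        finally show ?thesis .
      qed
      have "(\<lambda>T. LINT w|mode_sample T. (\<Prod>i\<in>P. 1 + 8 * real (sample_count T w (?A i)))) \<longlonglongrightarrow> (LINT w|M. Y w)"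
        using comp(1) unfolding Y_def by (rule tendsto_of_real_iff[THEN iffD1])
      then have EY: "(LINT w|M. Y w) \<le> D"
        by (rule LIMSEQ_le_const2) (use YT in blast)
      have Y0: "Y w \<ge> 0" for w unfolding Y_def by (intro prod_nonneg) auto
      have q0: "0 \<le> real (?n i w) * (real (?n i w) - 1)" for i w by (cases "?n i w") auto
      have "(\<integral>\<^sup>+w. ennreal (min (9 ^ ?N w) (real K)) \<partial>M)
        \<le> (\<integral>\<^sup>+w. ennreal (Y w) + ennreal (real K) * (\<Sum>i\<in>P. ennreal (real (?n i w) * (real (?n i w) - 1))) \<partial>M)"
      proof (rule nn_integral_mono)
        fix w assume w: "w \<in> space M"
        have "min (9 ^ ?N w) (real K) \<le> Y w + real K * (\<Sum>i\<in>P. real (?n i w) * (real (?n i w) - 1))"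
        proof (cases "\<forall>i\<in>P. ?n i w \<le> 1")
          case True
          have "9 ^ ?n i w = 1 + 8 * real (?n i w)" if "i \<in> P" for i
          proof -
            have "?n i w = 0 \<or> ?n i w = 1" using True that by (auto simp: le_Suc_eq)
            then show ?thesis by auto
          qed
          then have "Y w = (\<Prod>i\<in>P. 9 ^ ?n i w)" unfolding Y_def by (intro prod.cong) auto
          also have "\<dots> = 9 ^ ?N w" by (simp add: power_sum[symmetric] ginibre_cell_sum[OF cell gin w])
          finally have "Y w = 9 ^ ?N w" .
          moreover have "0 \<le> real K * (\<Sum>i\<in>P. real (?n i w) * (real (?n i w) - 1))"
            by (intro mult_nonneg_nonneg sum_nonneg q0) simp
          ultimately show ?thesis by linarith
        next
          case False
          then obtain k where k: "k \<in> P" "?n k w \<ge> 2" by auto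
          have "1 * 1 \<le> real (?n k w) * (real (?n k w) - 1)" using k by (intro mult_mono) auto
          also have "\<dots> \<le> (\<Sum>i\<in>P. real (?n i w) * (real (?n i w) - 1))"
            by (rule member_le_sum[OF k(1) q0 finite_cell_index[OF cell]])
          finally have "real K * 1 \<le> real K * (\<Sum>i\<in>P. real (?n i w) * (real (?n i w) - 1))"
            by (intro mult_left_mono) auto
          then show ?thesis using Y0[of w] by linarith
        qed
        then have "ennreal (min (9 ^ ?N w) (real K)) \<le> ennreal (Y w + real K * (\<Sum>i\<in>P. real (?n i w) * (real (?n i w) - 1)))"
          by (rule ennreal_leI)
        also have "\<dots> = ennreal (Y w) + ennreal (real K * (\<Sum>i\<in>P. real (?n i w) * (real (?n i w) - 1)))"
          by (intro ennreal_plus Y0 mult_nonneg_nonneg sum_nonneg q0) simp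
        also have "ennreal (real K * (\<Sum>i\<in>P. real (?n i w) * (real (?n i w) - 1)))
          = ennreal (real K) * ennreal (\<Sum>i\<in>P. real (?n i w) * (real (?n i w) - 1))"
          by (intro ennreal_mult sum_nonneg q0) simp
        also have "ennreal (\<Sum>i\<in>P. real (?n i w) * (real (?n i w) - 1)) = (\<Sum>i\<in>P. ennreal (real (?n i w) * (real (?n i w) - 1)))"
          by (intro sum_ennreal[symmetric] q0)
        finally show "ennreal (min (9 ^ ?N w) (real K)) \<le>
          ennreal (Y w) + ennreal (real K) * (\<Sum>i\<in>P. ennreal (real (?n i w) * (real (?n i w) - 1)))" .
      qed
      also have "\<dots> = (\<integral>\<^sup>+w. ennreal (Y w) \<partial>M) + ennreal (real K) *
          (\<Sum>i\<in>P. \<integral>\<^sup>+w. ennreal (real (?n i w) * (real (?n i w) - 1)) \<partial>M)"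
      proof -
        have [measurable]: "(\<lambda>w. ennreal (real (?n i w) * (real (?n i w) - 1))) \<in> borel_measurable M" for i
          using measurable_ginibre_cell[OF cell gin, of i] by measurable
        have [measurable]: "Y \<in> borel_measurable M" using Yi by auto
        show ?thesis
          by (subst nn_integral_add, measurable, subst nn_integral_cmult, measurable, subst nn_integral_sum) auto
      qed
      also have "\<dots> \<le> ennreal D + ennreal (real K) * (\<Sum>i\<in>P. ennreal (2 * pi\<^sup>2 * (mean_count (?A i))\<^sup>2))"
        using EY Y0 Yi ginibre_cell_pair_expectation[OF cell gin]
        by (intro add_mono mult_left_mono sum_mono) (auto simp: nn_integral_eq_integral intro!: ennreal_leI)
      also have "\<dots> = ennreal (D + real K * (2 * pi\<^sup>2 * (\<Sum>i\<in>P. (mean_count (?A i))\<^sup>2)))"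
        using D by (simp add: sum_ennreal sum_nonneg ennreal_mult[symmetric] ennreal_plus[symmetric] sum_distrib_left del: ennreal_plus)
      also have "\<dots> \<le> ennreal (D + real K * (2 * pi\<^sup>2 * (4 * b ^ 4 / real ?m)))"
        using sum_mean_count_radial_cell_sq[OF cell] by (intro ennreal_leI add_left_mono mult_left_mono) auto
      finally show "(\<integral>\<^sup>+w. ennreal (min (9 ^ ?N w) (real K)) \<partial>M)
        \<le> ennreal (D + real K * (8 * pi\<^sup>2 * b ^ 4) * inverse (real (Suc n)))"
        by (simp add: field_simps)
    qed
  qed
  have "(\<integral>\<^sup>+w. ennreal (9 ^ ?N w) \<partial>M) = (\<integral>\<^sup>+w. liminf (\<lambda>K::nat. ennreal (min (9 ^ ?N w) (real K))) \<partial>M)"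
  proof (intro nn_integral_cong lim_imp_Liminf[symmetric] tendsto_eventually)
    fix w
    show "\<forall>\<^sub>F K in sequentially. ennreal (min (9 ^ ?N w) (real K)) = ennreal (9 ^ ?N w)"
    proof (rule eventually_sequentiallyI[of "9 ^ ?N w"])
      fix K :: nat assume "9 ^ ?N w \<le> K"
      then have "real (9 ^ ?N w) \<le> real K" by (rule of_nat_mono)
      then show "ennreal (min (9 ^ ?N w) (real K)) = ennreal (9 ^ ?N w)" by simp
    qed
  qed simp
  also have "\<dots> \<le> liminf (\<lambda>K::nat. \<integral>\<^sup>+w. ennreal (min (9 ^ ?N w) (real K)) \<partial>M)"
    using pm by (intro nn_integral_liminf) measurable
  also have "\<dots> \<le> liminf (\<lambda>K::nat. ennreal D)"
    using trunc by (intro Liminf_mono always_eventually) auto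
  finally show ?thesis by (simp add: Liminf_const D_def)
qed

text \<open>The multiplicative functional is replaced by its substitute with affine factors, once
  for the process and once for the first \<open>T\<close> modes, with the same error bound not
  depending on \<open>T\<close>. The substitutes converge by the comparison of moments, so the limit
  in \<open>T\<close> passes through the error.\<close>

lemma radial_product_limit_finite_range:
  fixes g :: "real \<Rightarrow> complex"
  assumes gin: "ginibre_ensemble M G" and b: "b > 0" and g: "g \<in> borel_measurable borel"
    and fin: "finite (g ` {0..<b})" and g1: "\<And>r. norm (g r) = 1"
  shows "(\<lambda>T. \<Prod>n<T. LINT z|mode_law n. (if norm z < b then g (norm z) else 1))
    \<longlonglongrightarrow> (LINT w|M. (\<Prod>z\<in>G w \<inter> annulus {0..<b}. g (norm z)))"
    and "(\<lambda>w. \<Prod>z\<in>G w \<inter> annulus {0..<b}. g (norm z)) \<in> borel_measurable M"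
proof -
  interpret determinantal_process M G lborel ginibre_kernel
    using gin by (simp add: ginibre_ensemble_def)
  define D where "D = exp (8 * mean_count {0..<b})"
  have D: "D > 0" by (simp add: D_def)
  define E where "E = (LINT w|M. (\<Prod>z\<in>G w \<inter> annulus {0..<b}. g (norm z)))"
  define L where "L T = (\<Prod>n<T. LINT z|mode_law n. (if norm z < b then g (norm z) else 1))" for T
  have L_eq: "L T = (LINT w|mode_sample T. (\<Prod>n<T. if norm (w n) < b then g (norm (w n)) else 1))" for T
  proof -
    have "(\<lambda>z. if norm z < b then g (norm z) else 1) \<in> borel_measurable borel" for z :: complex
      using g by measurable
    then show ?thesis unfolding L_def using g1
      by (intro integral_mode_sample_prod(1)[symmetric, where B=1]) auto
  qed
  \<comment> \<open>The pair bound \<open>2 * pi\<^sup>2 * (mean_count A)\<^sup>2\<close> for the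
    process, times the bound \<open>4 * b ^ 4 / m\<close> on the sum of squared means, gives
    \<open>C / m\<close>.\<close>
  define C where "C = 8 * pi\<^sup>2 * b ^ 4"
  have C: "C > 0" using b by (simp add: C_def)
  have approx: "\<exists>E' L'. norm (E - E') \<le> \<eta> * D + C / real m / \<eta> \<and> (\<forall>T. norm (L T - L' T) \<le> \<eta> * D + C / real m / \<eta>)
      \<and> L' \<longlonglongrightarrow> E' \<and> (\<lambda>w. \<Prod>z\<in>G w \<inter> annulus {0..<b}. g (norm z)) \<in> borel_measurable M"
    if m: "m > 0" and \<eta>: "\<eta> > 0" for m :: nat and \<eta> :: real
  proof -
    define P where "P = g ` {0..<b} \<times> {..<m}"
    note cell = b m g fin P_def
    let ?A = "radial_cell b m g"
    let ?n = "\<lambda>i w. card (G w \<inter> annulus (?A i))"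
    define c where "c i = fst i - 1" for i :: "complex \<times> nat"
    define e where "e i = 2 * pi\<^sup>2 * (mean_count (?A i))\<^sup>2" for i
    have e0: "e i \<ge> 0" for i by (simp add: e_def)
    have c1: "norm (1 + c i) = 1" if "i \<in> P" for i
      using that g1 by (auto simp: c_def P_def)
    have fc: "fst i = 1 + c i" for i by (simp add: c_def)
    have sum_e: "(\<Sum>i\<in>P. e i) \<le> C / real m"
    proof -
      have "(\<Sum>i\<in>P. e i) = 2 * pi\<^sup>2 * (\<Sum>i\<in>P. (mean_count (?A i))\<^sup>2)"
        by (simp add: e_def sum_distrib_left)
      also have "\<dots> \<le> 2 * pi\<^sup>2 * (4 * b ^ 4 / real m)"
        using sum_mean_count_radial_cell_sq[OF cell] by (intro mult_left_mono) auto
      finally show ?thesis by (simp add: C_def)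
    qed
    then have bnd: "\<eta> * D + (\<Sum>i\<in>P. e i) / \<eta> \<le> \<eta> * D + C / real m / \<eta>"
      using \<eta> by (intro add_left_mono divide_right_mono) auto
    note comp = ginibre_product_comparison[OF gin finite_cell_index[OF cell] radial_cell_borel[OF cell]
        disjoint_radial_cell[OF cell], where c=c]
    have pw: "(\<integral>\<^sup>+w. ennreal (9 ^ (\<Sum>i\<in>P. ?n i w)) \<partial>M) \<le> ennreal D"
    proof -
      have "(\<integral>\<^sup>+w. ennreal (9 ^ (\<Sum>i\<in>P. ?n i w)) \<partial>M) = (\<integral>\<^sup>+w. ennreal (9 ^ card (G w \<inter> annulus {0..<b})) \<partial>M)"
        by (intro nn_integral_cong) (simp only: ginibre_cell_sum[OF cell gin])
      then show ?thesis using ginibre_power_expectation[OF gin b] by (simp only: D_def)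
    qed
    note ap = expectation_power_product_approx[OF finite_cell_index[OF cell] c1 \<eta> measurable_ginibre_cell[OF cell gin]
        pw less_imp_le[OF D] ginibre_cell_pair_expectation[OF cell gin, folded e_def] e0 comp(2)]
    have E_eq: "E = (LINT w|M. (\<Prod>i\<in>P. (1 + c i) ^ ?n i w))"
      unfolding E_def by (intro Bochner_Integration.integral_cong refl) (simp only: ginibre_cell_prod[OF cell gin] fc)
    have 1: "norm (E - (LINT w|M. (\<Prod>i\<in>P. 1 + c i * of_nat (?n i w)))) \<le> \<eta> * D + C / real m / \<eta>"
      unfolding E_eq by (rule order_trans[OF ap(1) bnd])
    have 2: "norm (L T - (LINT w|mode_sample T. (\<Prod>i\<in>P. 1 + c i * of_nat (sample_count T w (?A i))))) \<le> \<eta> * D + C / real m / \<eta>" for T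
    proof -
      interpret T: prob_space "mode_sample T" by (rule prob_space_mode_sample)
      have Ltt: "L T = (LINT w|mode_sample T. (\<Prod>i\<in>P. (1 + c i) ^ sample_count T w (?A i)))"
        unfolding L_eq by (intro Bochner_Integration.integral_cong refl) (simp only: sample_cell_prod[OF cell] fc)
      have pwT: "(\<integral>\<^sup>+w. ennreal (9 ^ (\<Sum>i\<in>P. sample_count T w (?A i))) \<partial>mode_sample T) \<le> ennreal D"
        unfolding sample_cell_sum[OF cell]
        using sample_power_expectation_disc[OF b, of T]
        by (subst nn_integral_eq_integral) (auto simp: D_def intro!: ennreal_leI)
      have eT: "(\<integral>\<^sup>+w. ennreal (real (sample_count T w (?A i)) * (real (sample_count T w (?A i)) - 1)) \<partial>mode_sample T) \<le> ennreal (e i)" for i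
      proof -
        \<comment> \<open>The samples satisfy the pair bound without the factor
          \<open>2 * pi\<^sup>2\<close>; it is weakened so that the same \<open>e i\<close> serves
          both sides.\<close>
        have "1 * 1 \<le> pi * pi" using pi_ge_two by (intro mult_mono) auto
        then have "1 * (mean_count (?A i))\<^sup>2 \<le> 2 * pi\<^sup>2 * (mean_count (?A i))\<^sup>2"
          by (intro mult_right_mono) (auto simp: power2_eq_square)
        then have "ennreal ((mean_count (?A i))\<^sup>2) \<le> ennreal (e i)"
          by (intro ennreal_leI) (simp add: e_def)
        then show ?thesis
          using sample_pair_expectation[of "?A i" T] radial_cell_borel[OF cell, of i] by (auto intro: order_trans)
      qed
      have mT: "(\<lambda>w. real (sample_count T w (?A i))) \<in> borel_measurable (mode_sample T)" for i
        using radial_cell_borel[OF cell, of i] by (intro borel_measurable_sample_count) auto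
      show ?thesis unfolding Ltt
        by (rule order_trans[OF T.expectation_power_product_approx(1)[OF finite_cell_index[OF cell] c1 \<eta> mT
              pwT less_imp_le[OF D] eT e0 comp(3)] bnd])
    qed
    have 3: "(\<lambda>w. \<Prod>z\<in>G w \<inter> annulus {0..<b}. g (norm z)) \<in> borel_measurable M"
    proof -
      have "(\<lambda>w. \<Prod>i\<in>P. (1 + c i) ^ ?n i w) \<in> borel_measurable M" using ap(2) by auto
      then show ?thesis
        by (rule measurable_cong[THEN iffD1, rotated]) (simp only: ginibre_cell_prod[OF cell gin] fc)
    qed
    show ?thesis
      by (rule exI, rule exI[where x="\<lambda>T. LINT w|mode_sample T. (\<Prod>i\<in>P. 1 + c i * of_nat (sample_count T w (?A i)))"],
        intro conjI allI, rule 1, rule 2, rule comp(1), rule 3)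
  qed
  show "(\<lambda>w. \<Prod>z\<in>G w \<inter> annulus {0..<b}. g (norm z)) \<in> borel_measurable M"
    using approx[of 1 1] by auto
  have "L \<longlonglongrightarrow> E"
  proof (rule LIMSEQ_I)
    fix \<epsilon> :: real assume \<epsilon>: "\<epsilon> > 0"
    \<comment> \<open>\<open>\<eta>\<close> makes the first error term one eighth of
      \<open>\<epsilon>\<close>, and then \<open>m\<close> makes the second smaller than that. Each
      of the two replacements thus costs less than \<open>\<epsilon> / 4\<close>, which leaves
      \<open>\<epsilon> / 2\<close> for the convergence in \<open>T\<close>.\<close>
    define \<eta> where "\<eta> = \<epsilon> / (8 * D)"
    have \<eta>: "\<eta> > 0" "\<eta> * D = \<epsilon> / 8" using \<epsilon> D by (auto simp: \<eta>_def)
    obtain m :: nat where m: "C / (\<eta> * (\<epsilon> / 8)) < real m" using reals_Archimedean2 by blast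
    have "0 < C / (\<eta> * (\<epsilon> / 8))" using C \<eta> \<epsilon> by simp
    then have m0: "m > 0" using m by (cases m) auto
    have Cm: "C / real m / \<eta> < \<epsilon> / 8" using m m0 \<eta> \<epsilon> by (simp add: field_simps)
    obtain E' L' where EL: "norm (E - E') \<le> \<eta> * D + C / real m / \<eta>"
      "\<And>T. norm (L T - L' T) \<le> \<eta> * D + C / real m / \<eta>" "L' \<longlonglongrightarrow> E'"
      using approx[OF m0 \<eta>(1)] by blast
    obtain T0 where T0: "\<And>T. T \<ge> T0 \<Longrightarrow> norm (L' T - E') < \<epsilon> / 2"
      using LIMSEQ_D[OF EL(3), of "\<epsilon> / 2"] \<epsilon> by auto
    have "norm (L T - E) < \<epsilon>" if "T \<ge> T0" for T
    proof -
      have "norm (L T - E) = norm ((L T - L' T) + (L' T - E') - (E - E'))" by simp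
      also have "\<dots> \<le> norm (L T - L' T) + norm (L' T - E') + norm (E - E')"
        by (intro order_trans[OF norm_triangle_ineq4] add_right_mono norm_triangle_ineq)
      also have "\<dots> < \<epsilon>" using EL(1) EL(2)[of T] T0[OF that] Cm \<eta>(2) by linarith
      finally show ?thesis .
    qed
    then show "\<exists>no. \<forall>T\<ge>no. norm (L T - E) < \<epsilon>" by blast
  qed
  then show "(\<lambda>T. \<Prod>n<T. LINT z|mode_law n. (if norm z < b then g (norm z) else 1))
    \<longlonglongrightarrow> (LINT w|M. (\<Prod>z\<in>G w \<inter> annulus {0..<b}. g (norm z)))"
    unfolding L_def E_def .
qed

section \<open>From finite range to arbitrary measurable radial functions\<close>

lemma norm_mode_sq_le: "(norm (mode n z))\<^sup>2 \<le> 1 / pi"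
  using norm_mode_sq_sums[of z] sum_le_suminf[of "\<lambda>n. (norm (mode n z))\<^sup>2" "{n}"] by (auto simp: sums_iff)

lemma integrable_mode_law_lborel:
  fixes k :: "complex \<Rightarrow> real"
  assumes k: "integrable lborel k"
  shows "integrable lborel (\<lambda>z. (norm (mode n z))\<^sup>2 * k z)"
    and "integrable (mode_law n) k"
    and "(LINT z|mode_law n. k z) = (LINT z|lborel. (norm (mode n z))\<^sup>2 * k z)"
proof -
  have [measurable]: "k \<in> borel_measurable borel" using k by auto
  show int: "integrable lborel (\<lambda>z. (norm (mode n z))\<^sup>2 * k z)"
  proof (rule Bochner_Integration.integrable_bound[of _ "\<lambda>z. 1 / pi * k z"])
    show "integrable lborel (\<lambda>z. 1 / pi * k z)" using k by (rule integrable_mult_right)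
    show "AE z in lborel. norm ((norm (mode n z))\<^sup>2 * k z) \<le> norm (1 / pi * k z)"
    proof (rule AE_I2)
      fix z
      have "(norm (mode n z))\<^sup>2 * \<bar>k z\<bar> \<le> 1 / pi * \<bar>k z\<bar>"
        by (intro mult_right_mono norm_mode_sq_le) simp
      then show "norm ((norm (mode n z))\<^sup>2 * k z) \<le> norm (1 / pi * k z)" by (simp add: abs_mult)
    qed
  qed measurable
  then show "integrable (mode_law n) k"
    unfolding mode_law_def by (subst integrable_density) auto
  show "(LINT z|mode_law n. k z) = (LINT z|lborel. (norm (mode n z))\<^sup>2 * k z)"
    unfolding mode_law_def by (subst integral_density) auto
qed

text \<open>The mode densities add up to the constant intensity \<open>1 / pi\<close>, so this is
  Campbell's formula read on the side of the samples. It turns sums of errors over all modes into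
  one planar integral.\<close>

lemma mode_law_integral_sums:
  fixes k :: "complex \<Rightarrow> real"
  assumes k: "integrable lborel k"
  shows "(\<lambda>n. LINT z|mode_law n. k z) sums ((LINT z|lborel. k z) / pi)"
proof -
  have [measurable]: "k \<in> borel_measurable borel" using k by auto
  have "(\<lambda>T. LINT z|lborel. (\<Sum>n<T. (norm (mode n z))\<^sup>2) * k z) \<longlonglongrightarrow> (LINT z|lborel. 1 / pi * k z)"
  proof (rule integral_dominated_convergence[where w="\<lambda>z. 1 / pi * norm (k z)"])
    show "integrable lborel (\<lambda>z. 1 / pi * norm (k z))" using k by (intro integrable_mult_right integrable_norm)
    show "AE z in lborel. (\<lambda>T. (\<Sum>n<T. (norm (mode n z))\<^sup>2) * k z) \<longlonglongrightarrow> 1 / pi * k z"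
      using norm_mode_sq_sums by (intro AE_I2 tendsto_intros) (auto simp: sums_def)
    show "AE z in lborel. norm ((\<Sum>n<T. (norm (mode n z))\<^sup>2) * k z) \<le> 1 / pi * norm (k z)" for T
    proof (rule AE_I2)
      fix z
      have "(\<Sum>n<T. (norm (mode n z))\<^sup>2) \<le> 1 / pi"
        using norm_mode_sq_sums[of z] sum_le_suminf[of "\<lambda>n. (norm (mode n z))\<^sup>2" "{..<T}"] by (auto simp: sums_iff)
      then have "(\<Sum>n<T. (norm (mode n z))\<^sup>2) * norm (k z) \<le> 1 / pi * norm (k z)"
        by (intro mult_right_mono) auto
      then show "norm ((\<Sum>n<T. (norm (mode n z))\<^sup>2) * k z) \<le> 1 / pi * norm (k z)"
        by (simp add: abs_mult abs_of_nonneg sum_nonneg)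
    qed
  qed measurable
  moreover have "(LINT z|lborel. (\<Sum>n<T. (norm (mode n z))\<^sup>2) * k z) = (\<Sum>n<T. LINT z|mode_law n. k z)" for T
    unfolding sum_distrib_right
    by (subst Bochner_Integration.integral_sum) (auto intro: integrable_mode_law_lborel k simp: integrable_mode_law_lborel(3)[OF k])
  ultimately show ?thesis by (simp add: sums_def)
qed

lemma integrable_lborel_disc:
  fixes k :: "complex \<Rightarrow> real"
  assumes "k \<in> borel_measurable borel" "\<And>z. norm (k z) \<le> B" "\<And>z. norm z \<ge> b \<Longrightarrow> k z = 0"
  shows "integrable lborel k"
proof (rule Bochner_Integration.integrable_bound[of _ "\<lambda>z. B * indicator (cball 0 b) z"])
  show "integrable lborel (\<lambda>z::complex. B * indicator (cball 0 b) z)"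
    using emeasure_lborel_cball_finite[of "0::complex" b] by (intro integrable_mult_right) auto
  show "AE z in lborel. norm (k z) \<le> norm (B * indicator (cball 0 b) z)"
  proof (rule AE_I2)
    fix z
    have "norm (k z) \<le> \<bar>B\<bar>" using assms(2)[of z] by linarith
    then show "norm (k z) \<le> norm (B * indicator (cball 0 b) z)"
      using assms(3)[of z] by (cases "norm z \<le> b") (auto simp: indicator_def)
  qed
qed (use assms in auto)

lemma mode_law_integral_diff_le:
  assumes [measurable]: "f \<in> borel_measurable borel" "g \<in> borel_measurable borel"
    and f1: "\<And>z. norm (f z) = 1" and g1: "\<And>z. norm (g z :: complex) = 1"
  shows "norm ((LINT z|mode_law n. f z) - (LINT z|mode_law n. g z)) \<le> (LINT z|mode_law n. norm (f z - g z))"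
proof -
  have "integrable (mode_law n) f" "integrable (mode_law n) g"
    using f1 g1 by (auto intro!: integrable_mode_law_bounded[where B=1])
  then have "(LINT z|mode_law n. f z) - (LINT z|mode_law n. g z) = (LINT z|mode_law n. f z - g z)"
    by simp
  then show ?thesis using integral_norm_bound by metis
qed

lemma norm_mode_law_integral_le:
  assumes [measurable]: "f \<in> borel_measurable borel" and f1: "\<And>z. norm (f z :: complex) = 1"
  shows "norm (LINT z|mode_law n. f z) \<le> 1"
proof -
  interpret prob_space "mode_law n" by (rule prob_space_mode_law)
  have "norm (LINT z|mode_law n. f z) \<le> (LINT z|mode_law n. norm (f z))" by (rule integral_norm_bound)
  then show ?thesis using f1 prob_space by simp
qed

text \<open>Simple functions \<open>F j\<close> reduce the claim to finite range. Replacing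
  \<open>h\<close> by \<open>F j\<close> is harmless on both sides: for the process by dominated
  convergence, for the products because factors of norm at most 1 make the errors add, and their sum
  over all modes is at most \<open>\<delta> j\<close>, independently of \<open>T\<close>.\<close>

lemma
  fixes h :: "real \<Rightarrow> real" and b :: real
  assumes gin: "ginibre_ensemble M G" and b: "b > 0" and h[measurable]: "h \<in> borel_measurable borel"
    and supp: "\<And>r. r \<notin> {0..<b} \<Longrightarrow> h r = 0"
  shows ginibre_radial_char:
      "(\<lambda>T. \<Prod>n<T. LINT z|mode_law n. iexp (h (norm z)))
        \<longlonglongrightarrow> (LINT w|M. iexp (\<Sum>z\<in>G w \<inter> annulus {0..<b}. h (norm z)))"
    and measurable_ginibre_radial_sum:
      "(\<lambda>w. \<Sum>z\<in>G w \<inter> annulus {0..<b}. h (norm z)) \<in> borel_measurable M"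
proof -
  interpret determinantal_process M G lborel ginibre_kernel
    using gin by (simp add: ginibre_ensemble_def)
  obtain F where simp: "\<And>j. simple_function borel (F j)" and lim: "\<And>r. (\<lambda>j. F j r) \<longlonglongrightarrow> h r"
    and bound: "\<And>j r. \<bar>F j r\<bar> \<le> 2 * \<bar>h r\<bar>"
    using borel_measurable_implies_sequence_metric[OF h, of 0] by auto
  have [measurable]: "F j \<in> borel_measurable borel" for j
    using simp by (rule borel_measurable_simple_function)
  have finF: "finite (range (F j))" for j using simple_functionD(1)[OF simp[of j]] by simp
  \<comment> \<open>The bound by \<open>2 * \<bar>h r\<bar>\<close> forces each approximant to
    vanish wherever \<open>h\<close> does, so the factor 1 beyond radius \<open>b\<close> in the
    finite range result is already \<open>iexp (F j r)\<close>.\<close>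
  have supF: "F j r = 0" if "r \<notin> {0..<b}" for j r using bound[of j r] supp[OF that] by simp
  let ?D = "\<lambda>w. G w \<inter> annulus {0..<b}"
  define S where "S w = (\<Sum>z\<in>?D w. h (norm z))" for w
  define S' where "S' j w = (\<Sum>z\<in>?D w. F j (norm z))" for j w
  have S'_lim: "(\<lambda>j. S' j w) \<longlonglongrightarrow> S w" for w
    unfolding S_def S'_def by (intro tendsto_sum lim)
  have S'_meas: "S' j \<in> borel_measurable M" for j
  proof -
    have cnt: "(\<lambda>w. real (card (G w \<inter> {z. norm z \<in> {0..<b} \<and> F j (norm z) = v}))) \<in> borel_measurable M" for v
    proof (rule measurable_count)
      show "{z::complex. norm z \<in> {0..<b} \<and> F j (norm z) = v} \<in> sets borel" by measurable
      have "bounded {z::complex. norm z \<in> {0..<b} \<and> F j (norm z) = v}"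
        by (rule bounded_subset[OF bounded_annulus[of "{0..<b}"]]) auto
      then show "compact (closure {z::complex. norm z \<in> {0..<b} \<and> F j (norm z) = v})" by (simp only: compact_closure)
    qed
    have "S' j w = (\<Sum>v\<in>range (F j). v * real (card (G w \<inter> {z. norm z \<in> {0..<b} \<and> F j (norm z) = v})))"
      if w: "w \<in> space M" for w
    proof -
      have fin: "finite (?D w)"
      proof (rule finite_subset)
        show "?D w \<subseteq> G w \<inter> cball 0 b" by auto
        show "finite (G w \<inter> cball 0 b)" using w by (intro locally_finite) auto
      qed
      have "S' j w = (\<Sum>v\<in>range (F j). \<Sum>z\<in>{z \<in> ?D w. F j (norm z) = v}. F j (norm z))"
        unfolding S'_def by (rule sum.group[symmetric]) (use fin finF in auto)
      also have "\<dots> = (\<Sum>v\<in>range (F j). v * real (card {z \<in> ?D w. F j (norm z) = v}))"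
        by (intro sum.cong refl) simp
      also have "\<dots> = (\<Sum>v\<in>range (F j). v * real (card (G w \<inter> {z. norm z \<in> {0..<b} \<and> F j (norm z) = v})))"
        by (intro sum.cong refl arg_cong2[where f="(*)"] arg_cong[where f="\<lambda>A. real (card A)"]) auto
      finally show ?thesis .
    qed
    moreover have "(\<lambda>w. \<Sum>v\<in>range (F j). v * real (card (G w \<inter> {z. norm z \<in> {0..<b} \<and> F j (norm z) = v}))) \<in> borel_measurable M"
      by (intro borel_measurable_sum borel_measurable_times borel_measurable_const cnt)
    ultimately show ?thesis by (subst measurable_cong) auto
  qed
  show S_meas: "(\<lambda>w. \<Sum>z\<in>G w \<inter> annulus {0..<b}. h (norm z)) \<in> borel_measurable M"
    using S'_meas S'_lim unfolding S_def by (rule borel_measurable_LIMSEQ_real[rotated])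
  define E where "E = (LINT w|M. iexp (S w))"
  define E' where "E' j = (LINT w|M. iexp (S' j w))" for j
  have E_lim: "E' \<longlonglongrightarrow> E"
    unfolding E_def E'_def
  proof (rule integral_dominated_convergence[where w="\<lambda>_. 1"])
    have "(\<lambda>j. iexp (S' j w)) \<longlonglongrightarrow> iexp (S w)" for w
      by (intro tendsto_intros S'_lim)
    then show "AE w in M. (\<lambda>j. iexp (S' j w)) \<longlonglongrightarrow> iexp (S w)" by auto
    have "S \<in> borel_measurable M" using S_meas by (simp add: S_def[abs_def])
    then show "(\<lambda>w. iexp (S w)) \<in> borel_measurable M" by measurable
    show "(\<lambda>w. iexp (S' j w)) \<in> borel_measurable M" for j using S'_meas by measurable
  qed auto
  define L where "L T = (\<Prod>n<T. LINT z|mode_law n. iexp (h (norm z)))" for T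
  define L' where "L' j T = (\<Prod>n<T. LINT z|mode_law n. iexp (F j (norm z)))" for j T
  have L'_lim: "(\<lambda>T. L' j T) \<longlonglongrightarrow> E' j" for j
  proof -
    have fin: "finite ((\<lambda>r. iexp (F j r)) ` {0..<b})"
    proof (rule finite_subset)
      show "(\<lambda>r. iexp (F j r)) ` {0..<b} \<subseteq> iexp ` range (F j)" by auto
    qed (use finF in auto)
    have 1: "(if norm z < b then iexp (F j (norm z)) else 1) = iexp (F j (norm z))" for z :: complex
      using supF[of "norm z" j] by auto
    have 2: "(\<Prod>z\<in>?D w. iexp (F j (norm z))) = iexp (S' j w)" for w
    \<comment> \<open>Local finiteness is known on \<open>space M\<close> only. For an infinite
      index set the sum defaults to 0 and the product to 1, and the identity still holds.\<close>
    proof (cases "finite (?D w)")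
      case True
      then show ?thesis by (simp add: S'_def exp_sum sum_distrib_left)
    qed (simp add: S'_def)
    show ?thesis
      using radial_product_limit_finite_range(1)[OF gin b _ fin] unfolding 1 2 L'_def E'_def by auto
  qed
  define \<delta> where "\<delta> j = (LINT z|lborel. norm (iexp (F j (norm (z::complex))) - iexp (h (norm z)))) / pi" for j
  have int: "integrable lborel (\<lambda>z::complex. norm (iexp (F j (norm z)) - iexp (h (norm z))))" for j
  proof (rule integrable_lborel_disc[where B=2 and b=b])
    show "norm (norm (iexp (F j (norm z)) - iexp (h (norm z)))) \<le> 2" for z :: complex
      using norm_triangle_ineq4[of "iexp (F j (norm z))" "iexp (h (norm z))"] by simp
    show "norm (iexp (F j (norm z)) - iexp (h (norm z))) = 0" if "norm z \<ge> b" for z :: complex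
      using that supF[of "norm z" j] supp[of "norm z"] by simp
  qed measurable
  have \<delta>_lim: "\<delta> \<longlonglongrightarrow> 0"
  proof -
    have "(\<lambda>j. LINT z|lborel. norm (iexp (F j (norm (z::complex))) - iexp (h (norm z)))) \<longlonglongrightarrow> (LINT z|(lborel :: complex measure). 0::real)"
    proof (rule integral_dominated_convergence[where w="\<lambda>z::complex. 2 * indicator (cball 0 b) z"])
      show "integrable lborel (\<lambda>z::complex. 2 * indicator (cball 0 b) z :: real)"
        using emeasure_lborel_cball_finite[of "0::complex" b] by (intro integrable_mult_right) auto
      show "AE z::complex in lborel. (\<lambda>j. norm (iexp (F j (norm z)) - iexp (h (norm z)))) \<longlonglongrightarrow> 0"
      proof (rule AE_I2)
        fix z :: complex
        have "(\<lambda>j. norm (iexp (F j (norm z)) - iexp (h (norm z)))) \<longlonglongrightarrow> norm (iexp (h (norm z)) - iexp (h (norm z)))"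
          by (intro tendsto_intros lim)
        then show "(\<lambda>j. norm (iexp (F j (norm z)) - iexp (h (norm z)))) \<longlonglongrightarrow> 0" by simp
      qed
      show "AE z::complex in lborel. norm (norm (iexp (F j (norm z)) - iexp (h (norm z)))) \<le> 2 * indicator (cball 0 b) z" for j
      proof (rule AE_I2)
        fix z :: complex
        have "norm (iexp (F j (norm z)) - iexp (h (norm z))) \<le> 2"
          using norm_triangle_ineq4[of "iexp (F j (norm z))" "iexp (h (norm z))"] by simp
        moreover have "norm (iexp (F j (norm z)) - iexp (h (norm z))) = 0" if "z \<notin> cball 0 b"
          using that supF[of "norm z" j] supp[of "norm z"] by simp
        ultimately show "norm (norm (iexp (F j (norm z)) - iexp (h (norm z)))) \<le> 2 * indicator (cball 0 b) z"
          by (cases "z \<in> cball 0 b") auto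
      qed
    qed measurable
    then have "\<delta> \<longlonglongrightarrow> (LINT z|(lborel :: complex measure). 0::real) / pi"
      unfolding \<delta>_def by (intro tendsto_divide tendsto_const) auto
    then show ?thesis by simp
  qed
  have LL: "norm (L T - L' j T) \<le> \<delta> j" for T j
  proof -
    have "norm (L' j T - L T) \<le> (\<Sum>n<T. norm ((LINT z|mode_law n. iexp (F j (norm z))) - (LINT z|mode_law n. iexp (h (norm z)))))"
      unfolding L_def L'_def by (intro norm_prod_diff norm_mode_law_integral_le) auto
    also have "\<dots> \<le> (\<Sum>n<T. LINT z|mode_law n. norm (iexp (F j (norm z)) - iexp (h (norm z))))"
      by (intro sum_mono mode_law_integral_diff_le) auto
    also have "\<dots> \<le> \<delta> j"
      using mode_law_integral_sums[OF int[of j]]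
        sum_le_suminf[of "\<lambda>n. LINT z|mode_law n. norm (iexp (F j (norm z)) - iexp (h (norm z)))" "{..<T}"]
      by (auto simp: sums_iff \<delta>_def)
    finally show ?thesis by (simp add: norm_minus_commute)
  qed
  have "L \<longlonglongrightarrow> E"
  proof (rule LIMSEQ_I)
    fix \<epsilon> :: real assume \<epsilon>: "\<epsilon> > 0"
    have "\<forall>\<^sub>F j in sequentially. \<bar>\<delta> j\<bar> < \<epsilon> / 3 \<and> norm (E' j - E) < \<epsilon> / 3"
      using tendstoD[OF \<delta>_lim, of "\<epsilon> / 3"] tendstoD[OF E_lim, of "\<epsilon> / 3"] \<epsilon>
      by (auto simp: dist_norm elim: eventually_elim2)
    then obtain j where j: "\<bar>\<delta> j\<bar> < \<epsilon> / 3" "norm (E' j - E) < \<epsilon> / 3"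
      by (auto simp: eventually_sequentially)
    obtain T0 where T0: "\<And>T. T \<ge> T0 \<Longrightarrow> norm (L' j T - E' j) < \<epsilon> / 3"
      using LIMSEQ_D[OF L'_lim[of j], of "\<epsilon> / 3"] \<epsilon> by auto
    have "norm (L T - E) < \<epsilon>" if "T \<ge> T0" for T
    proof -
      have "norm (L T - E) = norm ((L T - L' j T) + (L' j T - E' j) + (E' j - E))" by simp
      also have "\<dots> \<le> norm (L T - L' j T) + norm (L' j T - E' j) + norm (E' j - E)"
        by (intro order_trans[OF norm_triangle_ineq] add_right_mono norm_triangle_ineq)
      also have "\<dots> < \<epsilon>" using LL[of T j] T0[OF that] j by linarith
      finally show ?thesis .
    qed
    then show "\<exists>no. \<forall>T\<ge>no. norm (L T - E) < \<epsilon>" by blast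
  qed
  then show "(\<lambda>T. \<Prod>n<T. LINT z|mode_law n. iexp (h (norm z)))
        \<longlonglongrightarrow> (LINT w|M. iexp (\<Sum>z\<in>G w \<inter> annulus {0..<b}. h (norm z)))"
    unfolding L_def E_def S_def .
qed

section \<open>Bessel asymptotics and the limit variance\<close>

lemma integral_cos_multiple:
  fixes n m :: nat
  shows "has_bochner_integral lborel (\<lambda>\<theta>. cos ((real n - real m) * \<theta>) * indicator {- pi..pi} \<theta>)
    (if n = m then 2 * pi else 0)"
proof (cases "n = m")
  case True
  have "has_bochner_integral lborel (\<lambda>\<theta>. 1 * indicator {- pi..pi} \<theta>) (pi - (- pi))"
    by (rule has_bochner_integral_FTC_Icc_real) (auto intro!: derivative_eq_intros)
  then show ?thesis using True by simp
next
  case False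
  define k where "k = real n - real m"
  have k: "k \<noteq> 0" using False by (simp add: k_def)
  have "has_bochner_integral lborel (\<lambda>\<theta>. cos (k * \<theta>) * indicator {- pi..pi} \<theta>) (sin (k * pi) / k - sin (k * - pi) / k)"
    using k by (intro has_bochner_integral_FTC_Icc_real) (auto intro!: derivative_eq_intros continuous_intros)
  moreover have "sin (k * pi) = 0"
    by (simp add: k_def left_diff_distrib sin_diff sin_npi)
  ultimately show ?thesis using False by (simp add: k_def)
qed

text \<open>This is the modified Bessel function \<open>I_0\<close> at \<open>2 * u\<close>, in its
  integral representation.\<close>

definition bessel_int :: "real \<Rightarrow> real" where
  "bessel_int u = (LINT \<theta>|lborel. exp (2 * u * cos \<theta>) * indicator {- pi..pi} \<theta>) / (2 * pi)"

text \<open>Parseval's identity for the boundary values of \<open>exp (u * cis \<theta>)\<close>.\<close>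

lemma square_exp_series_sums:
  assumes u: "u \<ge> 0"
  shows "(\<lambda>n. (u ^ n / fact n)\<^sup>2) sums bessel_int u"
proof -
  define a where "a n = u ^ n / fact n" for n
  have a0: "a n \<ge> 0" for n using u by (simp add: a_def)
  have a_sums: "a sums exp u"
  proof -
    have "a = (\<lambda>n. u ^ n /\<^sub>R fact n)" by (simp add: a_def fun_eq_iff divide_inverse mult.commute)
    then show ?thesis using exp_converges[of u] by simp
  qed
  \<comment> \<open>The squared modulus of the partial sum of \<open>exp (u * cis \<theta>)\<close>,
    written with cosines so that integration over a period keeps exactly the diagonal
    \<open>n = m\<close>.\<close>
  define P where "P N \<theta> = (\<Sum>n<N. \<Sum>m<N. a n * a m * cos ((real n - real m) * \<theta>))" for N :: nat and \<theta>
  have P_eq: "P N \<theta> = (norm (\<Sum>n<N. of_real (a n) * cis (real n * \<theta>)))\<^sup>2" for N \<theta>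
    unfolding cmod_power2 P_def
    by (simp add: power2_eq_square sum_product sum.distrib[symmetric] left_diff_distrib cos_diff algebra_simps)
  have P_int: "has_bochner_integral lborel (\<lambda>\<theta>. P N \<theta> * indicator {- pi..pi} \<theta>) (2 * pi * (\<Sum>n<N. (a n)\<^sup>2))" for N
  proof -
    have "has_bochner_integral lborel (\<lambda>\<theta>. \<Sum>n<N. \<Sum>m<N. a n * a m * (cos ((real n - real m) * \<theta>) * indicator {- pi..pi} \<theta>))
       (\<Sum>n<N. \<Sum>m<N. a n * a m * (if n = m then 2 * pi else 0))"
      by (intro has_bochner_integral_sum has_bochner_integral_mult_right integral_cos_multiple)
    also have "(\<lambda>\<theta>. \<Sum>n<N. \<Sum>m<N. a n * a m * (cos ((real n - real m) * \<theta>) * indicator {- pi..pi} \<theta>))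
      = (\<lambda>\<theta>. P N \<theta> * indicator {- pi..pi} \<theta>)"
      by (simp add: P_def sum_distrib_right mult.assoc)
    also have "(\<Sum>n<N. \<Sum>m<N. a n * a m * (if n = m then 2 * pi else 0)) = 2 * pi * (\<Sum>n<N. (a n)\<^sup>2)"
      by (simp add: if_distrib[of "(*) _"] sum_distrib_left power2_eq_square mult_ac cong: if_cong)
    finally show ?thesis .
  qed
  have "(\<lambda>N. LINT \<theta>|lborel. P N \<theta> * indicator {- pi..pi} \<theta>) \<longlonglongrightarrow>
    (LINT \<theta>|lborel. exp (2 * u * cos \<theta>) * indicator {- pi..pi} \<theta>)"
  proof (rule integral_dominated_convergence[where w="\<lambda>\<theta>. (exp u)\<^sup>2 * indicator {- pi..pi} \<theta>"])
    show "integrable lborel (\<lambda>\<theta>. (exp u)\<^sup>2 * indicator {- pi..pi} \<theta> :: real)"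
      by (intro integrable_mult_right) auto
    show "AE \<theta> in lborel. norm (P N \<theta> * indicator {- pi..pi} \<theta>) \<le> (exp u)\<^sup>2 * indicator {- pi..pi} \<theta>" for N
    proof (rule AE_I2)
      fix \<theta>
      have "norm (\<Sum>n<N. of_real (a n) * cis (real n * \<theta>)) \<le> (\<Sum>n<N. a n)"
        by (rule order_trans[OF norm_sum]) (simp add: norm_mult a0)
      also have "\<dots> \<le> exp u" using a_sums a0 by (metis sum_le_suminf sums_iff finite_lessThan)
      finally have "P N \<theta> \<le> (exp u)\<^sup>2" unfolding P_eq by (intro power_mono) auto
      moreover have "P N \<theta> \<ge> 0" unfolding P_eq by simp
      ultimately show "norm (P N \<theta> * indicator {- pi..pi} \<theta>) \<le> (exp u)\<^sup>2 * indicator {- pi..pi} \<theta>"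
        by (auto simp: indicator_def)
    qed
    show "AE \<theta> in lborel. (\<lambda>N. P N \<theta> * indicator {- pi..pi} \<theta>) \<longlonglongrightarrow> exp (2 * u * cos \<theta>) * indicator {- pi..pi} \<theta>"
    proof (intro AE_I2 tendsto_intros)
      fix \<theta>
      have "(\<lambda>n. (of_real u * cis \<theta>) ^ n /\<^sub>R fact n) sums exp (of_real u * cis \<theta>)" by (rule exp_converges)
      moreover have "(of_real u * cis \<theta>) ^ n /\<^sub>R fact n = of_real (a n) * cis (real n * \<theta>)" for n
        by (simp add: power_mult_distrib Complex.DeMoivre a_def scaleR_conv_of_real divide_inverse mult_ac)
      ultimately have "(\<lambda>N. \<Sum>n<N. of_real (a n) * cis (real n * \<theta>)) \<longlonglongrightarrow> exp (of_real u * cis \<theta>)"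
        by (simp add: sums_def)
      then have "(\<lambda>N. P N \<theta>) \<longlonglongrightarrow> (norm (exp (of_real u * cis \<theta>)))\<^sup>2"
        unfolding P_eq by (intro tendsto_intros)
      also have "(norm (exp (of_real u * cis \<theta>)))\<^sup>2 = exp (2 * u * cos \<theta>)"
        by (simp add: exp_double[symmetric] mult.assoc)
      finally show "(\<lambda>N. P N \<theta>) \<longlonglongrightarrow> exp (2 * u * cos \<theta>)" .
    qed
  qed (auto simp: P_def)
  moreover have "(LINT \<theta>|lborel. P N \<theta> * indicator {- pi..pi} \<theta>) = 2 * pi * (\<Sum>n<N. (a n)\<^sup>2)" for N
    using P_int by (rule has_bochner_integral_integral_eq)
  ultimately have "(\<lambda>N. 2 * pi * (\<Sum>n<N. (a n)\<^sup>2)) \<longlonglongrightarrow> (LINT \<theta>|lborel. exp (2 * u * cos \<theta>) * indicator {- pi..pi} \<theta>)"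
    by simp
  then have "(\<lambda>N. 2 * pi * (\<Sum>n<N. (a n)\<^sup>2) / (2 * pi)) \<longlonglongrightarrow> bessel_int u"
    unfolding bessel_int_def by (intro tendsto_divide tendsto_const) auto
  then show ?thesis by (simp add: sums_def a_def)
qed

text \<open>A quadratic lower bound valid on the whole period lets one Gaussian dominate the
  integrand of Laplace's method. For \<open>y = \<theta> / 2\<close>, of modulus at most 2, the
  cubic Taylor bound gives \<open>\<bar>sin y\<bar> \<ge> \<bar>y\<bar> / 3\<close>, and
  \<open>1 - cos \<theta>\<close> is twice the square of \<open>sin y\<close>; hence 18.\<close>

lemma one_minus_cos_ge:
  assumes "\<bar>\<theta>\<bar> \<le> pi"
  shows "\<theta>\<^sup>2 / 18 \<le> 1 - cos \<theta>"
proof -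
  define y where "y = \<theta> / 2"
  have y: "\<bar>y\<bar> \<le> 2" using assms pi_less_4 by (simp add: y_def)
  have "\<bar>sin y - y\<bar> \<le> inverse (fact 3) * \<bar>y\<bar> ^ 3"
    using Maclaurin_sin_bound[of y 3] by (simp add: eval_nat_numeral sin_coeff_def)
  then have s: "\<bar>sin y - y\<bar> \<le> \<bar>y\<bar> ^ 3 / 6" by (simp add: fact_numeral field_simps)
  have "\<bar>y\<bar>\<^sup>2 \<le> 2\<^sup>2" using y by (intro power_mono) auto
  then have "\<bar>y\<bar>\<^sup>2 * \<bar>y\<bar> \<le> 4 * \<bar>y\<bar>" by (intro mult_right_mono) auto
  then have "\<bar>y\<bar> ^ 3 / 6 \<le> 2 / 3 * \<bar>y\<bar>" by (simp add: power3_eq_cube power2_eq_square)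
  then have "\<bar>y\<bar> / 3 \<le> \<bar>sin y\<bar>" using s by linarith
  then have "(\<bar>y\<bar> / 3)\<^sup>2 \<le> \<bar>sin y\<bar>\<^sup>2" by (intro power_mono) auto
  then have "y\<^sup>2 / 9 \<le> (sin y)\<^sup>2" by (simp add: power_divide)
  moreover have "1 - cos \<theta> = 2 * (sin y)\<^sup>2"
    using cos_double_sin[of y] by (simp add: y_def)
  ultimately show ?thesis by (simp add: y_def power_divide)
qed

lemma gaussian_integral: "has_bochner_integral lborel (\<lambda>x::real. exp (- x\<^sup>2)) (sqrt pi)"
  using has_bochner_integral_even_function[OF gaussian_moment_0] by simp

lemma gaussian_integral_scaled: "integrable lborel (\<lambda>x::real. exp (- x\<^sup>2 / 9))"
  using lborel_integrable_real_affine[of "\<lambda>x::real. exp (- x\<^sup>2)" "1 / 3" 0] gaussian_integral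
  by (simp add: has_bochner_integral_iff power_mult_distrib power_divide)

text \<open>\<open>I_0 (2 * u)\<close> grows like \<open>exp (2 * u) / (2 * sqrt (pi * u))\<close>;
  this normalisation has the finite limit \<open>1 / (2 * sqrt pi)\<close>.\<close>

definition bessel_scaled :: "real \<Rightarrow> real" where
  "bessel_scaled u = sqrt u * exp (- 2 * u) * bessel_int u"

lemma bessel_scaled_eq:
  assumes u: "u > 0"
  shows "bessel_scaled u = (LINT x|lborel. exp (- (2 * u * (1 - cos (x / sqrt u)))) * indicator {- pi..pi} (x / sqrt u)) / (2 * pi)"
proof -
  have "(LINT \<theta>|lborel. exp (2 * u * cos \<theta>) * indicator {- pi..pi} \<theta>)
     = (LINT x|lborel. exp (2 * u * cos (x / sqrt u)) * indicator {- pi..pi} (x / sqrt u)) / sqrt u"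
    using u by (subst lborel_integral_real_affine[where c="1 / sqrt u" and t=0]) auto
  then have "bessel_scaled u = exp (- 2 * u) * (LINT x|lborel. exp (2 * u * cos (x / sqrt u)) * indicator {- pi..pi} (x / sqrt u)) / (2 * pi)"
    using u by (simp add: bessel_scaled_def bessel_int_def)
  also have "exp (- 2 * u) * (LINT x|lborel. exp (2 * u * cos (x / sqrt u)) * indicator {- pi..pi} (x / sqrt u))
    = (LINT x|lborel. exp (- 2 * u) * (exp (2 * u * cos (x / sqrt u)) * indicator {- pi..pi} (x / sqrt u)))"
    by (rule integral_mult_right_zero[symmetric])
  also have "\<dots> = (LINT x|lborel. exp (- (2 * u * (1 - cos (x / sqrt u)))) * indicator {- pi..pi} (x / sqrt u))"
  proof -
    have "exp (- 2 * u) * exp (2 * u * c) = exp (- (2 * u * (1 - c)))" for c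
      by (simp add: exp_add[symmetric] right_diff_distrib)
    then show ?thesis by (simp only: mult.assoc[symmetric])
  qed
  finally show ?thesis .
qed

lemma bessel_integrand_le:
  assumes u: "u > 0"
  shows "\<bar>exp (- (2 * u * (1 - cos (x / sqrt u)))) * indicator {- pi..pi} (x / sqrt u)\<bar> \<le> exp (- x\<^sup>2 / 9)"
proof (cases "\<bar>x / sqrt u\<bar> \<le> pi")
  case True
  have "2 * u * ((x / sqrt u)\<^sup>2 / 18) \<le> 2 * u * (1 - cos (x / sqrt u))"
    using one_minus_cos_ge[OF True] u by (intro mult_left_mono) auto
  then have "x\<^sup>2 / 9 \<le> 2 * u * (1 - cos (x / sqrt u))" using u by (simp add: power_divide)
  then show ?thesis by (auto simp: indicator_def)
next
  case False
  then have "x / sqrt u \<notin> {- pi..pi}" by auto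
  then show ?thesis by simp
qed

text \<open>Laplace's method. After the substitution \<open>\<theta> = x / sqrt u\<close> the
  exponent \<open>2 * u * (1 - cos (x / sqrt u))\<close> tends to the square of \<open>x\<close>,
  and the quadratic lower bound on \<open>1 - cos\<close> dominates the integrand by a fixed
  Gaussian.\<close>

lemma bessel_scaled_tendsto: "(bessel_scaled \<longlongrightarrow> 1 / (2 * sqrt pi)) at_top"
proof -
  let ?s = "\<lambda>u x. exp (- (2 * u * (1 - cos (x / sqrt u)))) * indicator {- pi..pi} (x / sqrt u) :: real"
  have "((\<lambda>u. LINT x|lborel. ?s u x) \<longlongrightarrow> (LINT x|lborel. exp (- x\<^sup>2))) at_top"
  proof (rule integral_dominated_convergence_at_top[where w="\<lambda>x. exp (- x\<^sup>2 / 9)"])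
    show "\<forall>\<^sub>F u in at_top. AE x in lborel. norm (?s u x) \<le> exp (- x\<^sup>2 / 9)"
      using eventually_gt_at_top[of 0] by eventually_elim (use bessel_integrand_le in auto)
    show "AE x in lborel. ((\<lambda>u. ?s u x) \<longlongrightarrow> exp (- x\<^sup>2)) at_top"
    proof (rule AE_I2)
      fix x :: real
      have lim: "((\<lambda>u. exp (- (2 * u * (1 - cos (x / sqrt u))))) \<longlongrightarrow> exp (- x\<^sup>2)) at_top"
        unfolding power2_eq_square by real_asymp
      have "((\<lambda>u. x / sqrt u) \<longlongrightarrow> 0) at_top" by real_asymp
      then have "\<forall>\<^sub>F u in at_top. x / sqrt u \<in> {- pi<..<pi}"
        by (rule topological_tendstoD) auto
      then have "\<forall>\<^sub>F u in at_top. exp (- (2 * u * (1 - cos (x / sqrt u)))) = ?s u x"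
        by eventually_elim (auto simp: indicator_def)
      then show "((\<lambda>u. ?s u x) \<longlongrightarrow> exp (- x\<^sup>2)) at_top"
        using lim by (rule Lim_transform_eventually[rotated])
    qed
  qed (use gaussian_integral_scaled in auto)
  also have "(LINT x|lborel. exp (- (x::real)\<^sup>2)) = sqrt pi"
    using gaussian_integral by (rule has_bochner_integral_integral_eq)
  finally have "((\<lambda>u. (LINT x|lborel. ?s u x) / (2 * pi)) \<longlongrightarrow> sqrt pi / (2 * pi)) at_top"
    by (intro tendsto_divide tendsto_const) auto
  moreover have "\<forall>\<^sub>F u in at_top. (LINT x|lborel. ?s u x) / (2 * pi) = bessel_scaled u"
    using eventually_gt_at_top[of 0] by eventually_elim (simp add: bessel_scaled_eq)
  ultimately have "(bessel_scaled \<longlongrightarrow> sqrt pi / (2 * pi)) at_top"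
    by (rule Lim_transform_eventually)
  moreover have "sqrt pi / (2 * pi) = 1 / (2 * sqrt pi)"
    using real_sqrt_pow2[of pi] by (simp add: field_simps power2_eq_square)
  ultimately show ?thesis by simp
qed

definition bessel_bound :: real where
  "bessel_bound = (LINT x|lborel. exp (- (x::real)\<^sup>2 / 9)) / (2 * pi)"

lemma bessel_bound_nonneg: "bessel_bound \<ge> 0"
  unfolding bessel_bound_def by (intro divide_nonneg_nonneg integral_nonneg_AE) auto

lemma bessel_scaled_nonneg: "u \<ge> 0 \<Longrightarrow> bessel_scaled u \<ge> 0"
  unfolding bessel_scaled_def bessel_int_def by (intro mult_nonneg_nonneg divide_nonneg_nonneg integral_nonneg_AE) auto

text \<open>The Gaussian that dominates in Laplace's method also bounds the function for every
  positive \<open>u\<close>. This uniform bound is the source of all dominating functions in the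
  double integrals below.\<close>

lemma bessel_scaled_le:
  assumes u: "u > 0"
  shows "bessel_scaled u \<le> bessel_bound"
proof -
  let ?s = "\<lambda>x. exp (- (2 * u * (1 - cos (x / sqrt u)))) * indicator {- pi..pi} (x / sqrt u) :: real"
  have "integrable lborel ?s"
    by (rule Bochner_Integration.integrable_bound[OF gaussian_integral_scaled])
      (use bessel_integrand_le[OF u] in auto)
  then have "(LINT x|lborel. ?s x) \<le> (LINT x|lborel. exp (- x\<^sup>2 / 9))"
    using bessel_integrand_le[OF u] gaussian_integral_scaled
    by (intro integral_mono) (auto intro: order_trans[OF abs_ge_self])
  then show ?thesis unfolding bessel_scaled_eq[OF u] bessel_bound_def
    by (intro divide_right_mono) auto
qed

section \<open>Radial densities of the modes and their summed products\<close>

definition radial_density :: "nat \<Rightarrow> real \<Rightarrow> real" where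
  "radial_density n r = indicator {0..} r * (2 * r ^ (2 * n + 1) * exp (- r\<^sup>2) / fact n)"

lemma borel_measurable_radial_density [measurable]: "radial_density n \<in> borel_measurable borel"
  unfolding radial_density_def by measurable

lemma radial_density_nonneg: "radial_density n r \<ge> 0"
  by (auto simp: radial_density_def indicator_def)

lemma distr_norm_mode_law:
  "distr (mode_law n) borel norm = density lborel (\<lambda>r. ennreal (radial_density n r))"
proof (rule measure_eqI)
  fix A :: "real set" assume "A \<in> sets (distr (mode_law n) borel norm)"
  then have [measurable]: "A \<in> sets borel" by simp
  have "emeasure (distr (mode_law n) borel norm) A = (\<integral>\<^sup>+r. indicator A r \<partial>distr (mode_law n) borel norm)"
    by simp
  also have "\<dots> = (\<integral>\<^sup>+z. indicator A (norm z) \<partial>mode_law n)"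
    by (rule nn_integral_distr) measurable
  also have "\<dots> = (\<integral>\<^sup>+r. ennreal (radial_density n r) * indicator A r \<partial>lborel)"
    unfolding radial_density_def by (rule nn_integral_mode_law_radial) measurable
  also have "\<dots> = emeasure (density lborel (\<lambda>r. ennreal (radial_density n r))) A"
    by (rule emeasure_density[symmetric]) measurable
  finally show "emeasure (distr (mode_law n) borel norm) A = emeasure (density lborel (\<lambda>r. ennreal (radial_density n r))) A" .
qed simp

lemma integral_mode_law_radial:
  fixes k :: "real \<Rightarrow> real"
  assumes [measurable]: "k \<in> borel_measurable borel"
  shows "(LINT z|mode_law n. k (norm z)) = (LINT r|lborel. radial_density n r * k r)"
proof -
  have "(LINT z|mode_law n. k (norm z)) = (LINT r|distr (mode_law n) borel norm. k r)"
    by (rule integral_distr[symmetric]) measurable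
  also have "\<dots> = (LINT r|lborel. radial_density n r * k r)"
    unfolding distr_norm_mode_law by (subst integral_density) (auto simp: radial_density_nonneg)
  finally show ?thesis .
qed

lemma integral_lborel_radial:
  fixes k :: "real \<Rightarrow> real"
  assumes [measurable]: "k \<in> borel_measurable borel"
  shows "(LINT z|(lborel :: complex measure). k (norm z)) = (LINT r|lborel. max 0 (2 * pi * r) * k r)"
proof -
  have "(LINT z|(lborel :: complex measure). k (norm z)) = (LINT r|distr (lborel :: complex measure) borel norm. k r)"
    by (rule integral_distr[symmetric]) auto
  also have "distr (lborel :: complex measure) borel norm = density lborel (\<lambda>r. ennreal (max 0 (2 * pi * r)))"
    unfolding distr_norm_lborel_complex by (intro density_cong) (auto simp: max_def ennreal_neg)
  also have "(LINT r|\<dots>. k r) = (LINT r|lborel. max 0 (2 * pi * r) * k r)"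
    by (subst integral_density) auto
  finally show ?thesis .
qed

text \<open>The series is \<open>4 * r * s * exp (- r\<^sup>2 - s\<^sup>2)\<close> times
  \<open>bessel_int (r * s)\<close>. Writing the exponent as
  \<open>- (r - s)\<^sup>2 - 2 * r * s\<close> splits off the Gaussian weight of the limit variance
  and leaves exactly the factor that normalises the Bessel function.\<close>

lemma radial_density_product_sums:
  assumes "r > 0" "s > 0"
  shows "(\<lambda>n. radial_density n r * radial_density n s) sums (4 * sqrt (r * s) * exp (- (r - s)\<^sup>2) * bessel_scaled (r * s))"
proof -
  have e: "exp (- (r - s)\<^sup>2) * exp (- 2 * (r * s)) = exp (- r\<^sup>2) * exp (- s\<^sup>2)"
    unfolding exp_add[symmetric] by (simp add: power2_eq_square algebra_simps)
  have "(\<lambda>n. 4 * (r * s) * (exp (- r\<^sup>2) * exp (- s\<^sup>2)) * ((r * s) ^ n / fact n)\<^sup>2) sums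
     (4 * (r * s) * (exp (- r\<^sup>2) * exp (- s\<^sup>2)) * bessel_int (r * s))"
    using assms by (intro sums_mult square_exp_series_sums) auto
  moreover have "4 * (r * s) * (exp (- r\<^sup>2) * exp (- s\<^sup>2)) * ((r * s) ^ n / fact n)\<^sup>2 = radial_density n r * radial_density n s" for n
  proof -
    have rd: "radial_density n x = 2 * (x * (x ^ n * x ^ n)) * exp (- x\<^sup>2) / fact n" if "x > 0" for x
    proof -
      have "x ^ (2 * n + 1) = x * (x ^ n * x ^ n)"
        using power_add[of x n n] by (simp add: mult_2[symmetric])
      then show ?thesis using that unfolding radial_density_def by (simp only:) simp
    qed
    have "4 * (x * y) * (E * F) * ((x * y) ^ n / q)\<^sup>2
      = (2 * (x * (x ^ n * x ^ n)) * E / q) * (2 * (y * (y ^ n * y ^ n)) * F / q)" for x y E F q :: real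
      by (simp add: power_mult_distrib power_divide power2_eq_square mult_ac)
    then show ?thesis unfolding rd[OF assms(1)] rd[OF assms(2)] .
  qed
  moreover have "4 * (r * s) * (exp (- r\<^sup>2) * exp (- s\<^sup>2)) * bessel_int (r * s)
    = 4 * sqrt (r * s) * exp (- (r - s)\<^sup>2) * bessel_scaled (r * s)"
  proof -
    have "sqrt (r * s) * sqrt (r * s) = r * s" using assms by (intro real_sqrt_mult_self[THEN trans]) auto
    moreover have "4 * q * E * (q * A * J) = 4 * (q * q) * (E * A) * J" for q E A J :: real
      by (simp only: mult_ac)
    ultimately have "4 * sqrt (r * s) * exp (- (r - s)\<^sup>2) * bessel_scaled (r * s)
      = 4 * (r * s) * (exp (- (r - s)\<^sup>2) * exp (- 2 * (r * s))) * bessel_int (r * s)"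
      unfolding bessel_scaled_def by metis
    then show ?thesis by (simp only: e)
  qed
  ultimately show ?thesis by simp
qed

abbreviation "lborel2 \<equiv> (lborel \<Otimes>\<^sub>M lborel :: (real \<times> real) measure)"

abbreviation square_ind :: "real \<Rightarrow> real \<times> real \<Rightarrow> real" where
  "square_ind L \<equiv> indicator ({-L..L} \<times> {-L..L})"

lemma integrable_pair_box:
  fixes F :: "real \<times> real \<Rightarrow> real"
  assumes [measurable]: "F \<in> borel_measurable lborel2"
    and F: "\<And>x y. \<bar>F (x, y)\<bar> \<le> C * square_ind L (x, y)"
  shows "integrable lborel2 F"
    and "integrable lborel2 (\<lambda>p. C * square_ind L p)"
proof -
  have "emeasure lborel2 ({-L..L} \<times> {-L..L}) < \<infinity>"
  proof -
    have "emeasure lborel {-L..L} < \<infinity>" by (rule emeasure_bounded_finite) simp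
    then show ?thesis by (subst lborel.emeasure_pair_measure_Times) (auto simp: ennreal_mult_less_top)
  qed
  then show int: "integrable lborel2 (\<lambda>p. C * square_ind L p)"
    by (intro integrable_mult_right integrable_real_indicator) auto
  show "integrable lborel2 F"
  proof (rule Bochner_Integration.integrable_bound[OF int])
    show "AE p in lborel2. norm (F p) \<le> norm (C * square_ind L p)"
    proof (rule AE_I2)
      fix p :: "real \<times> real"
      show "norm (F p) \<le> norm (C * square_ind L p)"
        using F[of "fst p" "snd p"] abs_ge_self[of "C * square_ind L p"] by simp
    qed
  qed simp
qed

section \<open>Sums over modes for a function concentrated near radius \<open>R\<close>, and the
  limit of the variance\<close>

context
  fixes f :: "real \<Rightarrow> real" and B L :: real
  assumes f[measurable]: "f \<in> borel_measurable borel"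
    and B: "\<And>x. \<bar>f x\<bar> \<le> B" and L: "L > 0" and supp: "\<And>x. \<bar>x\<bar> > L \<Longrightarrow> f x = 0"
begin

lemma uniform_bound_nonneg: "B \<ge> 0"
  using B[of 0] by linarith

lemma abs_le_bound_indicator: "\<bar>f x\<bar> \<le> B * indicator {-L..L} x"
  using B[of x] supp[of x] by (cases "\<bar>x\<bar> \<le> L") (auto simp: indicator_def)

lemma integrable_interval_bound:
  fixes k :: "real \<Rightarrow> real"
  assumes [measurable]: "k \<in> borel_measurable borel" and k: "\<And>x. \<bar>k x\<bar> \<le> C * indicator {-L..L} x"
  shows "integrable lborel k"
proof (rule Bochner_Integration.integrable_bound)
  show "integrable lborel (\<lambda>x. C * indicator {-L..L} x)" using L by (intro integrable_mult_right integrable_real_indicator) auto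
  show "AE x in lborel. norm (k x) \<le> norm (C * indicator {-L..L} x)"
    using k by (intro AE_I2) (auto intro: order_trans[OF _ abs_ge_self])
qed simp

lemma integrable_compact_support: "integrable lborel f"
  by (rule integrable_interval_bound[OF f abs_le_bound_indicator])

lemma integrable_compact_support_sq: "integrable lborel (\<lambda>x. (f x)\<^sup>2)"
proof (rule integrable_interval_bound[where C="B\<^sup>2"])
  show "\<bar>(f x)\<^sup>2\<bar> \<le> B\<^sup>2 * indicator {-L..L} x" for x
    using power_mono[OF abs_le_bound_indicator[of x], of 2] by (auto simp: power_mult_distrib indicator_def)
qed simp

lemma integrable_compact_support_moment: "integrable lborel (\<lambda>x. x * f x)" "integrable lborel (\<lambda>x. x * (f x)\<^sup>2)"
proof -
  have *: "\<bar>x * k x\<bar> \<le> L * C * indicator {-L..L} x" if "\<bar>k x\<bar> \<le> C * indicator {-L..L} x" for k C and x :: real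
  proof (cases "\<bar>x\<bar> \<le> L")
    case True
    then have "x \<in> {-L..L}" by auto
    then have "\<bar>k x\<bar> \<le> C" using that by simp
    then have "\<bar>x\<bar> * \<bar>k x\<bar> \<le> L * C" using True L by (intro mult_mono) auto
    then show ?thesis using \<open>x \<in> {-L..L}\<close> by (simp add: abs_mult)
  next
    case False
    then show ?thesis using that by (auto simp: indicator_def split: if_splits)
  qed
  show "integrable lborel (\<lambda>x. x * f x)"
    by (rule integrable_interval_bound[where C="L * B"]) (simp, rule *[OF abs_le_bound_indicator])
  have "\<bar>(f x)\<^sup>2\<bar> \<le> B\<^sup>2 * indicator {-L..L} x" for x
    using power_mono[OF abs_le_bound_indicator[of x], of 2] by (auto simp: power_mult_distrib indicator_def)
  then show "integrable lborel (\<lambda>x. x * (f x)\<^sup>2)"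
    by (intro integrable_interval_bound[OF _ *]) auto
qed

text \<open>In polar coordinates with \<open>r = R + x\<close> the density \<open>2 * pi * r\<close>
  splits into a constant part and a part linear in \<open>x\<close>: the first gives the growth in
  \<open>R\<close>, the second a bounded curvature correction. \<open>R > L\<close> keeps
  \<open>R + x\<close> positive on the support. A general \<open>k\<close> is allowed because both
  \<open>f\<close> and its square are inserted.\<close>

lemma mode_law_shifted_sums:
  fixes k :: "real \<Rightarrow> real"
  assumes k[measurable]: "k \<in> borel_measurable borel" and kb: "\<And>x. \<bar>k x\<bar> \<le> C"
    and ks: "\<And>x. \<bar>x\<bar> > L \<Longrightarrow> k x = 0" and ki: "integrable lborel k" "integrable lborel (\<lambda>x. x * k x)"
    and R: "R > L"
  shows "(\<lambda>n. LINT z|mode_law n. k (norm z - R)) sums (2 * R * (LINT x|lborel. k x) + 2 * (LINT x|lborel. x * k x))"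
    and "integrable lborel (\<lambda>z::complex. k (norm z - R))"
proof -
  show int: "integrable lborel (\<lambda>z::complex. k (norm z - R))"
  proof (rule integrable_lborel_disc[where B=C and b="R + L + 1"])
    show "k (norm z - R) = 0" if "norm z \<ge> R + L + 1" for z :: complex
      by (rule ks) (use that L in linarith)
  qed (use kb in auto)
  have "(LINT z|(lborel :: complex measure). k (norm z - R)) = (LINT r|lborel. max 0 (2 * pi * r) * k (r - R))"
    by (rule integral_lborel_radial) measurable
  also have "\<dots> = (LINT x|lborel. max 0 (2 * pi * (R + x)) * k x)"
    by (subst lborel_integral_real_affine[where c=1 and t=R]) auto
  also have "\<dots> = (LINT x|lborel. 2 * pi * R * k x + 2 * pi * (x * k x))"
  proof (intro Bochner_Integration.integral_cong refl)
    fix x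
    show "max 0 (2 * pi * (R + x)) * k x = 2 * pi * R * k x + 2 * pi * (x * k x)"
    proof (cases "\<bar>x\<bar> > L")
      case True
      then show ?thesis using ks by simp
    next
      case False
      then have "0 \<le> 2 * pi * (R + x)" using R by (intro mult_nonneg_nonneg) auto
      then show ?thesis by (simp add: max_def algebra_simps)
    qed
  qed
  also have "\<dots> = 2 * pi * R * (LINT x|lborel. k x) + 2 * pi * (LINT x|lborel. x * k x)"
    using ki by (subst Bochner_Integration.integral_add) auto
  finally have "(LINT z|(lborel :: complex measure). k (norm z - R)) / pi = 2 * R * (LINT x|lborel. k x) + 2 * (LINT x|lborel. x * k x)"
    by (simp add: field_simps)
  then show "(\<lambda>n. LINT z|mode_law n. k (norm z - R)) sums (2 * R * (LINT x|lborel. k x) + 2 * (LINT x|lborel. x * k x))"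
    using mode_law_integral_sums[OF int] by simp
qed

text \<open>Closed form of the sum over all \<open>n\<close> of
  \<open>radial_density n (x + R) * radial_density n (y + R)\<close>, in coordinates centred at
  radius \<open>R\<close>.\<close>

definition overlap :: "real \<Rightarrow> real \<times> real \<Rightarrow> real" where
  "overlap R p = 4 * sqrt ((fst p + R) * (snd p + R)) * exp (- (fst p - snd p)\<^sup>2) * bessel_scaled ((fst p + R) * (snd p + R))"

lemma borel_measurable_bessel_scaled [measurable]: "bessel_scaled \<in> borel_measurable borel"
  unfolding bessel_scaled_def bessel_int_def by measurable

lemma overlap_bounds:
  assumes R: "R > L" and xy: "\<bar>x\<bar> \<le> L" "\<bar>y\<bar> \<le> L"
  shows "0 \<le> overlap R (x, y)" "overlap R (x, y) \<le> 4 * (R + L) * bessel_bound"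
    "(\<lambda>n. radial_density n (x + R) * radial_density n (y + R)) sums overlap R (x, y)"
proof -
  have r: "x + R > 0" "y + R > 0" using R xy by auto
  then have u: "(x + R) * (y + R) > 0" by simp
  show s: "(\<lambda>n. radial_density n (x + R) * radial_density n (y + R)) sums overlap R (x, y)"
    using radial_density_product_sums[OF r] by (simp add: overlap_def)
  show "0 \<le> overlap R (x, y)"
    using r by (auto simp: overlap_def intro!: mult_nonneg_nonneg bessel_scaled_nonneg)
  have "(x + R) * (y + R) \<le> (R + L) * (R + L)" using r xy by (intro mult_mono) auto
  then have "sqrt ((x + R) * (y + R)) \<le> R + L" using R L by (intro real_le_lsqrt) (auto simp: power2_eq_square)
  moreover have "exp (- (x - y)\<^sup>2) \<le> 1" by simp
  ultimately have "4 * sqrt ((x + R) * (y + R)) * exp (- (x - y)\<^sup>2) * bessel_scaled ((x + R) * (y + R)) \<le> 4 * (R + L) * 1 * bessel_bound"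
    using u R L bessel_scaled_le[OF u] bessel_scaled_nonneg[of "(x + R) * (y + R)"] by (intro mult_mono) auto
  then show "overlap R (x, y) \<le> 4 * (R + L) * bessel_bound" by (simp add: overlap_def)
qed

lemma abs_product_le_indicator: "\<bar>f x * f y\<bar> \<le> B\<^sup>2 * square_ind L (x, y)"
proof -
  have "\<bar>f x\<bar> * \<bar>f y\<bar> \<le> (B * indicator {-L..L} x) * (B * indicator {-L..L} y)"
    using abs_le_bound_indicator uniform_bound_nonneg by (intro mult_mono) auto
  also have "\<dots> = B\<^sup>2 * square_ind L (x, y)"
    by (simp add: power2_eq_square indicator_times)
  finally show ?thesis by (simp add: abs_mult)
qed

lemma mode_law_mean_shift: "(LINT z|mode_law n. f (norm z - R)) = (LINT x|lborel. radial_density n (x + R) * f x)"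
proof -
  have "(LINT z|mode_law n. f (norm z - R)) = (LINT r|lborel. radial_density n r * f (r - R))"
    by (rule integral_mode_law_radial) measurable
  also have "\<dots> = (LINT x|lborel. radial_density n (x + R) * f x)"
    by (subst lborel_integral_real_affine[where c=1 and t=R]) (auto simp: add.commute)
  finally show ?thesis .
qed

lemma radial_density_le_overlap:
  assumes R: "R > L" and xy: "\<bar>x\<bar> \<le> L" "\<bar>y\<bar> \<le> L"
  shows "(\<Sum>n<N. radial_density n (x + R) * radial_density n (y + R)) \<le> 4 * (R + L) * bessel_bound"
    "radial_density n (x + R) * radial_density n (y + R) \<le> 4 * (R + L) * bessel_bound"
proof -
  have le: "(\<Sum>n\<in>I. radial_density n (x + R) * radial_density n (y + R)) \<le> 4 * (R + L) * bessel_bound" if "finite I" for I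
    using sum_le_suminf[OF sums_summable[OF overlap_bounds(3)[OF assms]] that] sums_unique[OF overlap_bounds(3)[OF assms]]
      overlap_bounds(2)[OF assms] radial_density_nonneg by (auto intro: order_trans)
  show "(\<Sum>n<N. radial_density n (x + R) * radial_density n (y + R)) \<le> 4 * (R + L) * bessel_bound"
    by (rule le) simp
  show "radial_density n (x + R) * radial_density n (y + R) \<le> 4 * (R + L) * bessel_bound"
    using le[of "{n}"] by simp
qed

text \<open>The square of a mean is a double integral against a product of two radial densities. The
  sum over modes moves inside by dominated convergence: its terms are nonnegative, so all partial
  sums stay below the full overlap, which is bounded on the square.\<close>

lemma mode_law_mean_sq_sums:
  assumes R: "R > L"
  shows "(\<lambda>n. (LINT z|mode_law n. f (norm z - R))\<^sup>2) sums
    (LINT p|lborel2. f (fst p) * f (snd p) * overlap R p)"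
proof -
  define C where "C = B\<^sup>2 * (4 * (R + L) * bessel_bound)"
  have C0: "0 \<le> 4 * (R + L) * bessel_bound" using R L bessel_bound_nonneg by auto
  let ?F = "\<lambda>n p. f (fst p) * f (snd p) * (radial_density n (fst p + R) * radial_density n (snd p + R))"
  \<comment> \<open>One estimate for a single term, a partial sum and any other factor
    \<open>G\<close> subject to the overlap bound on the square; off the square the product of
    values of \<open>f\<close> vanishes.\<close>
  have bnd: "\<bar>f x * f y * G\<bar> \<le> C * square_ind L (x, y)"
    if "\<bar>x\<bar> \<le> L \<Longrightarrow> \<bar>y\<bar> \<le> L \<Longrightarrow> 0 \<le> G \<and> G \<le> 4 * (R + L) * bessel_bound" for x y G
  proof (cases "\<bar>x\<bar> \<le> L \<and> \<bar>y\<bar> \<le> L")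
    case True
    then have xy: "(x, y) \<in> {-L..L} \<times> {-L..L}" by auto
    then have "\<bar>f x * f y\<bar> \<le> B\<^sup>2" using abs_product_le_indicator[of x y] by simp
    then have "\<bar>f x * f y\<bar> * \<bar>G\<bar> \<le> C" unfolding C_def
      using that True by (intro mult_mono) auto
    then show ?thesis using xy by (simp add: abs_mult)
  next
    case False
    then have "f x * f y = 0" using supp[of x] supp[of y] by auto
    then have z: "\<bar>f x * f y * G\<bar> = 0" by simp
    have "C \<ge> 0" unfolding C_def by (intro mult_nonneg_nonneg C0) simp
    then show ?thesis unfolding z by (intro mult_nonneg_nonneg) auto
  qed
  have intF: "integrable lborel2 (?F n)" for n
  proof (rule integrable_pair_box[where C=C and L=L])
    show "\<bar>?F n (x, y)\<bar> \<le> C * square_ind L (x, y)" for x y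
      using bnd[of x y "radial_density n (x + R) * radial_density n (y + R)"]
        radial_density_le_overlap(2)[OF R, of x y n] radial_density_nonneg by simp
  qed measurable
  have sq: "(LINT z|mode_law n. f (norm z - R))\<^sup>2 = (LINT p|lborel2. ?F n p)" for n
  proof -
    have "(LINT p|lborel2. ?F n p) = (LINT x|lborel. LINT y|lborel. ?F n (x, y))"
      by (rule lborel_pair.integral_fst'[OF intF, symmetric])
    also have "\<dots> = (LINT x|lborel. radial_density n (x + R) * f x * (LINT y|lborel. radial_density n (y + R) * f y))"
      by (intro Bochner_Integration.integral_cong refl, subst integral_mult_right_zero[symmetric])
        (auto intro!: Bochner_Integration.integral_cong simp: mult_ac)
    also have "\<dots> = (LINT x|lborel. radial_density n (x + R) * f x) * (LINT y|lborel. radial_density n (y + R) * f y)"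
      by (rule integral_mult_left_zero)
    finally show ?thesis by (simp add: mode_law_mean_shift power2_eq_square)
  qed
  have "(\<lambda>N. LINT p|lborel2. f (fst p) * f (snd p) * (\<Sum>n<N. radial_density n (fst p + R) * radial_density n (snd p + R)))
    \<longlonglongrightarrow> (LINT p|lborel2. f (fst p) * f (snd p) * overlap R p)"
  proof (rule integral_dominated_convergence[where w="\<lambda>p. C * square_ind L p"])
    show "integrable lborel2 (\<lambda>p. C * square_ind L p)"
      by (rule integrable_pair_box(2)[where F="\<lambda>_. 0"]) (use C0 in \<open>auto simp: C_def\<close>)
    show "(\<lambda>p. f (fst p) * f (snd p) * overlap R p) \<in> borel_measurable lborel2"
      unfolding overlap_def by measurable
    show "AE p in lborel2. norm (f (fst p) * f (snd p) * (\<Sum>n<N. radial_density n (fst p + R) * radial_density n (snd p + R)))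
       \<le> C * square_ind L p" for N
    proof (rule AE_I2)
      fix p :: "real \<times> real"
      show "norm (f (fst p) * f (snd p) * (\<Sum>n<N. radial_density n (fst p + R) * radial_density n (snd p + R)))
       \<le> C * square_ind L p"
        using bnd[of "fst p" "snd p" "\<Sum>n<N. radial_density n (fst p + R) * radial_density n (snd p + R)"]
          radial_density_le_overlap(1)[OF R, of "fst p" "snd p" N]
        by (simp add: sum_nonneg radial_density_nonneg)
    qed
    show "AE p in lborel2. (\<lambda>N. f (fst p) * f (snd p) * (\<Sum>n<N. radial_density n (fst p + R) * radial_density n (snd p + R)))
       \<longlonglongrightarrow> f (fst p) * f (snd p) * overlap R p"
    proof (rule AE_I2)
      fix p :: "real \<times> real"
      show "(\<lambda>N. f (fst p) * f (snd p) * (\<Sum>n<N. radial_density n (fst p + R) * radial_density n (snd p + R)))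
       \<longlonglongrightarrow> f (fst p) * f (snd p) * overlap R p"
      proof (cases "\<bar>fst p\<bar> \<le> L \<and> \<bar>snd p\<bar> \<le> L")
        case True
        then show ?thesis using overlap_bounds(3)[OF R, of "fst p" "snd p"]
          by (intro tendsto_mult_left) (simp add: sums_def)
      next
        case False
        then have "f (fst p) * f (snd p) = 0" using supp[of "fst p"] supp[of "snd p"] by auto
        then show ?thesis by (simp only: mult_zero_left tendsto_const)
      qed
    qed
  qed measurable
  moreover have "(LINT p|lborel2. f (fst p) * f (snd p) * (\<Sum>n<N. radial_density n (fst p + R) * radial_density n (snd p + R)))
    = (\<Sum>n<N. (LINT z|mode_law n. f (norm z - R))\<^sup>2)" for N
    unfolding sq sum_distrib_left by (rule Bochner_Integration.integral_sum) (rule intF)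
  ultimately show ?thesis by (simp add: sums_def)
qed

definition gauss_overlap :: real where
  "gauss_overlap = (LINT p|lborel2. f (fst p) * f (snd p) * exp (- (fst p - snd p)\<^sup>2))"

text \<open>Pointwise, \<open>sqrt ((x + R) * (y + R)) / R\<close> tends to 1 and the Bessel factor
  to \<open>1 / (2 * sqrt pi)\<close>; with the prefactor 4 this produces
  \<open>2 / sqrt pi\<close>.\<close>

lemma mode_law_mean_sq_limit:
  "((\<lambda>R. (LINT p|lborel2. f (fst p) * f (snd p) * overlap R p) / R)
    \<longlongrightarrow> 2 / sqrt pi * gauss_overlap) at_top"
proof -
  define C where "C = B\<^sup>2 * (8 * bessel_bound)"
  have "((\<lambda>R. LINT p|lborel2. f (fst p) * f (snd p) * (overlap R p / R))
    \<longlongrightarrow> (LINT p|lborel2. f (fst p) * f (snd p) * (2 / sqrt pi * exp (- (fst p - snd p)\<^sup>2)))) at_top"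
  proof (rule integral_dominated_convergence_at_top[where w="\<lambda>p. C * square_ind L p"])
    show "integrable lborel2 (\<lambda>p. C * square_ind L p)"
      by (rule integrable_pair_box(2)[where F="\<lambda>_. 0"]) (use bessel_bound_nonneg in \<open>auto simp: C_def\<close>)
    show "(\<lambda>p. f (fst p) * f (snd p) * (overlap R p / R)) \<in> borel_measurable lborel2" for R
      unfolding overlap_def by measurable
    show "\<forall>\<^sub>F R in at_top. AE p in lborel2. norm (f (fst p) * f (snd p) * (overlap R p / R))
      \<le> C * square_ind L p"
      using eventually_gt_at_top[of L]
    proof eventually_elim
      case (elim R)
      show ?case
      proof (rule AE_I2)
        fix p :: "real \<times> real"
        show "norm (f (fst p) * f (snd p) * (overlap R p / R)) \<le> C * square_ind L p"
        proof (cases "\<bar>fst p\<bar> \<le> L \<and> \<bar>snd p\<bar> \<le> L")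
          case True
          have R0: "R > 0" using elim L by simp
          have o: "0 \<le> overlap R p" "overlap R p \<le> 4 * (R + L) * bessel_bound"
            using overlap_bounds(1,2)[OF elim, of "fst p" "snd p"] True by auto
          \<comment> \<open>Since \<open>R > L\<close>, the sum \<open>R + L\<close> is at most
            \<open>2 * R\<close>; this is where the 8 in \<open>C\<close> comes from.\<close>
          have "4 * (R + L) * bessel_bound \<le> 4 * (2 * R) * bessel_bound"
            using elim bessel_bound_nonneg by (intro mult_right_mono) auto
          then have "overlap R p \<le> 8 * bessel_bound * R" using o(2) by (simp add: mult_ac)
          then have "overlap R p / R \<le> 8 * bessel_bound" using R0 by (simp add: field_simps)
          moreover have p: "p \<in> {-L..L} \<times> {-L..L}" using True by (cases p) auto
          moreover have "\<bar>f (fst p) * f (snd p)\<bar> \<le> B\<^sup>2" using abs_product_le_indicator[of "fst p" "snd p"] p by simp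
          ultimately have "\<bar>f (fst p) * f (snd p)\<bar> * \<bar>overlap R p / R\<bar> \<le> C"
            unfolding C_def using o(1) R0 by (intro mult_mono) auto
          with p show ?thesis by (simp add: abs_mult)
        next
          case False
          then have "f (fst p) * f (snd p) = 0" using supp[of "fst p"] supp[of "snd p"] by auto
          then have z: "norm (f (fst p) * f (snd p) * (overlap R p / R)) = 0" by (simp only: mult_zero_left norm_zero)
          have "C \<ge> 0" unfolding C_def using bessel_bound_nonneg by (intro mult_nonneg_nonneg) auto
          then show ?thesis unfolding z by (intro mult_nonneg_nonneg) auto
        qed
      qed
    qed
    show "AE p in lborel2. ((\<lambda>R. f (fst p) * f (snd p) * (overlap R p / R))
      \<longlongrightarrow> f (fst p) * f (snd p) * (2 / sqrt pi * exp (- (fst p - snd p)\<^sup>2))) at_top"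
    proof (rule AE_I2)
      fix p :: "real \<times> real"
      define x y where "x = fst p" and "y = snd p"
      have "filterlim (\<lambda>R. (x + R) * (y + R)) at_top at_top" by real_asymp
      then have 1: "((\<lambda>R. bessel_scaled ((x + R) * (y + R))) \<longlongrightarrow> 1 / (2 * sqrt pi)) at_top"
        by (rule filterlim_compose[OF bessel_scaled_tendsto])
      have 2: "((\<lambda>R. sqrt ((x + R) * (y + R)) / R) \<longlongrightarrow> 1) at_top" by real_asymp
      have "((\<lambda>R. f x * f y * (4 * (sqrt ((x + R) * (y + R)) / R) * exp (- (x - y)\<^sup>2) * bessel_scaled ((x + R) * (y + R))))
        \<longlongrightarrow> f x * f y * (4 * 1 * exp (- (x - y)\<^sup>2) * (1 / (2 * sqrt pi)))) at_top"
        by (intro tendsto_intros 1 2)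
      then show "((\<lambda>R. f (fst p) * f (snd p) * (overlap R p / R))
        \<longlongrightarrow> f (fst p) * f (snd p) * (2 / sqrt pi * exp (- (fst p - snd p)\<^sup>2))) at_top"
        by (simp add: overlap_def x_def y_def)
    qed
  qed measurable
  moreover have "(LINT p|lborel2. f (fst p) * f (snd p) * (overlap R p / R))
     = (LINT p|lborel2. f (fst p) * f (snd p) * overlap R p) / R" for R
    by simp
  moreover have "(LINT p|lborel2. f (fst p) * f (snd p) * (2 / sqrt pi * exp (- (fst p - snd p)\<^sup>2)))
     = 2 / sqrt pi * gauss_overlap"
    unfolding gauss_overlap_def integral_mult_right_zero[symmetric]
    by (intro Bochner_Integration.integral_cong refl) simp
  ultimately show ?thesis by simp
qed

lemma gaussian_shift: "has_bochner_integral lborel (\<lambda>y. exp (- (x - y)\<^sup>2)) (sqrt pi)" for x :: real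
  using gaussian_integral
  by (subst (asm) lborel_has_bochner_integral_real_affine_iff[where c="-1" and t=x]) auto

text \<open>Expanding the square, each pure term integrates the Gaussian in the other variable to
  \<open>sqrt pi\<close>, which cancels the prefactor. The resulting form matches the split of a
  variance into second moment minus squared mean.\<close>

lemma limit_variance_eq:
  "limit_variance f = 2 * (LINT x|lborel. (f x)\<^sup>2) - 2 / sqrt pi * gauss_overlap"
proof -
  let ?P = "lborel2"
  let ?e = "\<lambda>p::real \<times> real. exp (- (fst p - snd p)\<^sup>2)"
  have inner: "(LINT y|lborel. (f x)\<^sup>2 * exp (- (x - y)\<^sup>2)) = sqrt pi * (f x)\<^sup>2" for x
    using has_bochner_integral_integral_eq[OF gaussian_shift[of x]] by simp
  have int1: "integrable ?P (\<lambda>p. (f (fst p))\<^sup>2 * ?e p)"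
  proof (rule lborel_pair.Fubini_integrable)
    show "integrable lborel (\<lambda>x. LINT y|lborel. norm ((f (fst (x, y)))\<^sup>2 * ?e (x, y)))"
      using integrable_compact_support_sq has_bochner_integral_integral_eq[OF gaussian_shift] by simp
    show "AE x in lborel. integrable lborel (\<lambda>y. (f (fst (x, y)))\<^sup>2 * ?e (x, y))"
      using gaussian_shift by (intro AE_I2) (auto simp: has_bochner_integral_iff)
  qed measurable
  have I1: "(LINT p|?P. (f (fst p))\<^sup>2 * ?e p) = sqrt pi * (LINT x|lborel. (f x)\<^sup>2)"
    by (subst lborel_pair.integral_fst'[OF int1, symmetric])
      (simp add: has_bochner_integral_integral_eq[OF gaussian_shift] mult.commute)
  \<comment> \<open>The Gaussian weight is symmetric, so exchanging the coordinates transfers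
    integrability and value from one pure term to the other.\<close>
  have swap: "(\<lambda>(x, y). (f (fst (y, x)))\<^sup>2 * ?e (y, x)) = (\<lambda>p. (f (snd p))\<^sup>2 * ?e p)"
    by (auto simp: fun_eq_iff power2_commute)
  have int2: "integrable ?P (\<lambda>p. (f (snd p))\<^sup>2 * ?e p)"
    using lborel_pair.integrable_product_swap[OF int1] by (simp only: swap)
  have I2: "(LINT p|?P. (f (snd p))\<^sup>2 * ?e p) = sqrt pi * (LINT x|lborel. (f x)\<^sup>2)"
    using lborel_pair.integral_product_swap[of "\<lambda>p. (f (fst p))\<^sup>2 * ?e p"] unfolding swap I1 by simp
  have int3: "integrable ?P (\<lambda>p. f (fst p) * f (snd p) * ?e p)"
  proof (rule integrable_pair_box)
    show "\<bar>f (fst (x, y)) * f (snd (x, y)) * ?e (x, y)\<bar> \<le> B\<^sup>2 * square_ind L (x, y)" for x y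
      using abs_product_le_indicator[of x y] mult_left_mono[of "exp (- (x - y)\<^sup>2)" 1 "\<bar>f x * f y\<bar>"] by (simp add: abs_mult)
  qed measurable
  have "(LINT p|?P. (f (fst p) - f (snd p))\<^sup>2 * ?e p)
    = (LINT p|?P. (f (fst p))\<^sup>2 * ?e p + (f (snd p))\<^sup>2 * ?e p - 2 * (f (fst p) * f (snd p) * ?e p))"
    by (intro Bochner_Integration.integral_cong refl) (simp add: power2_diff algebra_simps)
  also have "\<dots> = (LINT p|?P. (f (fst p))\<^sup>2 * ?e p + (f (snd p))\<^sup>2 * ?e p) - (LINT p|?P. 2 * (f (fst p) * f (snd p) * ?e p))"
    by (rule Bochner_Integration.integral_diff) (intro Bochner_Integration.integrable_add int1 int2 integrable_mult_right int3)+
  also have "\<dots> = 2 * (sqrt pi * (LINT x|lborel. (f x)\<^sup>2)) - 2 * gauss_overlap"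
    unfolding Bochner_Integration.integral_add[OF int1 int2] I1 I2 gauss_overlap_def integral_mult_right_zero by simp
  finally show ?thesis
    by (simp add: limit_variance_def right_diff_distrib)
qed

text \<open>The variances of the independent summands add up to a sum of second moments, of order
  \<open>2 * R\<close> times the integral of the square of \<open>f\<close>, minus a sum of squared
  means, which is of the same order \<open>R\<close> and contributes the Gaussian overlap.\<close>

lemma variance_limit:
  "((\<lambda>R. (\<Sum>n. (LINT z|mode_law n. (f (norm z - R))\<^sup>2) - (LINT z|mode_law n. f (norm z - R))\<^sup>2) / R)
    \<longlongrightarrow> limit_variance f) at_top"
proof -
  let ?I2 = "LINT x|lborel. (f x)\<^sup>2" and ?J2 = "LINT x|lborel. x * (f x)\<^sup>2"
  have 1: "((\<lambda>R. (2 * R * ?I2 + 2 * ?J2) / R) \<longlongrightarrow> 2 * ?I2) at_top"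
  proof -
    have "((\<lambda>R. (2 * R * a + 2 * c) / R) \<longlongrightarrow> 2 * a) at_top" for a c :: real by real_asymp
    then show ?thesis .
  qed
  have eq: "(\<Sum>n. (LINT z|mode_law n. (f (norm z - R))\<^sup>2) - (LINT z|mode_law n. f (norm z - R))\<^sup>2)
     = (2 * R * ?I2 + 2 * ?J2) - (LINT p|lborel2. f (fst p) * f (snd p) * overlap R p)" if R: "R > L" for R
  proof -
    have "(\<lambda>n. LINT z|mode_law n. (f (norm z - R))\<^sup>2) sums (2 * R * ?I2 + 2 * ?J2)"
    proof (rule mode_law_shifted_sums(1)[where C="B\<^sup>2"])
      show "\<bar>(f x)\<^sup>2\<bar> \<le> B\<^sup>2" for x using power_mono[OF B[of x], of 2] by simp
    qed (use R supp integrable_compact_support_sq integrable_compact_support_moment in auto)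
    from sums_diff[OF this mode_law_mean_sq_sums[OF R]] show ?thesis by (rule sums_unique[symmetric])
  qed
  have "((\<lambda>R. (2 * R * ?I2 + 2 * ?J2) / R - (LINT p|lborel2. f (fst p) * f (snd p) * overlap R p) / R)
     \<longlongrightarrow> limit_variance f) at_top"
    unfolding limit_variance_eq by (intro tendsto_diff 1 mode_law_mean_sq_limit)
  moreover have "\<forall>\<^sub>F R in at_top. (2 * R * ?I2 + 2 * ?J2) / R - (LINT p|lborel2. f (fst p) * f (snd p) * overlap R p) / R
    = (\<Sum>n. (LINT z|mode_law n. (f (norm z - R))\<^sup>2) - (LINT z|mode_law n. f (norm z - R))\<^sup>2) / R"
    using eventually_gt_at_top[of L] by eventually_elim (simp add: eq diff_divide_distrib)
  ultimately show ?thesis by (rule Lim_transform_eventually)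
qed

end

section \<open>The central limit theorem\<close>

text \<open>The product of \<open>1 - a + a\<^sup>2 / 2\<close> and
  \<open>1 + a + a\<^sup>2 / 2\<close> is at least 1, and the second factor is at most
  \<open>exp a\<close>; hence the first bounds \<open>exp (- a)\<close> from above.\<close>

lemma abs_exp_minus_taylor:
  fixes a :: real
  assumes "a \<ge> 0"
  shows "\<bar>exp (- a) - (1 - a)\<bar> \<le> a\<^sup>2 / 2"
proof -
  have "(1 - a + a\<^sup>2 / 2) * (1 + a + a\<^sup>2 / 2) = 1 + (a\<^sup>2)\<^sup>2 / 4"
    by (simp add: power2_eq_square field_simps)
  then have "1 \<le> (1 - a + a\<^sup>2 / 2) * (1 + a + a\<^sup>2 / 2)" by simp
  also have "\<dots> \<le> (1 - a + a\<^sup>2 / 2) * exp a"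
  proof (rule mult_left_mono)
    show "1 + a + a\<^sup>2 / 2 \<le> exp a" using exp_lower_Taylor_quadratic[OF assms] .
    have eq: "1 - a + a\<^sup>2 / 2 = ((1 - a)\<^sup>2 + 1) / 2" by (simp add: power2_eq_square field_simps)
    show "0 \<le> 1 - a + a\<^sup>2 / 2" unfolding eq by simp
  qed
  finally have "exp (- a) \<le> 1 - a + a\<^sup>2 / 2" by (simp add: exp_minus field_simps)
  moreover have "1 - a \<le> exp (- a)" using exp_ge_add_one_self[of "- a"] by simp
  ultimately show ?thesis by simp
qed

text \<open>With \<open>s\<close> the variance, the characteristic function of the centred variable
  and the Gaussian one are both compared with \<open>1 - \<theta>\<^sup>2 * s / 2\<close>. The
  centred variable is bounded by \<open>2 * B\<close>, so its third absolute moment is at most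
  \<open>2 * B * s\<close>; and \<open>s \<le> q \<le> B\<^sup>2\<close> makes the quartic term
  linear in \<open>q\<close> as well. Linearity in \<open>q\<close> is essential, since the errors
  are summed over infinitely many modes.\<close>

lemma (in prob_space) char_centered_bounded_approx:
  fixes X :: "'a \<Rightarrow> real"
  assumes X[measurable]: "random_variable borel X" and B: "\<And>w. \<bar>X w\<bar> \<le> B"
  defines "g \<equiv> expectation X" and "q \<equiv> expectation (\<lambda>w. (X w)\<^sup>2)"
  shows "norm (expectation (\<lambda>w. iexp (\<theta> * X w)) * iexp (- \<theta> * g) - of_real (exp (- \<theta>\<^sup>2 * (q - g\<^sup>2) / 2)))
      \<le> (\<bar>\<theta>\<bar> ^ 3 * B / 3 + \<theta> ^ 4 * B\<^sup>2 / 8) * q"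
    and "0 \<le> q - g\<^sup>2"
proof -
  define Y where "Y w = X w - g" for w
  have [measurable]: "random_variable borel Y" unfolding Y_def by measurable
  have B0: "B \<ge> 0" using B[of undefined] by linarith
  have Xi: "integrable M X" using B by (intro integrable_const_bound[where B=B]) auto
  have X2: "(X w)\<^sup>2 \<le> B\<^sup>2" for w using power_mono[OF B[of w], of 2] by simp
  have X2i: "integrable M (\<lambda>w. (X w)\<^sup>2)" using X2 by (intro integrable_const_bound[where B="B\<^sup>2"]) auto
  have gB: "\<bar>g\<bar> \<le> B"
  proof -
    have "\<bar>g\<bar> \<le> expectation (\<lambda>w. \<bar>X w\<bar>)" using integral_norm_bound[of M X] by (simp add: g_def)
    also have "\<dots> \<le> expectation (\<lambda>w. B)" using Xi B by (intro integral_mono) auto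
    finally show ?thesis by (simp add: prob_space)
  qed
  have YB: "\<bar>Y w\<bar> \<le> 2 * B" for w using B[of w] gB by (simp add: Y_def)
  have Yi: "integrable M Y" unfolding Y_def using Xi by simp
  have Y2i: "integrable M (\<lambda>w. (Y w)\<^sup>2)"
    using power_mono[OF YB, of _ 2] by (intro integrable_const_bound[where B="(2 * B)\<^sup>2"]) auto
  have EY: "expectation Y = 0" using Xi by (simp add: Y_def[abs_def] prob_space) (simp add: g_def)
  define s where "s = q - g\<^sup>2"
  have EY2: "expectation (\<lambda>w. (Y w)\<^sup>2) = s"
  proof -
    have "expectation (\<lambda>w. (Y w)\<^sup>2) = expectation (\<lambda>w. (X w)\<^sup>2 - 2 * g * X w + g\<^sup>2)"
      by (intro Bochner_Integration.integral_cong refl) (simp add: Y_def power2_diff)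
    also have "\<dots> = q - 2 * g * g + g\<^sup>2"
      using Xi X2i by (simp add: prob_space q_def g_def)
    finally show ?thesis by (simp add: s_def power2_eq_square)
  qed
  have s0: "s \<ge> 0" unfolding EY2[symmetric] by simp
  then show "0 \<le> q - g\<^sup>2" by (simp add: s_def)
  have qs: "s \<le> q" by (simp add: s_def)
  have qB: "q \<le> B\<^sup>2"
  proof -
    have "q \<le> expectation (\<lambda>w. B\<^sup>2)" unfolding q_def using X2i X2 by (intro integral_mono) auto
    then show ?thesis by (simp add: prob_space)
  qed
  have char_eq: "char (distr M borel Y) \<theta> = expectation (\<lambda>w. iexp (\<theta> * X w)) * iexp (- \<theta> * g)"
  proof -
    have "char (distr M borel Y) \<theta> = expectation (\<lambda>w. iexp (\<theta> * Y w))"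
      unfolding char_def by (subst integral_distr) auto
    also have "\<dots> = expectation (\<lambda>w. iexp (\<theta> * X w) * iexp (- \<theta> * g))"
      by (intro Bochner_Integration.integral_cong refl) (simp add: Y_def exp_add[symmetric] algebra_simps)
    also have "\<dots> = expectation (\<lambda>w. iexp (\<theta> * X w)) * iexp (- \<theta> * g)"
      by (rule integral_mult_left_zero)
    finally show ?thesis .
  qed
  have "norm (char (distr M borel Y) \<theta> - (1 - \<theta>\<^sup>2 * s / 2)) \<le>
    (\<theta>\<^sup>2 / 6) * expectation (\<lambda>w. min (6 * (Y w)\<^sup>2) (\<bar>\<theta>\<bar> * \<bar>Y w\<bar> ^ 3))"
    by (rule char_approx3'[where X=Y]) (use Yi Y2i EY EY2 in auto)
  also have "\<dots> \<le> (\<theta>\<^sup>2 / 6) * expectation (\<lambda>w. \<bar>\<theta>\<bar> * (2 * B) * (Y w)\<^sup>2)"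
  proof (intro mult_left_mono integral_mono)
    show "integrable M (\<lambda>w. \<bar>\<theta>\<bar> * (2 * B) * (Y w)\<^sup>2)" using Y2i by (rule integrable_mult_right)
    show "integrable M (\<lambda>w. min (6 * (Y w)\<^sup>2) (\<bar>\<theta>\<bar> * \<bar>Y w\<bar> ^ 3))"
    proof (rule Bochner_Integration.integrable_bound)
      show "integrable M (\<lambda>w. 6 * (Y w)\<^sup>2)" using Y2i by (rule integrable_mult_right)
      show "AE w in M. norm (min (6 * (Y w)\<^sup>2) (\<bar>\<theta>\<bar> * \<bar>Y w\<bar> ^ 3)) \<le> norm (6 * (Y w)\<^sup>2)"
        by (intro AE_I2) (simp add: min_def)
    qed measurable
    fix w
    have "\<bar>Y w\<bar> ^ 3 = \<bar>Y w\<bar> * (Y w)\<^sup>2" by (simp add: power3_eq_cube power2_eq_square)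
    also have "\<dots> \<le> 2 * B * (Y w)\<^sup>2" using YB by (intro mult_right_mono) auto
    finally have "\<bar>\<theta>\<bar> * \<bar>Y w\<bar> ^ 3 \<le> \<bar>\<theta>\<bar> * (2 * B * (Y w)\<^sup>2)" by (intro mult_left_mono) auto
    then show "min (6 * (Y w)\<^sup>2) (\<bar>\<theta>\<bar> * \<bar>Y w\<bar> ^ 3) \<le> \<bar>\<theta>\<bar> * (2 * B) * (Y w)\<^sup>2" by (simp add: mult.assoc)
  qed simp
  also have "expectation (\<lambda>w. \<bar>\<theta>\<bar> * (2 * B) * (Y w)\<^sup>2) = \<bar>\<theta>\<bar> * (2 * B) * s"
    unfolding integral_mult_right_zero EY2 ..
  also have "(\<theta>\<^sup>2 / 6) * (\<bar>\<theta>\<bar> * (2 * B) * s) = \<bar>\<theta>\<bar> ^ 3 * B / 3 * s"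
    by (simp add: power3_eq_cube power2_eq_square)
  also have "\<dots> \<le> \<bar>\<theta>\<bar> ^ 3 * B / 3 * q" using qs B0 by (intro mult_left_mono) auto
  finally have 1: "norm (char (distr M borel Y) \<theta> - (1 - \<theta>\<^sup>2 * s / 2)) \<le> \<bar>\<theta>\<bar> ^ 3 * B / 3 * q" .
  have "\<bar>exp (- (\<theta>\<^sup>2 * s / 2)) - (1 - \<theta>\<^sup>2 * s / 2)\<bar> \<le> (\<theta>\<^sup>2 * s / 2)\<^sup>2 / 2"
    using s0 by (intro abs_exp_minus_taylor) auto
  also have "\<dots> = \<theta> ^ 4 / 8 * (s * s)" by (simp add: power2_eq_square power4_eq_xxxx)
  also have "\<dots> \<le> \<theta> ^ 4 / 8 * (B\<^sup>2 * q)"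
    using s0 qs qB by (intro mult_left_mono mult_mono) auto
  finally have 2: "norm (complex_of_real (exp (- (\<theta>\<^sup>2 * s / 2))) - (1 - \<theta>\<^sup>2 * s / 2)) \<le> \<theta> ^ 4 / 8 * (B\<^sup>2 * q)"
    by (metis norm_of_real of_real_1 of_real_diff)
  have "norm (char (distr M borel Y) \<theta> - of_real (exp (- (\<theta>\<^sup>2 * s / 2)))) \<le>
    norm (char (distr M borel Y) \<theta> - (1 - \<theta>\<^sup>2 * s / 2)) + norm (complex_of_real (exp (- (\<theta>\<^sup>2 * s / 2))) - (1 - \<theta>\<^sup>2 * s / 2))"
    using norm_triangle_ineq4[of "char (distr M borel Y) \<theta> - (1 - \<theta>\<^sup>2 * s / 2)" "complex_of_real (exp (- (\<theta>\<^sup>2 * s / 2))) - (1 - \<theta>\<^sup>2 * s / 2)"]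
    by simp
  also have "\<dots> \<le> \<bar>\<theta>\<bar> ^ 3 * B / 3 * q + \<theta> ^ 4 / 8 * (B\<^sup>2 * q)" by (rule add_mono[OF 1 2])
  finally have fin: "norm (char (distr M borel Y) \<theta> - of_real (exp (- (\<theta>\<^sup>2 * s / 2))))
    \<le> \<bar>\<theta>\<bar> ^ 3 * B / 3 * q + \<theta> ^ 4 / 8 * (B\<^sup>2 * q)" .
  show "norm (expectation (\<lambda>w. iexp (\<theta> * X w)) * iexp (- \<theta> * g) - of_real (exp (- \<theta>\<^sup>2 * (q - g\<^sup>2) / 2)))
      \<le> (\<bar>\<theta>\<bar> ^ 3 * B / 3 + \<theta> ^ 4 * B\<^sup>2 / 8) * q"
  proof -
    have "- \<theta>\<^sup>2 * (q - g\<^sup>2) / 2 = - (\<theta>\<^sup>2 * s / 2)" by (simp add: s_def)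
    moreover have "(\<bar>\<theta>\<bar> ^ 3 * B / 3 + \<theta> ^ 4 * B\<^sup>2 / 8) * q = \<bar>\<theta>\<bar> ^ 3 * B / 3 * q + \<theta> ^ 4 / 8 * (B\<^sup>2 * q)"
      by (simp add: algebra_simps)
    ultimately show ?thesis using fin
      by (simp only: char_eq)
  qed
qed

text \<open>For every \<open>V \<ge> 0\<close> the law is that of \<open>sqrt V\<close> times a
  standard normal variable, the case \<open>V = 0\<close> giving a constant. The degenerate limit
  thus needs no separate treatment afterwards.\<close>

lemma
  assumes V: "V \<ge> 0"
  shows real_distribution_centered_normal: "real_distribution (centered_normal V)"
    and char_centered_normal: "char (centered_normal V) t = of_real (exp (- t\<^sup>2 * V / 2))"
proof -
  interpret std: prob_space std_normal_distribution
    by (rule prob_space_normal_density) simp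
  have eq: "centered_normal V = distr std_normal_distribution borel (\<lambda>x. sqrt V * x)"
  proof (cases "V = 0")
    case True
    then show ?thesis by (simp add: centered_normal_def std.distr_const)
  next
    case False
    have "distributed std_normal_distribution lborel (\<lambda>x. x) std_normal_density"
      by (auto simp: distributed_def distr_id2)
    then have "distributed std_normal_distribution lborel (\<lambda>x. 0 + sqrt V * x) (normal_density (0 + sqrt V * 0) (\<bar>sqrt V\<bar> * 1))"
      by (rule std.normal_density_affine) (use V False in auto)
    then have "distr std_normal_distribution lborel (\<lambda>x. sqrt V * x) = density lborel (normal_density 0 (sqrt V))"
      using V by (simp add: distributed_def)
    moreover have "distr std_normal_distribution lborel (\<lambda>x. sqrt V * x) = distr std_normal_distribution borel (\<lambda>x. sqrt V * x)"
      by (rule distr_cong) auto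
    ultimately show ?thesis using False by (simp add: centered_normal_def)
  qed
  show "real_distribution (centered_normal V)" unfolding eq by (rule std.real_distribution_distr) simp
  have "char (centered_normal V) t = char std_normal_distribution (t * sqrt V)"
    unfolding eq char_def by (subst integral_distr) (auto simp: mult.assoc)
  then show "char (centered_normal V) t = of_real (exp (- t\<^sup>2 * V / 2))"
    using V by (simp add: char_std_normal_distribution power_mult_distrib)
qed

section \<open>Characteristic function of the radial statistic\<close>

context
  fixes M :: "'w measure" and G :: "'w \<Rightarrow> complex set" and f :: "real \<Rightarrow> real" and B L :: real
  assumes gin: "ginibre_ensemble M G" and f[measurable]: "f \<in> borel_measurable borel"
    and B: "\<And>x. \<bar>f x\<bar> \<le> B" and L: "L > 0" and supp: "\<And>x. \<bar>x\<bar> > L \<Longrightarrow> f x = 0"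
begin

text \<open>Points of modulus at least \<open>b\<close> lie at a distance above \<open>L\<close>
  from radius \<open>R\<close>, and only finitely many points remain; the infinite sum is therefore
  an honest finite one. The absolute value of \<open>R\<close> covers all signs of
  \<open>R\<close>.\<close>

lemma radial_stat_eq:
  assumes w: "w \<in> space M" and b: "b \<ge> \<bar>R\<bar> + L + 1"
  shows "(\<Sum>\<^sub>\<infinity>z\<in>G w. f (norm z - R)) = (\<Sum>z\<in>G w \<inter> annulus {0..<b}. f (norm z - R))"
proof -
  interpret determinantal_process M G lborel ginibre_kernel
    using gin by (simp add: ginibre_ensemble_def)
  have "finite (G w \<inter> annulus {0..<b})"
  proof (rule finite_subset)
    show "G w \<inter> annulus {0..<b} \<subseteq> G w \<inter> cball 0 b" by auto
    show "finite (G w \<inter> cball 0 b)" using w by (intro locally_finite) auto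
  qed
  moreover have "infsum (\<lambda>z. f (norm z - R)) (G w) = infsum (\<lambda>z. f (norm z - R)) (G w \<inter> annulus {0..<b})"
  proof (rule infsum_cong_neutral)
    fix z assume "z \<in> G w - G w \<inter> annulus {0..<b}"
    then have "norm z \<ge> b" by auto
    then show "f (norm z - R) = 0" using b by (intro supp) linarith
  qed auto
  ultimately show ?thesis by simp
qed

lemma measurable_radial_stat:
  "(\<lambda>w. \<Sum>\<^sub>\<infinity>z\<in>G w. f (norm z - R)) \<in> borel_measurable M"
proof -
  define b where "b = \<bar>R\<bar> + L + 1"
  \<comment> \<open>For small or negative \<open>R\<close> the shifted support may extend below 0.
    The indicator makes \<open>h\<close> vanish off \<open>{0..<b}\<close> and leaves its values at
    the moduli of the counted points unchanged.\<close>
  define h where "h r = indicator {0..<b} r * f (r - R)" for r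
  have "(\<lambda>w. \<Sum>z\<in>G w \<inter> annulus {0..<b}. h (norm z)) \<in> borel_measurable M"
  proof (rule measurable_ginibre_radial_sum[OF gin])
    show "h \<in> borel_measurable borel" unfolding h_def by measurable
  qed (use L in \<open>auto simp: b_def h_def\<close>)
  moreover have "(\<Sum>z\<in>G w \<inter> annulus {0..<b}. h (norm z)) = (\<Sum>\<^sub>\<infinity>z\<in>G w. f (norm z - R))" if "w \<in> space M" for w
    by (subst radial_stat_eq[OF that, of R b]) (auto simp: b_def h_def intro!: sum.cong)
  ultimately show ?thesis by (subst measurable_cong) (auto elim: back_subst)
qed

text \<open>For the first \<open>T\<close> modes, a product of centred characteristic functions is
  compared with a product of Gaussian ones. All factors have norm at most 1, so the errors add up,
  and their sum is bounded by the full sum of second moments. The bound is free of \<open>T\<close>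
  and passes to the process.\<close>

lemma radial_char_estimate:
  assumes R: "R > L"
  defines "V \<equiv> (\<Sum>n. (LINT z|mode_law n. (f (norm z - R))\<^sup>2) - (LINT z|mode_law n. f (norm z - R))\<^sup>2)"
  shows "norm ((LINT w|M. iexp (\<theta> * (\<Sum>\<^sub>\<infinity>z\<in>G w. f (norm z - R))))
        * iexp (- \<theta> * (2 * R * (LINT x|lborel. f x) + 2 * (LINT x|lborel. x * f x))) - of_real (exp (- \<theta>\<^sup>2 * V / 2)))
      \<le> (\<bar>\<theta>\<bar> ^ 3 * B / 3 + \<theta> ^ 4 * B\<^sup>2 / 8) * (2 * R * (LINT x|lborel. (f x)\<^sup>2) + 2 * (LINT x|lborel. x * (f x)\<^sup>2))"
proof -
  note loc = f B L supp
  define b where "b = R + L + 1"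
  define g where "g n = (LINT z|mode_law n. f (norm z - R))" for n
  define q where "q n = (LINT z|mode_law n. (f (norm z - R))\<^sup>2)" for n
  define \<psi> where "\<psi> n = (LINT z|mode_law n. iexp (\<theta> * f (norm z - R)))" for n
  define C where "C = \<bar>\<theta>\<bar> ^ 3 * B / 3 + \<theta> ^ 4 * B\<^sup>2 / 8"
  have B0: "B \<ge> 0" using B[of 0] by linarith
  have C0: "C \<ge> 0" using B0 by (simp add: C_def)
  let ?m1 = "2 * R * (LINT x|lborel. f x) + 2 * (LINT x|lborel. x * f x)"
  let ?m2 = "2 * R * (LINT x|lborel. (f x)\<^sup>2) + 2 * (LINT x|lborel. x * (f x)\<^sup>2)"
  have g_sums: "g sums ?m1"
    unfolding g_def by (rule mode_law_shifted_sums(1)[OF loc f B supp integrable_compact_support[OF loc] integrable_compact_support_moment(1)[OF loc] R])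
  have q_sums: "q sums ?m2"
    unfolding q_def
  proof (rule mode_law_shifted_sums(1)[OF loc _ _ _ integrable_compact_support_sq[OF loc] integrable_compact_support_moment(2)[OF loc] R, where C="B\<^sup>2"])
    show "\<bar>(f x)\<^sup>2\<bar> \<le> B\<^sup>2" for x using power_mono[OF B[of x], of 2] by simp
  qed (use supp in auto)
  have V_sums: "(\<lambda>n. q n - (g n)\<^sup>2) sums V"
  proof -
    have "summable (\<lambda>n. q n - (g n)\<^sup>2)"
      using sums_diff[OF q_sums mode_law_mean_sq_sums[OF loc R, folded g_def]] by (rule sums_summable)
    then show ?thesis unfolding V_def q_def g_def by (rule summable_sums)
  qed
  have est: "norm (\<psi> n * iexp (- \<theta> * g n) - of_real (exp (- \<theta>\<^sup>2 * (q n - (g n)\<^sup>2) / 2))) \<le> C * q n"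
    and var0: "0 \<le> q n - (g n)\<^sup>2" for n
  proof -
    interpret prob_space "mode_law n" by (rule prob_space_mode_law)
    have X: "(\<lambda>z. f (norm z - R)) \<in> borel_measurable (mode_law n)" by measurable
    show "norm (\<psi> n * iexp (- \<theta> * g n) - of_real (exp (- \<theta>\<^sup>2 * (q n - (g n)\<^sup>2) / 2))) \<le> C * q n"
      unfolding \<psi>_def g_def q_def C_def by (rule char_centered_bounded_approx(1)[OF X B])
    show "0 \<le> q n - (g n)\<^sup>2"
      unfolding g_def q_def by (rule char_centered_bounded_approx(2)[OF X B])
  qed
  have q0: "q n \<ge> 0" for n by (simp add: q_def)
  have \<psi>1: "norm (\<psi> n) \<le> 1" for n
    unfolding \<psi>_def by (rule norm_mode_law_integral_le) auto
  have finite_T: "norm ((\<Prod>n<T. \<psi> n) * iexp (- \<theta> * (\<Sum>n<T. g n)) - of_real (exp (- \<theta>\<^sup>2 * (\<Sum>n<T. q n - (g n)\<^sup>2) / 2))) \<le> C * ?m2" for T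
  proof -
    have 1: "(\<Prod>n<T. \<psi> n) * iexp (- \<theta> * (\<Sum>n<T. g n)) = (\<Prod>n<T. \<psi> n * iexp (- \<theta> * g n))"
      by (simp add: prod.distrib exp_sum[symmetric] sum_distrib_left sum_negf)
    have 2: "complex_of_real (exp (- \<theta>\<^sup>2 * (\<Sum>n<T. q n - (g n)\<^sup>2) / 2)) = (\<Prod>n<T. of_real (exp (- \<theta>\<^sup>2 * (q n - (g n)\<^sup>2) / 2)))"
    proof -
      have "- \<theta>\<^sup>2 * (\<Sum>n<T. q n - (g n)\<^sup>2) / 2 = (\<Sum>n<T. - \<theta>\<^sup>2 * (q n - (g n)\<^sup>2) / 2)"
        unfolding sum_distrib_left sum_divide_distrib ..
      then show ?thesis by (simp only: exp_sum[OF finite_lessThan] of_real_prod)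
    qed
    have "norm ((\<Prod>n<T. \<psi> n * iexp (- \<theta> * g n)) - (\<Prod>n<T. of_real (exp (- \<theta>\<^sup>2 * (q n - (g n)\<^sup>2) / 2))))
      \<le> (\<Sum>n<T. norm (\<psi> n * iexp (- \<theta> * g n) - of_real (exp (- \<theta>\<^sup>2 * (q n - (g n)\<^sup>2) / 2))))"
    proof (rule norm_prod_diff)
      show "norm (\<psi> n * iexp (- \<theta> * g n)) \<le> 1" for n using \<psi>1[of n] by (simp add: norm_mult)
      show "norm (complex_of_real (exp (- \<theta>\<^sup>2 * (q n - (g n)\<^sup>2) / 2))) \<le> 1" for n
        using var0[of n] by (simp add: mult_nonneg_nonneg)
    qed
    also have "\<dots> \<le> (\<Sum>n<T. C * q n)" by (intro sum_mono est)
    also have "\<dots> = C * (\<Sum>n<T. q n)" by (rule sum_distrib_left[symmetric])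
    also have "\<dots> \<le> C * ?m2"
      using q_sums q0 sum_le_suminf[of q "{..<T}"] C0 by (intro mult_left_mono) (auto simp: sums_iff)
    finally show ?thesis unfolding 1 2 .
  qed
  have \<psi>_lim: "(\<lambda>T. \<Prod>n<T. \<psi> n) \<longlonglongrightarrow> (LINT w|M. iexp (\<theta> * (\<Sum>\<^sub>\<infinity>z\<in>G w. f (norm z - R))))"
  proof -
    have "(\<lambda>T. \<Prod>n<T. LINT z|mode_law n. iexp (\<theta> * f (norm z - R)))
      \<longlonglongrightarrow> (LINT w|M. iexp (\<Sum>z\<in>G w \<inter> annulus {0..<b}. \<theta> * f (norm z - R)))"
    proof (rule ginibre_radial_char[OF gin])
      show "\<theta> * f (r - R) = 0" if "r \<notin> {0..<b}" for r
        using that R L by (subst supp) (auto simp: b_def)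
    qed (use R L in \<open>auto simp: b_def\<close>)
    moreover have "(LINT w|M. iexp (\<Sum>z\<in>G w \<inter> annulus {0..<b}. \<theta> * f (norm z - R)))
      = (LINT w|M. iexp (\<theta> * (\<Sum>\<^sub>\<infinity>z\<in>G w. f (norm z - R))))"
    proof (intro Bochner_Integration.integral_cong refl)
      fix w assume w: "w \<in> space M"
      have "(\<Sum>\<^sub>\<infinity>z\<in>G w. f (norm z - R)) = (\<Sum>z\<in>G w \<inter> annulus {0..<b}. f (norm z - R))"
        using R L by (intro radial_stat_eq[OF w]) (auto simp: b_def)
      then show "iexp (\<Sum>z\<in>G w \<inter> annulus {0..<b}. \<theta> * f (norm z - R)) = iexp (\<theta> * (\<Sum>\<^sub>\<infinity>z\<in>G w. f (norm z - R)))"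
        by (simp only: sum_distrib_left)
    qed
    ultimately show ?thesis by (simp add: \<psi>_def)
  qed
  have "(\<lambda>T. norm ((\<Prod>n<T. \<psi> n) * iexp (- \<theta> * (\<Sum>n<T. g n)) - of_real (exp (- \<theta>\<^sup>2 * (\<Sum>n<T. q n - (g n)\<^sup>2) / 2))))
    \<longlonglongrightarrow> norm ((LINT w|M. iexp (\<theta> * (\<Sum>\<^sub>\<infinity>z\<in>G w. f (norm z - R)))) * iexp (- \<theta> * ?m1) - of_real (exp (- \<theta>\<^sup>2 * V / 2)))"
    using g_sums V_sums unfolding sums_def by (intro tendsto_intros \<psi>_lim) auto
  then show ?thesis
    unfolding C_def[symmetric] by (rule LIMSEQ_le_const2) (use finite_T in blast)
qed

text \<open>At \<open>\<theta> = t / sqrt R\<close> the leading constant of the estimate is of order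
  \<open>R\<close> to the power \<open>- 3 / 2\<close>, while the sum of second moments is of order
  \<open>R\<close>; the error therefore decays like \<open>1 / sqrt R\<close>.\<close>

lemma radial_char_limit:
  "((\<lambda>R. LINT w|M. iexp (t * (1 / sqrt R * (\<Sum>\<^sub>\<infinity>z\<in>G w. f (norm z - R)) - 2 * sqrt R * (LINT x|lborel. f x))))
    \<longlongrightarrow> of_real (exp (- t\<^sup>2 * limit_variance f / 2))) at_top"
proof -
  note loc = f B L supp
  define I where "I = (LINT x|lborel. f x)"
  define J where "J = (LINT x|lborel. x * f x)"
  define I2 where "I2 = (LINT x|lborel. (f x)\<^sup>2)"
  define J2 where "J2 = (LINT x|lborel. x * (f x)\<^sup>2)"
  define V where "V R = (\<Sum>n. (LINT z|mode_law n. (f (norm z - R))\<^sup>2) - (LINT z|mode_law n. f (norm z - R))\<^sup>2)" for R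
  define S where "S R w = (\<Sum>\<^sub>\<infinity>z\<in>G w. f (norm z - R))" for R w
  define \<theta> where "\<theta> R = t / sqrt R" for R
  define Z where "Z R = (LINT w|M. iexp (\<theta> R * S R w)) * iexp (- \<theta> R * (2 * R * I + 2 * J))" for R
  have V_lim: "((\<lambda>R. V R / R) \<longlongrightarrow> limit_variance f) at_top"
    unfolding V_def by (rule variance_limit[OF loc])
  have exp_lim: "((\<lambda>R. of_real (exp (- (\<theta> R)\<^sup>2 * V R / 2))) \<longlongrightarrow> complex_of_real (exp (- t\<^sup>2 * limit_variance f / 2))) at_top"
  proof -
    have "((\<lambda>R. of_real (exp (- t\<^sup>2 * (V R / R) / 2))) \<longlongrightarrow> complex_of_real (exp (- t\<^sup>2 * limit_variance f / 2))) at_top"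
      by (intro tendsto_intros V_lim) auto
    moreover have "\<forall>\<^sub>F R in at_top. complex_of_real (exp (- t\<^sup>2 * (V R / R) / 2)) = of_real (exp (- (\<theta> R)\<^sup>2 * V R / 2))"
      using eventually_gt_at_top[of 0] by eventually_elim (simp add: \<theta>_def power_divide)
    ultimately show ?thesis by (rule Lim_transform_eventually)
  qed
  have diff_lim: "((\<lambda>R. Z R - of_real (exp (- (\<theta> R)\<^sup>2 * V R / 2))) \<longlongrightarrow> 0) at_top"
  proof (rule Lim_null_comparison)
    show "\<forall>\<^sub>F R in at_top. norm (Z R - of_real (exp (- (\<theta> R)\<^sup>2 * V R / 2))) \<le>
      (\<bar>t / sqrt R\<bar> ^ 3 * B / 3 + (t / sqrt R) ^ 4 * B\<^sup>2 / 8) * (2 * R * I2 + 2 * J2)"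
      using eventually_gt_at_top[of L]
      by eventually_elim
        (use radial_char_estimate in \<open>simp only: Z_def S_def V_def \<theta>_def I_def J_def I2_def J2_def\<close>)
    have "((\<lambda>R. (a * (1 / sqrt R) ^ 3 * B / 3 + c * (1 / sqrt R) ^ 4 * B\<^sup>2 / 8) * (2 * R * i + 2 * j)) \<longlongrightarrow> 0) at_top"
      for a c i j :: real by real_asymp
    from this[of "\<bar>t\<bar> ^ 3" "t ^ 4" I2 J2]
    have "((\<lambda>R. (\<bar>t\<bar> ^ 3 * (1 / sqrt R) ^ 3 * B / 3 + t ^ 4 * (1 / sqrt R) ^ 4 * B\<^sup>2 / 8) * (2 * R * I2 + 2 * J2)) \<longlongrightarrow> 0) at_top" .
    moreover have "\<forall>\<^sub>F R in at_top. (\<bar>t\<bar> ^ 3 * (1 / sqrt R) ^ 3 * B / 3 + t ^ 4 * (1 / sqrt R) ^ 4 * B\<^sup>2 / 8) * (2 * R * I2 + 2 * J2)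
      = (\<bar>t / sqrt R\<bar> ^ 3 * B / 3 + (t / sqrt R) ^ 4 * B\<^sup>2 / 8) * (2 * R * I2 + 2 * J2)"
      using eventually_gt_at_top[of 0] by eventually_elim (simp add: power_divide abs_divide)
    ultimately show "((\<lambda>R. (\<bar>t / sqrt R\<bar> ^ 3 * B / 3 + (t / sqrt R) ^ 4 * B\<^sup>2 / 8) * (2 * R * I2 + 2 * J2)) \<longlongrightarrow> 0) at_top"
      by (rule Lim_transform_eventually)
  qed
  have Z_lim: "(Z \<longlongrightarrow> of_real (exp (- t\<^sup>2 * limit_variance f / 2))) at_top"
    using tendsto_add[OF diff_lim exp_lim] by simp
  \<comment> \<open>The exact mean is \<open>2 * R * I + 2 * J\<close>, whereas the statement
    subtracts only the part with \<open>I\<close>. The remaining \<open>2 * J\<close>, divided by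
    \<open>sqrt R\<close>, disappears in the limit.\<close>
  have shift_lim: "((\<lambda>R. iexp (t * (2 * J / sqrt R))) \<longlongrightarrow> iexp (t * 0)) at_top"
  proof (intro tendsto_intros)
    have "((\<lambda>R. 2 * j / sqrt R) \<longlongrightarrow> 0) at_top" for j :: real by real_asymp
    then show "((\<lambda>R. 2 * J / sqrt R) \<longlongrightarrow> 0) at_top" .
  qed
  have "((\<lambda>R. Z R * iexp (t * (2 * J / sqrt R))) \<longlongrightarrow> of_real (exp (- t\<^sup>2 * limit_variance f / 2)) * iexp (t * 0)) at_top"
    by (intro tendsto_mult Z_lim shift_lim)
  moreover have "\<forall>\<^sub>F R in at_top. Z R * iexp (t * (2 * J / sqrt R)) =
    (LINT w|M. iexp (t * (1 / sqrt R * S R w - 2 * sqrt R * I)))"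
    using eventually_gt_at_top[of 0]
  proof eventually_elim
    case (elim R)
    have sq: "R / sqrt R = sqrt R" using elim by (simp add: real_div_sqrt)
    have e: "\<theta> R * s + - \<theta> R * (2 * R * I + 2 * J) + t * (2 * J / sqrt R) = t * (1 / sqrt R * s - 2 * sqrt R * I)" for s
    proof -
      have "\<theta> R * s + - \<theta> R * (2 * R * I + 2 * J) + t * (2 * J / sqrt R) = t * (1 / sqrt R * s - 2 * (R / sqrt R) * I)"
        by (simp add: \<theta>_def algebra_simps add_divide_distrib)
      then show ?thesis by (simp only: sq)
    qed
    have "Z R * iexp (t * (2 * J / sqrt R)) =
      (LINT w|M. iexp (\<theta> R * S R w) * (iexp (- \<theta> R * (2 * R * I + 2 * J)) * iexp (t * (2 * J / sqrt R))))"
      unfolding Z_def mult.assoc by (rule integral_mult_left_zero[symmetric])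
    also have "\<dots> = (LINT w|M. iexp (t * (1 / sqrt R * S R w - 2 * sqrt R * I)))"
      unfolding e[symmetric] by (intro Bochner_Integration.integral_cong refl) (simp add: exp_add[symmetric] algebra_simps)
    finally show ?case .
  qed
  ultimately have "((\<lambda>R. LINT w|M. iexp (t * (1 / sqrt R * S R w - 2 * sqrt R * I)))
    \<longlongrightarrow> of_real (exp (- t\<^sup>2 * limit_variance f / 2)) * iexp (t * 0)) at_top"
    by (rule Lim_transform_eventually)
  then show ?thesis by (simp add: S_def I_def)
qed

end

lemma limit_variance_nonneg: "limit_variance f \<ge> 0"
  unfolding limit_variance_def by (intro mult_nonneg_nonneg integral_nonneg_AE) auto

theorem theorem1p2:
  fixes M :: "'w measure" and G :: "'w \<Rightarrow> complex set" and f :: "real \<Rightarrow> real"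
  assumes "ginibre_ensemble M G"
    and "f \<in> borel_measurable borel"
    and "bounded (range f)"
    and "compact (closure {x. f x \<noteq> 0})"
  shows "converges_in_law_at_top M
    (\<lambda>R \<omega>. 1 / sqrt R * (\<Sum>\<^sub>\<infinity>z\<in>G \<omega>. f (norm z - R)) - 2 * sqrt R * (LINT x|lborel. f x))
    (centered_normal (limit_variance f))"
proof -
  interpret determinantal_process M G lborel ginibre_kernel
    using assms(1) by (simp add: ginibre_ensemble_def)
  obtain B where B: "\<bar>f x\<bar> \<le> B" for x using assms(3) by (auto simp: bounded_iff)
  have "bounded {x. f x \<noteq> 0}" using assms(4) by (simp only: compact_closure)
  then obtain a where a: "\<bar>x\<bar> \<le> a" if "f x \<noteq> 0" for x by (auto simp: bounded_iff)
  \<comment> \<open>The bound \<open>a\<close> may be nonpositive, for instance when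
    \<open>f\<close> vanishes identically; the maximum with 1 secures \<open>L > 0\<close>.\<close>
  define L where "L = max 1 a"
  have L: "L > 0" by (simp add: L_def)
  have supp: "f x = 0" if "\<bar>x\<bar> > L" for x using a[of x] that by (auto simp: L_def)
  define Y where "Y R w = 1 / sqrt R * (\<Sum>\<^sub>\<infinity>z\<in>G w. f (norm z - R)) - 2 * sqrt R * (LINT x|lborel. f x)" for R w
  have [measurable]: "Y R \<in> borel_measurable M" for R
    using measurable_radial_stat[OF assms(1,2) B L supp, of R] unfolding Y_def by measurable
  have "weak_conv_m (\<lambda>n. distr M borel (Y (r n))) (centered_normal (limit_variance f))"
    if r: "filterlim r at_top sequentially" for r :: "nat \<Rightarrow> real"
  proof (rule levy_continuity)
    show "real_distribution (distr M borel (Y (r n)))" for n by simp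
    show "real_distribution (centered_normal (limit_variance f))"
      by (rule real_distribution_centered_normal[OF limit_variance_nonneg])
    fix t
    have "(\<lambda>n. LINT w|M. iexp (t * Y (r n) w)) \<longlonglongrightarrow> of_real (exp (- t\<^sup>2 * limit_variance f / 2))"
      using filterlim_compose[OF radial_char_limit[OF assms(1,2) B L supp] r] unfolding Y_def .
    moreover have "char (distr M borel (Y (r n))) t = (LINT w|M. iexp (t * Y (r n) w))" for n
      unfolding char_def by (subst integral_distr) auto
    ultimately show "(\<lambda>n. char (distr M borel (Y (r n))) t) \<longlonglongrightarrow> char (centered_normal (limit_variance f)) t"
      by (simp add: char_centered_normal[OF limit_variance_nonneg])
  qed
  then show ?thesis
    unfolding converges_in_law_at_top_def Y_def[symmetric] by auto
qed

end
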